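(* If $X$ is an essentially finite groupoid, then the functor category $\mathrm{Rep}(X)=[X,\mathrm{Vect}]$ is a Kapranov–Voevodsky 2-vector space.
   Context: Vect is the category of finite-dimensional complex vector spaces. A groupoid is essentially finite if it is equivalent to a finite groupoid (finitely many objects and morphisms). $[X,\mathrm{Vect}]$ has as objects the functors $X\to\mathrm{Vect}$ and as morphisms the natural transformations. A $\mathbb{C}$-linear additive category is a category enriched in Vect (each $\hom(x,y)$ is a finite-dimensional complex vector space and composition is bilinear), with a zero object and finite biproducts. An object $x$ is simple if $\hom(x,x)\cong\mathbb{C}$. A Kapranov–Voevodsky 2-vector space is a $\mathbb{C}$-linear additive category which is semisimple (every object can be written as a finite biproduct of simple objects), with finitely many simple objects up to isomorphism. *)

theory Defs
  imports "Jordan_Normal_Form.VS_Connect"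
begin

section \<open>Categories, functors, natural transformations\<close>

text \<open>Hom-sets are indexed by source and target and need not be disjoint, so composition takes the
  three objects as arguments: for \<open>f\<close> from \<open>x\<close> to \<open>y\<close> and \<open>g\<close> from \<open>y\<close> to \<open>z\<close>, the composite
  "\<open>g\<close> after \<open>f\<close>" is \<open>Comp C x y z g f\<close>.\<close>

record ('o, 'm) category =
  Ob :: "'o set"
  Hom :: "'o \<Rightarrow> 'o \<Rightarrow> 'm set"
  Idt :: "'o \<Rightarrow> 'm"
  Comp :: "'o \<Rightarrow> 'o \<Rightarrow> 'o \<Rightarrow> 'm \<Rightarrow> 'm \<Rightarrow> 'm"

locale category =
  fixes C :: "('o, 'm, 'c) category_scheme"
  assumes Idt_Hom: "x \<in> Ob C \<Longrightarrow> Idt C x \<in> Hom C x x"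
    and Comp_Hom: "\<lbrakk>x \<in> Ob C; y \<in> Ob C; z \<in> Ob C; f \<in> Hom C x y; g \<in> Hom C y z\<rbrakk>
      \<Longrightarrow> Comp C x y z g f \<in> Hom C x z"
    and Comp_Idt_right: "\<lbrakk>x \<in> Ob C; y \<in> Ob C; f \<in> Hom C x y\<rbrakk> \<Longrightarrow> Comp C x x y f (Idt C x) = f"
    and Comp_Idt_left: "\<lbrakk>x \<in> Ob C; y \<in> Ob C; f \<in> Hom C x y\<rbrakk> \<Longrightarrow> Comp C x y y (Idt C y) f = f"
    and Comp_assoc: "\<lbrakk>w \<in> Ob C; x \<in> Ob C; y \<in> Ob C; z \<in> Ob C;
        f \<in> Hom C w x; g \<in> Hom C x y; h \<in> Hom C y z\<rbrakk>
      \<Longrightarrow> Comp C w x z (Comp C x y z h g) f = Comp C w y z h (Comp C w x y g f)"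

definition is_iso :: "('o, 'm, 'c) category_scheme \<Rightarrow> 'o \<Rightarrow> 'o \<Rightarrow> 'm \<Rightarrow> bool" where
  "is_iso C x y f \<longleftrightarrow> f \<in> Hom C x y \<and>
     (\<exists>g \<in> Hom C y x. Comp C x y x g f = Idt C x \<and> Comp C y x y f g = Idt C y)"

definition isomorphic :: "('o, 'm, 'c) category_scheme \<Rightarrow> 'o \<Rightarrow> 'o \<Rightarrow> bool" where
  "isomorphic C x y \<longleftrightarrow> (\<exists>f. is_iso C x y f)"

text \<open>Functors are extensional (\<open>undefined\<close> outside the source category), so that functors that
  agree on all objects and morphisms are equal.\<close>

record ('o, 'm, 'p, 'q) cat_functor =
  on_Ob :: "'o \<Rightarrow> 'p"
  on_Hom :: "'o \<Rightarrow> 'o \<Rightarrow> 'm \<Rightarrow> 'q"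

definition is_functor ::
  "('o, 'm, 'c) category_scheme \<Rightarrow> ('p, 'q, 'd) category_scheme
    \<Rightarrow> ('o, 'm, 'p, 'q) cat_functor \<Rightarrow> bool" where
  "is_functor C D F \<longleftrightarrow>
     on_Ob F \<in> Ob C \<rightarrow>\<^sub>E Ob D \<and>
     (\<forall>x y f. \<not> (x \<in> Ob C \<and> y \<in> Ob C \<and> f \<in> Hom C x y) \<longrightarrow> on_Hom F x y f = undefined) \<and>
     (\<forall>x\<in>Ob C. \<forall>y\<in>Ob C. \<forall>f\<in>Hom C x y. on_Hom F x y f \<in> Hom D (on_Ob F x) (on_Ob F y)) \<and>
     (\<forall>x\<in>Ob C. on_Hom F x x (Idt C x) = Idt D (on_Ob F x)) \<and>
     (\<forall>x\<in>Ob C. \<forall>y\<in>Ob C. \<forall>z\<in>Ob C. \<forall>f\<in>Hom C x y. \<forall>g\<in>Hom C y z.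
        on_Hom F x z (Comp C x y z g f) =
          Comp D (on_Ob F x) (on_Ob F y) (on_Ob F z) (on_Hom F y z g) (on_Hom F x y f))"

definition id_functor :: "('o, 'm, 'c) category_scheme \<Rightarrow> ('o, 'm, 'o, 'm) cat_functor" where
  "id_functor C =
     \<lparr>on_Ob = (\<lambda>x\<in>Ob C. x),
      on_Hom = (\<lambda>x y f. if x \<in> Ob C \<and> y \<in> Ob C \<and> f \<in> Hom C x y then f else undefined)\<rparr>"

definition comp_functor ::
  "('o, 'm, 'c) category_scheme \<Rightarrow> ('p, 'q, 'r, 's) cat_functor
    \<Rightarrow> ('o, 'm, 'p, 'q) cat_functor \<Rightarrow> ('o, 'm, 'r, 's) cat_functor" where
  "comp_functor C G F =
     \<lparr>on_Ob = (\<lambda>x\<in>Ob C. on_Ob G (on_Ob F x)),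
      on_Hom = (\<lambda>x y f. if x \<in> Ob C \<and> y \<in> Ob C \<and> f \<in> Hom C x y
                 then on_Hom G (on_Ob F x) (on_Ob F y) (on_Hom F x y f) else undefined)\<rparr>"

definition nat_trans ::
  "('o, 'm, 'c) category_scheme \<Rightarrow> ('p, 'q, 'd) category_scheme
    \<Rightarrow> ('o, 'm, 'p, 'q) cat_functor \<Rightarrow> ('o, 'm, 'p, 'q) cat_functor \<Rightarrow> ('o \<Rightarrow> 'q) set" where
  "nat_trans C D F G =
     {\<eta>. \<eta> \<in> (\<Pi>\<^sub>E x\<in>Ob C. Hom D (on_Ob F x) (on_Ob G x)) \<and>
         (\<forall>x\<in>Ob C. \<forall>y\<in>Ob C. \<forall>f\<in>Hom C x y.
            Comp D (on_Ob F x) (on_Ob F y) (on_Ob G y) (\<eta> y) (on_Hom F x y f) =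
            Comp D (on_Ob F x) (on_Ob G x) (on_Ob G y) (on_Hom G x y f) (\<eta> x))}"

definition nat_iso ::
  "('o, 'm, 'c) category_scheme \<Rightarrow> ('p, 'q, 'd) category_scheme
    \<Rightarrow> ('o, 'm, 'p, 'q) cat_functor \<Rightarrow> ('o, 'm, 'p, 'q) cat_functor \<Rightarrow> bool" where
  "nat_iso C D F G \<longleftrightarrow>
     (\<exists>\<eta> \<in> nat_trans C D F G. \<forall>x\<in>Ob C. is_iso D (on_Ob F x) (on_Ob G x) (\<eta> x))"

definition equivalent_categories ::
  "('o, 'm, 'c) category_scheme \<Rightarrow> ('p, 'q, 'd) category_scheme \<Rightarrow> bool" where
  "equivalent_categories C D \<longleftrightarrow>
     (\<exists>F G. is_functor C D F \<and> is_functor D C G \<and>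
        nat_iso C C (comp_functor C G F) (id_functor C) \<and>
        nat_iso D D (comp_functor D F G) (id_functor D))"


section \<open>Essentially finite groupoids\<close>

locale groupoid = category +
  assumes all_iso: "\<lbrakk>x \<in> Ob C; y \<in> Ob C; f \<in> Hom C x y\<rbrakk> \<Longrightarrow> is_iso C x y f"

definition finite_groupoid :: "('o, 'm, 'c) category_scheme \<Rightarrow> bool" where
  "finite_groupoid C \<longleftrightarrow>
     groupoid C \<and> finite (Ob C) \<and> (\<forall>x\<in>Ob C. \<forall>y\<in>Ob C. finite (Hom C x y))"

text \<open>The finite groupoid may be taken on the type of natural numbers, since types cannot be
  quantified inside a formula; by \<open>essentially_finiteI\<close> below this is no restriction.\<close>

definition essentially_finite :: "('o, 'm, 'c) category_scheme \<Rightarrow> bool" where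
  "essentially_finite C \<longleftrightarrow>
     (\<exists>D :: (nat, nat) category. finite_groupoid D \<and> equivalent_categories C D)"

lemma essentially_finiteI:
  fixes C :: "('o, 'm, 'c) category_scheme" and D :: "('p, 'q, 'd) category_scheme"
  assumes cat: "category C" and fin: "finite_groupoid D" and equiv: "equivalent_categories C D"
  shows "essentially_finite C"
proof -
  interpret C: category C by (fact cat)
  interpret D: groupoid D using fin by (simp add: finite_groupoid_def)
  define M where "M = (\<Union>x\<in>Ob D. \<Union>y\<in>Ob D. Hom D x y)"
  have "finite (Ob D)" "finite M"
    using fin by (auto simp: finite_groupoid_def M_def)
  then obtain a :: "'p \<Rightarrow> nat" and b :: "'q \<Rightarrow> nat" where inj: "inj_on a (Ob D)" "inj_on b M"
    by (meson finite_imp_inj_to_nat_seg)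
  define a' where "a' = inv_into (Ob D) a"
  define b' where "b' = inv_into M b"
  have a'a [simp]: "a' (a x) = x" if "x \<in> Ob D" for x
    using that inj by (simp add: a'_def)
  have b'b [simp]: "b' (b f) = f" if "f \<in> Hom D x y" "x \<in> Ob D" "y \<in> Ob D" for f x y
  proof -
    have "f \<in> M" using that by (auto simp: M_def)
    then show ?thesis using inj by (simp add: b'_def)
  qed
  define E :: "(nat, nat) category" where "E =
    \<lparr>Ob = a ` Ob D, Hom = (\<lambda>u v. b ` Hom D (a' u) (a' v)), Idt = (\<lambda>u. b (Idt D (a' u))),
     Comp = (\<lambda>u v w g f. b (Comp D (a' u) (a' v) (a' w) (b' g) (b' f)))\<rparr>"
  note [simp] = D.Idt_Hom D.Comp_Hom D.Comp_Idt_left D.Comp_Idt_right D.Comp_assoc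
  have E [simp]: "Ob E = a ` Ob D"
    "x \<in> Ob D \<Longrightarrow> y \<in> Ob D \<Longrightarrow> Hom E (a x) (a y) = b ` Hom D x y"
    "x \<in> Ob D \<Longrightarrow> Idt E (a x) = b (Idt D x)" for x y
    by (simp_all add: E_def)
  have E_Comp [simp]: "Comp E (a x) (a y) (a z) (b g) (b f) = b (Comp D x y z g f)"
    if "x \<in> Ob D" "y \<in> Ob D" "z \<in> Ob D" "f \<in> Hom D x y" "g \<in> Hom D y z" for x y z f g
    using that b'b[of f x y] b'b[of g y z] by (simp add: E_def)
  have catE: "category E"
    by unfold_locales auto
  have iso: "is_iso E (a x) (a y) (b f)"
    if *: "x \<in> Ob D" "y \<in> Ob D" "f \<in> Hom D x y" "is_iso D x y f" for x y f
  proof -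
    obtain g where "g \<in> Hom D y x" "Comp D x y x g f = Idt D x" "Comp D y x y f g = Idt D y"
      using * by (auto simp: is_iso_def)
    with * show ?thesis by (auto simp: is_iso_def intro!: bexI[of _ g])
  qed
  have "groupoid E"
    using catE iso D.all_iso by (auto simp: groupoid_def groupoid_axioms_def)
  with \<open>finite (Ob D)\<close> fin have finE: "finite_groupoid E"
    by (auto simp: finite_groupoid_def)
  obtain F G \<alpha> \<beta> where F: "is_functor C D F" and G: "is_functor D C G"
    and \<alpha>: "\<alpha> \<in> nat_trans C C (comp_functor C G F) (id_functor C)"
      "\<And>x. x \<in> Ob C \<Longrightarrow> is_iso C (on_Ob G (on_Ob F x)) x (\<alpha> x)"
    and \<beta>: "\<beta> \<in> nat_trans D D (comp_functor D F G) (id_functor D)"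
      "\<And>x. x \<in> Ob D \<Longrightarrow> is_iso D (on_Ob F (on_Ob G x)) x (\<beta> x)"
    using equiv by (fastforce simp: equivalent_categories_def nat_iso_def comp_functor_def id_functor_def)
  have FOb [simp]: "on_Ob F x \<in> Ob D" if "x \<in> Ob C" for x
    using F that by (auto simp: is_functor_def)
  have GOb [simp]: "on_Ob G x \<in> Ob C" if "x \<in> Ob D" for x
    using G that by (auto simp: is_functor_def)
  have FHom [simp]: "on_Hom F x y f \<in> Hom D (on_Ob F x) (on_Ob F y)"
    if "x \<in> Ob C" "y \<in> Ob C" "f \<in> Hom C x y" for x y f
    using F that by (auto simp: is_functor_def)
  have GHom [simp]: "on_Hom G x y f \<in> Hom C (on_Ob G x) (on_Ob G y)"
    if "x \<in> Ob D" "y \<in> Ob D" "f \<in> Hom D x y" for x y f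
    using G that by (auto simp: is_functor_def)
  have [simp]: "b' (b (on_Hom F x y f)) = on_Hom F x y f"
    if "x \<in> Ob C" "y \<in> Ob C" "f \<in> Hom C x y" for x y f
    using b'b[OF FHom[OF that]] that by simp
  define F' where "F' =
    \<lparr>on_Ob = (\<lambda>x\<in>Ob C. a (on_Ob F x)),
     on_Hom = (\<lambda>x y f. if x \<in> Ob C \<and> y \<in> Ob C \<and> f \<in> Hom C x y
       then b (on_Hom F x y f) else undefined)\<rparr>"
  define G' where "G' =
    \<lparr>on_Ob = (\<lambda>u\<in>Ob E. on_Ob G (a' u)),
     on_Hom = (\<lambda>u v f. if u \<in> Ob E \<and> v \<in> Ob E \<and> f \<in> Hom E u v
       then on_Hom G (a' u) (a' v) (b' f) else undefined)\<rparr>"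
  have F'_ob [simp]: "on_Ob F' x = a (on_Ob F x)" if "x \<in> Ob C" for x
    using that by (simp add: F'_def)
  have F'_hom [simp]: "on_Hom F' x y f = b (on_Hom F x y f)"
    if "x \<in> Ob C" "y \<in> Ob C" "f \<in> Hom C x y" for x y f
    using that by (simp add: F'_def)
  have G'_ob [simp]: "on_Ob G' (a x) = on_Ob G x" if "x \<in> Ob D" for x
    using that by (simp add: G'_def)
  have G'_hom [simp]: "on_Hom G' (a x) (a y) (b f) = on_Hom G x y f"
    if "x \<in> Ob D" "y \<in> Ob D" "f \<in> Hom D x y" for x y f
    using that b'b[of f x y] by (simp add: G'_def)
  have F_Idt: "on_Hom F x x (Idt C x) = Idt D (on_Ob F x)" if "x \<in> Ob C" for x
    using F that by (auto simp: is_functor_def)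
  have F_Comp: "on_Hom F x z (Comp C x y z g f) =
      Comp D (on_Ob F x) (on_Ob F y) (on_Ob F z) (on_Hom F y z g) (on_Hom F x y f)"
    if "x \<in> Ob C" "y \<in> Ob C" "z \<in> Ob C" "f \<in> Hom C x y" "g \<in> Hom C y z" for x y z f g
    using F that by (auto simp: is_functor_def)
  have F': "is_functor C E F'"
    unfolding is_functor_def
  proof (intro conjI ballI allI impI)
    show "on_Ob F' \<in> Ob C \<rightarrow>\<^sub>E Ob E"
      by (auto simp: F'_def)
  qed (auto simp: C.Idt_Hom C.Comp_Hom F_Idt F_Comp, auto simp: F'_def)
  have G_Idt: "on_Hom G x x (Idt D x) = Idt C (on_Ob G x)" if "x \<in> Ob D" for x
    using G that by (auto simp: is_functor_def)
  have G_Comp: "on_Hom G x z (Comp D x y z g f) =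
      Comp C (on_Ob G x) (on_Ob G y) (on_Ob G z) (on_Hom G y z g) (on_Hom G x y f)"
    if "x \<in> Ob D" "y \<in> Ob D" "z \<in> Ob D" "f \<in> Hom D x y" "g \<in> Hom D y z" for x y z f g
    using G that by (auto simp: is_functor_def)
  have G': "is_functor E C G'"
    unfolding is_functor_def
  proof (intro conjI ballI allI impI)
    show "on_Ob G' \<in> Ob E \<rightarrow>\<^sub>E Ob C"
      by (auto simp: G'_def)
  qed (auto simp: G_Idt G_Comp, auto simp: G'_def)
  have "\<alpha> \<in> nat_trans C C (comp_functor C G' F') (id_functor C)"
    using \<alpha>(1) by (auto simp: nat_trans_def comp_functor_def id_functor_def PiE_iff)
  with \<alpha>(2) have \<alpha>': "nat_iso C C (comp_functor C G' F') (id_functor C)"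
    by (auto simp: nat_iso_def comp_functor_def id_functor_def)
  define \<beta>' where "\<beta>' = (\<lambda>u\<in>Ob E. b (\<beta> (a' u)))"
  have \<beta>'_a [simp]: "\<beta>' (a x) = b (\<beta> x)" if "x \<in> Ob D" for x
    using that by (simp add: \<beta>'_def)
  have \<beta>_Hom [simp]: "\<beta> x \<in> Hom D (on_Ob F (on_Ob G x)) x" if "x \<in> Ob D" for x
    using \<beta>(2)[OF that] by (simp add: is_iso_def)
  have \<beta>_nat: "Comp D (on_Ob F (on_Ob G x)) (on_Ob F (on_Ob G y)) y (\<beta> y)
        (on_Hom F (on_Ob G x) (on_Ob G y) (on_Hom G x y f)) =
      Comp D (on_Ob F (on_Ob G x)) x y f (\<beta> x)"
    if "x \<in> Ob D" "y \<in> Ob D" "f \<in> Hom D x y" for x y f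
    using \<beta>(1) that by (auto simp: nat_trans_def comp_functor_def id_functor_def)
  have "\<beta>' \<in> nat_trans E E (comp_functor E F' G') (id_functor E)"
    unfolding nat_trans_def
  proof (intro CollectI conjI ballI)
    show "\<beta>' \<in> (\<Pi>\<^sub>E u\<in>Ob E. Hom E (on_Ob (comp_functor E F' G') u) (on_Ob (id_functor E) u))"
      by (auto simp: comp_functor_def id_functor_def) (simp add: \<beta>'_def)
  next
    fix u v f assume *: "u \<in> Ob E" "v \<in> Ob E" "f \<in> Hom E u v"
    then obtain x y g where [simp]: "u = a x" "v = a y" "f = b g"
      and xy: "x \<in> Ob D" "y \<in> Ob D" "g \<in> Hom D x y"
      by auto
    show "Comp E (on_Ob (comp_functor E F' G') u) (on_Ob (comp_functor E F' G') v)
        (on_Ob (id_functor E) v) (\<beta>' v) (on_Hom (comp_functor E F' G') u v f) =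
      Comp E (on_Ob (comp_functor E F' G') u) (on_Ob (id_functor E) u)
        (on_Ob (id_functor E) v) (on_Hom (id_functor E) u v f) (\<beta>' u)"
      using xy by (simp add: comp_functor_def id_functor_def \<beta>_nat)
  qed
  moreover have "is_iso E (on_Ob (comp_functor E F' G') u) (on_Ob (id_functor E) u) (\<beta>' u)"
    if "u \<in> Ob E" for u
    using that \<beta>(2) by (auto simp: comp_functor_def id_functor_def intro!: iso)
  ultimately have "nat_iso E E (comp_functor E F' G') (id_functor E)"
    by (auto simp: nat_iso_def)
  with finE F' G' \<alpha>' show ?thesis
    by (auto simp: essentially_finite_def equivalent_categories_def)
qed

section \<open>Linear categories and 2-vector spaces\<close>

text \<open>The \<open>mult\<close> and \<open>one\<close> fields that module records inherit from ring records play no role for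
  vector spaces.\<close>

definition mk_vs :: "'v set \<Rightarrow> 'v \<Rightarrow> ('v \<Rightarrow> 'v \<Rightarrow> 'v) \<Rightarrow> (complex \<Rightarrow> 'v \<Rightarrow> 'v) \<Rightarrow> (complex, 'v) module" where
  "mk_vs A z p s =
     \<lparr>carrier = A, mult = undefined, one = undefined, zero = z, add = p, smult = s\<rparr>"

definition fd_vs :: "(complex, 'v) module \<Rightarrow> bool" where
  "fd_vs V \<longleftrightarrow> vectorspace class_ring V \<and> vectorspace.fin_dim class_ring V"

abbreviation linear_maps :: "(complex, 'v) module \<Rightarrow> (complex, 'w) module \<Rightarrow> ('v \<Rightarrow> 'w) set" where
  "linear_maps V W \<equiv> LinearCombinations.module_hom class_ring V W"

record ('o, 'm) linear_category = "('o, 'm) category" +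
  Hom_vs :: "'o \<Rightarrow> 'o \<Rightarrow> (complex, 'm) module"

locale linear_category = category C for C :: "('o, 'm, 'c) linear_category_scheme" +
  assumes carrier_Hom_vs: "\<lbrakk>x \<in> Ob C; y \<in> Ob C\<rbrakk> \<Longrightarrow> carrier (Hom_vs C x y) = Hom C x y"
    and fd_vs_Hom_vs: "\<lbrakk>x \<in> Ob C; y \<in> Ob C\<rbrakk> \<Longrightarrow> fd_vs (Hom_vs C x y)"
    and Comp_linear_right: "\<lbrakk>x \<in> Ob C; y \<in> Ob C; z \<in> Ob C; g \<in> Hom C y z\<rbrakk>
      \<Longrightarrow> (\<lambda>f. Comp C x y z g f) \<in> linear_maps (Hom_vs C x y) (Hom_vs C x z)"
    and Comp_linear_left: "\<lbrakk>x \<in> Ob C; y \<in> Ob C; z \<in> Ob C; f \<in> Hom C x y\<rbrakk>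
      \<Longrightarrow> (\<lambda>g. Comp C x y z g f) \<in> linear_maps (Hom_vs C y z) (Hom_vs C x z)"

definition is_zero_object :: "('o, 'm, 'c) category_scheme \<Rightarrow> 'o \<Rightarrow> bool" where
  "is_zero_object C z \<longleftrightarrow>
     z \<in> Ob C \<and> (\<forall>x\<in>Ob C. (\<exists>!f. f \<in> Hom C x z) \<and> (\<exists>!f. f \<in> Hom C z x))"

text \<open>\<open>b\<close> is a biproduct of the finite family \<open>s 0, \<dots>, s (n - 1)\<close>, with injections \<open>\<iota> i\<close> and
  projections \<open>\<pi> i\<close>.\<close>

definition is_biproduct ::
  "('o, 'm, 'c) linear_category_scheme \<Rightarrow> nat \<Rightarrow> (nat \<Rightarrow> 'o) \<Rightarrow> 'o \<Rightarrow> bool" where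
  "is_biproduct C n s b \<longleftrightarrow>
     (\<forall>i<n. s i \<in> Ob C) \<and> b \<in> Ob C \<and>
     (\<exists>\<iota> \<pi>.
        (\<forall>i<n. \<iota> i \<in> Hom C (s i) b \<and> \<pi> i \<in> Hom C b (s i)) \<and>
        (\<forall>i<n. \<forall>j<n. Comp C (s i) b (s j) (\<pi> j) (\<iota> i) =
           (if i = j then Idt C (s i) else \<zero>\<^bsub>Hom_vs C (s i) (s j)\<^esub>)) \<and>
        (\<Oplus>\<^bsub>Hom_vs C b b\<^esub>i\<in>{..<n}. Comp C b (s i) b (\<iota> i) (\<pi> i)) = Idt C b)"

locale linear_additive_category = linear_category +
  assumes ex_zero_object: "\<exists>z. is_zero_object C z"
    and ex_biproduct: "(\<And>i. i < n \<Longrightarrow> s i \<in> Ob C) \<Longrightarrow> \<exists>b. is_biproduct C n s b"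

definition complex_vs :: "(complex, complex) module" where
  "complex_vs = mk_vs UNIV 0 (+) (*)"

definition simple_object :: "('o, 'm, 'c) linear_category_scheme \<Rightarrow> 'o \<Rightarrow> bool" where
  "simple_object C x \<longleftrightarrow>
     x \<in> Ob C \<and>
     (\<exists>\<phi> \<in> linear_maps (Hom_vs C x x) complex_vs.
        bij_betw \<phi> (carrier (Hom_vs C x x)) (carrier complex_vs))"

locale KV_2_vector_space = linear_additive_category +
  assumes semisimple:
      "x \<in> Ob C \<Longrightarrow> \<exists>n s. (\<forall>i<n. simple_object C (s i)) \<and> is_biproduct C n s x"
    and finitely_many_simples:
      "\<exists>S. finite S \<and> (\<forall>s\<in>S. simple_object C s) \<and>
         (\<forall>x. simple_object C x \<longrightarrow> (\<exists>s\<in>S. isomorphic C x s))"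


section \<open>The category of finite-dimensional complex vector spaces\<close>

text \<open>The objects are all finite-dimensional complex vector spaces whose carrier is a subset of the
  type \<open>'v\<close>, which plays the role of the universe of sets. If \<open>'v\<close> has at least the cardinality of
  the continuum, every finite dimension occurs; for smaller types there are only zero spaces. Linear
  maps are taken extensional on their domain.\<close>

definition Vect :: "((complex, 'v) module, 'v \<Rightarrow> 'v) linear_category" where
  "Vect =
     (let L = (\<lambda>V W. linear_maps V W \<inter> extensional (carrier V)) in
     \<lparr>Ob = {V. fd_vs V},
      Hom = L,
      Idt = (\<lambda>V. \<lambda>v\<in>carrier V. v),
      Comp = (\<lambda>U V W g f. compose (carrier U) g f),
      Hom_vs = (\<lambda>V W. mk_vs (L V W)
                 (\<lambda>v\<in>carrier V. \<zero>\<^bsub>W\<^esub>)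
                 (\<lambda>f g. \<lambda>v\<in>carrier V. f v \<oplus>\<^bsub>W\<^esub> g v)
                 (\<lambda>c f. \<lambda>v\<in>carrier V. c \<odot>\<^bsub>W\<^esub> f v))\<rparr>)"


section \<open>Functor categories\<close>

text \<open>For a linear category \<open>D\<close>, the functors from \<open>C\<close> to \<open>D\<close> and their natural transformations,
  with the pointwise linear structure on the latter.\<close>

definition functor_category ::
  "('o, 'm, 'c) category_scheme \<Rightarrow> ('p, 'q, 'd) linear_category_scheme
    \<Rightarrow> (('o, 'm, 'p, 'q) cat_functor, 'o \<Rightarrow> 'q) linear_category" where
  "functor_category C D =
     \<lparr>Ob = {F. is_functor C D F},
      Hom = nat_trans C D,
      Idt = (\<lambda>F. \<lambda>x\<in>Ob C. Idt D (on_Ob F x)),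
      Comp = (\<lambda>F G H \<beta> \<alpha>. \<lambda>x\<in>Ob C. Comp D (on_Ob F x) (on_Ob G x) (on_Ob H x) (\<beta> x) (\<alpha> x)),
      Hom_vs = (\<lambda>F G. mk_vs (nat_trans C D F G)
                 (\<lambda>x\<in>Ob C. \<zero>\<^bsub>Hom_vs D (on_Ob F x) (on_Ob G x)\<^esub>)
                 (\<lambda>\<alpha> \<beta>. \<lambda>x\<in>Ob C. \<alpha> x \<oplus>\<^bsub>Hom_vs D (on_Ob F x) (on_Ob G x)\<^esub> \<beta> x)
                 (\<lambda>c \<alpha>. \<lambda>x\<in>Ob C. c \<odot>\<^bsub>Hom_vs D (on_Ob F x) (on_Ob G x)\<^esub> \<alpha> x))\<rparr>"

definition Rep ::
  "('o, 'm, 'c) category_scheme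
    \<Rightarrow> (('o, 'm, (complex, 'v) module, 'v \<Rightarrow> 'v) cat_functor, 'o \<Rightarrow> 'v \<Rightarrow> 'v) linear_category" where
  "Rep X = functor_category X Vect"

end

theory Submission
  imports Defs "Jordan_Normal_Form.Spectral_Radius" "HOL-Library.Function_Algebras"
begin

text \<open>Call a linear category regular if every morphism \<open>f\<close> has a quasi-inverse \<open>g\<close>, \<open>f g f = f\<close>.
  In a regular linear category with split idempotents and finite biproducts, a non-scalar endomorphism
  minus one of its eigenvalues is a nonzero non-invertible \<open>n\<close>, and \<open>g n\<close> is a proper idempotent, so
  that every object decomposes into simple ones by induction on the dimension of its endomorphism space.
  A nonzero map between simple objects is invertible, hence there are finitely many of them as soon as
  finitely many objects cogenerate. All these properties pass from \<open>Vect\<close> to functors into it: splittings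
  and biproducts are formed pointwise, quasi-inverses are averaged over the groupoid, and the functors
  coinduced from the representatives of the isomorphism classes cogenerate.\<close>

section \<open>Complex vector spaces\<close>

text \<open>Regularity is the working form of semisimplicity because g |-> f g f is linear: if
  several g satisfy f g f = f, so does their mean. Quasi-inverses can therefore be averaged over
  finite hom-sets, the number of morphisms being invertible in the complex numbers. No kernels,
  cokernels or invariant complements are constructed; the only subobjects needed are images of
  idempotents.

  Two obstacles shape the rest. An essentially finite groupoid may have infinitely many objects, so
  finiteness comes from representatives of the isomorphism classes: natural transformations are
  determined by their components there, and averages run over the finitely many morphisms from an
  object to its representative. And \<open>Vect\<close> contains only spaces carried by subsets of
  \<open>'v\<close>, a type that may be too small for the complex line and does not literally
  contain pairs: functionals take values in the separate space \<open>complex_vs\<close>, direct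
  sums are re-encoded, and the cogenerator is an arbitrary nonzero space, if there is one.\<close>

abbreviation complex_vectorspace :: "(complex, 'v) module \<Rightarrow> bool" where
  "complex_vectorspace V \<equiv> vectorspace class_ring V"

text \<open>Additive inverses come from the scalar -1, since v + (-1) v = (1 + -1) v = 0 v. The
  pointwise structures built later specify no negation, so this is their convenient entry
  point.\<close>

lemma complex_vectorspaceI:
  fixes V :: "(complex, 'v) module"
  assumes "\<zero>\<^bsub>V\<^esub> \<in> carrier V"
    and "\<And>v w. v \<in> carrier V \<Longrightarrow> w \<in> carrier V \<Longrightarrow> v \<oplus>\<^bsub>V\<^esub> w \<in> carrier V"
    and "\<And>c v. v \<in> carrier V \<Longrightarrow> c \<odot>\<^bsub>V\<^esub> v \<in> carrier V"
    and "\<And>v w. v \<in> carrier V \<Longrightarrow> w \<in> carrier V \<Longrightarrow> v \<oplus>\<^bsub>V\<^esub> w = w \<oplus>\<^bsub>V\<^esub> v"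
    and "\<And>u v w. u \<in> carrier V \<Longrightarrow> v \<in> carrier V \<Longrightarrow> w \<in> carrier V \<Longrightarrow>
      (u \<oplus>\<^bsub>V\<^esub> v) \<oplus>\<^bsub>V\<^esub> w = u \<oplus>\<^bsub>V\<^esub> (v \<oplus>\<^bsub>V\<^esub> w)"
    and zero: "\<And>v. v \<in> carrier V \<Longrightarrow> v \<oplus>\<^bsub>V\<^esub> \<zero>\<^bsub>V\<^esub> = v"
    and smult0: "\<And>v. v \<in> carrier V \<Longrightarrow> 0 \<odot>\<^bsub>V\<^esub> v = \<zero>\<^bsub>V\<^esub>"
    and one: "\<And>v. v \<in> carrier V \<Longrightarrow> 1 \<odot>\<^bsub>V\<^esub> v = v"
    and "\<And>a b v. v \<in> carrier V \<Longrightarrow> (a * b) \<odot>\<^bsub>V\<^esub> v = a \<odot>\<^bsub>V\<^esub> (b \<odot>\<^bsub>V\<^esub> v)"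
    and dist: "\<And>a b v. v \<in> carrier V \<Longrightarrow> (a + b) \<odot>\<^bsub>V\<^esub> v = a \<odot>\<^bsub>V\<^esub> v \<oplus>\<^bsub>V\<^esub> b \<odot>\<^bsub>V\<^esub> v"
    and "\<And>a v w. v \<in> carrier V \<Longrightarrow> w \<in> carrier V \<Longrightarrow>
      a \<odot>\<^bsub>V\<^esub> (v \<oplus>\<^bsub>V\<^esub> w) = a \<odot>\<^bsub>V\<^esub> v \<oplus>\<^bsub>V\<^esub> a \<odot>\<^bsub>V\<^esub> w"
  shows "complex_vectorspace V"
proof -
  have "\<exists>w\<in>carrier V. v \<oplus>\<^bsub>V\<^esub> w = \<zero>\<^bsub>V\<^esub>" if "v \<in> carrier V" for v
    using that assms dist[of v 1 "-1"] by (intro bexI[of _ "(-1) \<odot>\<^bsub>V\<^esub> v"]) auto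
  with assms show ?thesis
    by (intro vs_criteria) (auto simp: class_field)
qed

text \<open>Module laws phrased with the operations of the type \<open>complex\<close> instead of
  those of the record \<open>class_ring\<close>, so that ordinary arithmetic on scalars
  applies.\<close>

lemma complex_vectorspace_smult:
  assumes "complex_vectorspace V" and "v \<in> carrier V"
  shows "c \<odot>\<^bsub>V\<^esub> v \<in> carrier V" "0 \<odot>\<^bsub>V\<^esub> v = \<zero>\<^bsub>V\<^esub>" "1 \<odot>\<^bsub>V\<^esub> v = v"
    "(a * b) \<odot>\<^bsub>V\<^esub> v = a \<odot>\<^bsub>V\<^esub> (b \<odot>\<^bsub>V\<^esub> v)"
    "(a + b) \<odot>\<^bsub>V\<^esub> v = a \<odot>\<^bsub>V\<^esub> v \<oplus>\<^bsub>V\<^esub> b \<odot>\<^bsub>V\<^esub> v"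
proof -
  interpret V: vectorspace class_ring V by fact
  show "c \<odot>\<^bsub>V\<^esub> v \<in> carrier V" "0 \<odot>\<^bsub>V\<^esub> v = \<zero>\<^bsub>V\<^esub>" "1 \<odot>\<^bsub>V\<^esub> v = v"
    "(a * b) \<odot>\<^bsub>V\<^esub> v = a \<odot>\<^bsub>V\<^esub> (b \<odot>\<^bsub>V\<^esub> v)"
    "(a + b) \<odot>\<^bsub>V\<^esub> v = a \<odot>\<^bsub>V\<^esub> v \<oplus>\<^bsub>V\<^esub> b \<odot>\<^bsub>V\<^esub> v"
    using assms V.smult_closed[of c v] V.lmult_0[of v] V.smult_one[of v] V.smult_assoc1[of a b v]
      V.smult_l_distr[of a b v] by simp_all
qed

lemma linear_mapsI:
  fixes V :: "(complex, 'v) module"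
  assumes "\<And>v. v \<in> carrier V \<Longrightarrow> f v \<in> carrier W"
    and "\<And>v w. v \<in> carrier V \<Longrightarrow> w \<in> carrier V \<Longrightarrow> f (v \<oplus>\<^bsub>V\<^esub> w) = f v \<oplus>\<^bsub>W\<^esub> f w"
    and "\<And>c v. v \<in> carrier V \<Longrightarrow> f (c \<odot>\<^bsub>V\<^esub> v) = c \<odot>\<^bsub>W\<^esub> f v"
  shows "f \<in> linear_maps V W"
  using assms by (auto simp: LinearCombinations.module_hom_def)

lemma linear_mapsD:
  fixes V :: "(complex, 'v) module"
  assumes "f \<in> linear_maps V W"
  shows "v \<in> carrier V \<Longrightarrow> f v \<in> carrier W"
    and "v \<in> carrier V \<Longrightarrow> w \<in> carrier V \<Longrightarrow> f (v \<oplus>\<^bsub>V\<^esub> w) = f v \<oplus>\<^bsub>W\<^esub> f w"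
    and "v \<in> carrier V \<Longrightarrow> f (c \<odot>\<^bsub>V\<^esub> v) = c \<odot>\<^bsub>W\<^esub> f v"
  using assms by (auto simp: LinearCombinations.module_hom_def)

lemma linear_mapI:
  fixes V :: "(complex, 'v) module"
  assumes "complex_vectorspace V" "complex_vectorspace W" "f \<in> linear_maps V W"
  shows "linear_map class_ring V W f"
proof -
  interpret V: vectorspace class_ring V by fact
  interpret W: vectorspace class_ring W by fact
  show ?thesis using assms by unfold_locales auto
qed

lemma linear_maps_zero:
  fixes V :: "(complex, 'v) module"
  assumes "complex_vectorspace V" "complex_vectorspace W" "f \<in> linear_maps V W"
  shows "f \<zero>\<^bsub>V\<^esub> = \<zero>\<^bsub>W\<^esub>"
proof -
  interpret linear_map class_ring V W f by (rule linear_mapI) fact+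
  show ?thesis by simp
qed

lemma linear_maps_finsum:
  fixes V :: "(complex, 'v) module"
  assumes V: "complex_vectorspace V" and W: "complex_vectorspace W"
    and f: "f \<in> linear_maps V W" and g: "\<And>i. i \<in> A \<Longrightarrow> g i \<in> carrier V"
  shows "f (\<Oplus>\<^bsub>V\<^esub>i\<in>A. g i) = (\<Oplus>\<^bsub>W\<^esub>i\<in>A. f (g i))"
proof -
  interpret V: vectorspace class_ring V by fact
  interpret W: vectorspace class_ring W by fact
  note [simp] = linear_mapsD[OF f] linear_maps_zero[OF V W f]
  show ?thesis
    using g by (induction A rule: infinite_finite_induct) auto
qed

lemma linear_maps_inj_iff:
  fixes V :: "(complex, 'v) module"
  assumes V: "complex_vectorspace V" and W: "complex_vectorspace W" and f: "f \<in> linear_maps V W"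
  shows "inj_on f (carrier V) \<longleftrightarrow> (\<forall>v\<in>carrier V. f v = \<zero>\<^bsub>W\<^esub> \<longrightarrow> v = \<zero>\<^bsub>V\<^esub>)"
proof -
  interpret linear_map class_ring V W f by (rule linear_mapI) fact+
  have "\<zero>\<^bsub>V\<^esub> \<in> carrier V" by simp
  then show ?thesis unfolding Ke0_iff_inj by (auto simp: ker_def)
qed

lemma complex_vs_simps [simp]:
  "carrier complex_vs = UNIV" "\<zero>\<^bsub>complex_vs\<^esub> = 0" "x \<oplus>\<^bsub>complex_vs\<^esub> y = x + y"
  "c \<odot>\<^bsub>complex_vs\<^esub> x = c * x"
  by (simp_all add: complex_vs_def mk_vs_def)

lemma complex_vectorspace_complex_vs: "complex_vectorspace complex_vs"
  by (rule complex_vectorspaceI) (auto simp: algebra_simps)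

lemma mk_vs_simps [simp]:
  "carrier (mk_vs A z p s) = A" "zero (mk_vs A z p s) = z" "add (mk_vs A z p s) = p"
  "module.smult (mk_vs A z p s) = s"
  by (simp_all add: mk_vs_def)

lemma fd_vsD: "fd_vs V \<Longrightarrow> complex_vectorspace V" "fd_vs V \<Longrightarrow> vectorspace.fin_dim class_ring V"
  by (simp_all add: fd_vs_def)

section \<open>Dimension under injective linear maps\<close>

abbreviation vs_dim :: "(complex, 'v) module \<Rightarrow> nat" where
  "vs_dim V \<equiv> vectorspace.dim class_ring V"

text \<open>Injective linear maps preserve independence, so the size of independent sets in V is
  bounded by dim W; a maximal one is then a finite basis. For the strict inequality, the image of
  that basis stays independent when a vector outside the range is adjoined.\<close>

lemma fd_vs_inj:
  fixes V :: "(complex, 'v) module" and W :: "(complex, 'w) module"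
  assumes V: "complex_vectorspace V" and W: "complex_vectorspace W"
    and fd: "vectorspace.fin_dim class_ring W"
    and f: "f \<in> linear_maps V W" and inj: "inj_on f (carrier V)"
  shows "fd_vs V"
    and "w \<in> carrier W \<Longrightarrow> w \<notin> f ` carrier V \<Longrightarrow> vs_dim V < vs_dim W"
proof -
  interpret V: vectorspace class_ring V by fact
  interpret W: vectorspace class_ring W by fact
  interpret T: linear_map class_ring V W f by (rule linear_mapI) fact+
  have li: "W.lin_indpt (f ` A)" if A: "A \<subseteq> carrier V" "V.lin_indpt A" for A
  proof
    assume "W.lin_dep (f ` A)"
    then obtain B' a v where B': "finite B'" "B' \<subseteq> f ` A" "W.lincomb a B' = \<zero>\<^bsub>W\<^esub>" "v \<in> B'" "a v \<noteq> 0"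
      unfolding W.lin_dep_def by auto
    then obtain B where B: "B \<subseteq> A" "finite B" "B' = f ` B"
      by (metis finite_subset_image)
    have "W.lincomb a (f ` B) = f (V.lincomb (a \<circ> f) B)"
      using inj A B by (intro T.lincomb_linear_image) auto
    then have "f (V.lincomb (a \<circ> f) B) = \<zero>\<^bsub>W\<^esub>" using B' B by simp
    moreover have "V.lincomb (a \<circ> f) B \<in> carrier V"
      using A B by (intro V.lincomb_closed) auto
    ultimately have "V.lincomb (a \<circ> f) B = \<zero>\<^bsub>V\<^esub>"
      using inj linear_maps_inj_iff[OF V W f] by auto
    moreover obtain u where "u \<in> B" "v = f u" using B' B by auto
    ultimately have "V.lin_dep A" using B' B unfolding V.lin_dep_def by fastforce
    then show False using A by simp
  qed
  have card: "finite A \<and> card A \<le> W.dim" if A: "A \<subseteq> carrier V \<and> V.lin_indpt A" for A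
  proof -
    have "finite (f ` A)" "card (f ` A) \<le> W.dim"
      using W.li_le_dim[OF fd _ li] A linear_mapsD(1)[OF f] by auto
    moreover have "inj_on f A" using inj A inj_on_subset by blast
    ultimately show ?thesis by (metis card_image finite_image_iff)
  qed
  have "V.lin_indpt {}" by (simp add: V.lin_dep_def)
  then obtain A where A: "finite A" "maximal A (\<lambda>S. S \<subseteq> carrier V \<and> V.lin_indpt S)"
    using maximal_exists[of "\<lambda>S. S \<subseteq> carrier V \<and> V.lin_indpt S" "W.dim" "{}"] card by auto
  then have basis: "V.basis A" by (intro V.max_li_is_basis)
  then have "V.fin_dim" using A unfolding V.fin_dim_def V.basis_def by auto
  then show "fd_vs V" using V by (simp add: fd_vs_def)
  assume w: "w \<in> carrier W" "w \<notin> f ` carrier V"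
  have A': "A \<subseteq> carrier V" "V.lin_indpt A" using basis by (auto simp: V.basis_def)
  have span: "W.span (f ` A) \<subseteq> f ` carrier V"
  proof
    fix x assume "x \<in> W.span (f ` A)"
    moreover have "finite (f ` A)" "f ` A \<subseteq> carrier W" using A A' linear_mapsD(1)[OF f] by auto
    ultimately obtain a where a: "x = W.lincomb a (f ` A)"
      by (auto simp: W.finite_span)
    have "W.lincomb a (f ` A) = f (V.lincomb (a \<circ> f) A)"
      using inj A A' by (intro T.lincomb_linear_image) auto
    moreover have "V.lincomb (a \<circ> f) A \<in> carrier V"
      using A A' by (intro V.lincomb_closed) auto
    ultimately show "x \<in> f ` carrier V" using a by auto
  qed
  have fA: "f ` A \<subseteq> carrier W" using A' linear_mapsD(1)[OF f] by auto
  have wA: "w \<notin> f ` A" using w A' by auto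
  have "W.lin_indpt (f ` A \<union> {w})"
    using W.lin_dep_iff_in_span[OF fA li[OF A'] w(1) wA] span w by auto
  then have "card (f ` A \<union> {w}) \<le> W.dim"
    using W.li_le_dim(2)[OF fd] fA w by auto
  moreover have "card (f ` A) = card A" using inj A' by (meson card_image inj_on_subset)
  moreover have "V.dim = card A" using V.dim_basis A basis by auto
  ultimately show "V.dim < W.dim" using A wA by simp
qed

section \<open>Dual bases, coordinates and criteria for finite dimension\<close>

definition dual_bases ::
  "(complex, 'v) module \<Rightarrow> nat \<Rightarrow> (nat \<Rightarrow> 'v) \<Rightarrow> (nat \<Rightarrow> 'v \<Rightarrow> complex) \<Rightarrow> bool" where
  "dual_bases V n e l \<longleftrightarrow>
     (\<forall>i<n. e i \<in> carrier V) \<and> (\<forall>i<n. l i \<in> linear_maps V complex_vs) \<and>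
     (\<forall>i<n. \<forall>j<n. l i (e j) = (if i = j then 1 else 0)) \<and>
     (\<forall>v\<in>carrier V. v = (\<Oplus>\<^bsub>V\<^esub>i\<in>{..<n}. l i v \<odot>\<^bsub>V\<^esub> e i))"

text \<open>The coordinates of v are the coefficients of its unique expansion in a basis; uniqueness
  makes them linear and dual to the basis.\<close>

lemma fd_vs_dual_bases:
  fixes V :: "(complex, 'v) module"
  assumes "fd_vs V"
  obtains n e l where "dual_bases V n e l"
proof -
  interpret V: vectorspace class_ring V using assms by (simp add: fd_vs_def)
  obtain B where B: "finite B" "V.basis B"
    using V.finite_basis_exists assms by (auto simp: fd_vs_def)
  have BV: "B \<subseteq> carrier V" using B by (simp add: V.basis_def)
  have ex1: "\<exists>!a. a \<in> B \<rightarrow>\<^sub>E UNIV \<and> V.lincomb a B = v" if "v \<in> carrier V" for v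
    using V.basis_criterion[OF B(1) BV] B that by simp
  define c where "c v = (THE a. a \<in> B \<rightarrow>\<^sub>E UNIV \<and> V.lincomb a B = v)" for v
  have c: "V.lincomb (c v) B = v" if "v \<in> carrier V" for v
    using theI'[OF ex1[OF that]] by (simp add: c_def)
  \<comment> \<open>Uniqueness of coefficients holds among functions that are
    \<open>undefined\<close> off B, so a representing \<open>a\<close> is first restricted to B.
    Linearity and duality below are instances of this fact.\<close>
  have c_eq: "c v b = a b" if "b \<in> B" "v = V.lincomb a B" for v a b
  proof -
    have v: "v \<in> carrier V" using that BV by auto
    have *: "V.lincomb (restrict a B) B = V.lincomb a B"
      using BV by (intro V.lincomb_cong) auto
    have "c v = restrict a B"
      unfolding c_def by (rule the1_equality[OF ex1[OF v]]) (use * that in auto)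
    then show ?thesis using that by simp
  qed
  have c_lin: "(\<lambda>v. c v b) \<in> linear_maps V complex_vs" if b: "b \<in> B" for b
  proof (rule linear_mapsI)
    fix v w assume vw: "v \<in> carrier V" "w \<in> carrier V"
    have "V.lincomb (\<lambda>x. c v x + c w x) B = V.lincomb (c v) B \<oplus>\<^bsub>V\<^esub> V.lincomb (c w) B"
      using V.lincomb_sum[of B "c v" "c w"] B BV by auto
    also have "\<dots> = v \<oplus>\<^bsub>V\<^esub> w" using vw by (simp add: c)
    finally show "c (v \<oplus>\<^bsub>V\<^esub> w) b = c v b \<oplus>\<^bsub>complex_vs\<^esub> c w b"
      using c_eq[OF b, of "v \<oplus>\<^bsub>V\<^esub> w" "\<lambda>x. c v x + c w x"] by simp
  next
    fix v a assume v: "v \<in> carrier V"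
    have "V.lincomb (\<lambda>x. a * c v x) B = a \<odot>\<^bsub>V\<^esub> V.lincomb (c v) B"
      using V.lincomb_smult[of B "c v" a] BV by auto
    also have "\<dots> = a \<odot>\<^bsub>V\<^esub> v" using v by (simp add: c)
    finally show "c (a \<odot>\<^bsub>V\<^esub> v) b = a \<odot>\<^bsub>complex_vs\<^esub> c v b"
      using c_eq[OF b, of "a \<odot>\<^bsub>V\<^esub> v" "\<lambda>x. a * c v x"] by simp
  qed auto
  have c_delta: "c b' b = (if b = b' then 1 else 0)" if "b \<in> B" "b' \<in> B" for b b'
  proof (rule c_eq[OF that(1)])
    have "V.lincomb (\<lambda>b. if b = b' then 1 else 0) B
        = (\<Oplus>\<^bsub>V\<^esub>v\<in>B. if b' = v then b' else \<zero>\<^bsub>V\<^esub>)"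
      unfolding V.lincomb_def using BV
      by (intro V.finsum_cong') (auto simp: complex_vectorspace_smult[OF V.vectorspace_axioms])
    also have "\<dots> = b'"
      using that BV B by (subst V.add.finprod_singleton) auto
    finally show "b' = V.lincomb (\<lambda>b. if b = b' then 1 else 0) B" ..
  qed
  obtain e where e: "bij_betw e {..<card B} B"
    using ex_bij_betw_nat_finite[OF B(1)] by (auto simp: atLeast0LessThan)
  have eB: "e i \<in> B" if "i < card B" for i using e that by (auto simp: bij_betw_def)
  have "dual_bases V (card B) e (\<lambda>i v. c v (e i))"
    unfolding dual_bases_def
  proof (intro conjI allI impI ballI)
    show "e i \<in> carrier V" if "i < card B" for i using eB[OF that] BV by auto
    show "(\<lambda>v. c v (e i)) \<in> linear_maps V complex_vs" if "i < card B" for i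
      using c_lin eB that by blast
    show "c (e j) (e i) = (if i = j then 1 else 0)" if "i < card B" "j < card B" for i j
      using that c_delta eB e by (auto simp: bij_betw_def inj_on_def)
    fix v assume v: "v \<in> carrier V"
    have "v = (\<Oplus>\<^bsub>V\<^esub>b\<in>e ` {..<card B}. c v b \<odot>\<^bsub>V\<^esub> b)"
      using c[OF v] e by (simp add: V.lincomb_def bij_betw_def)
    also have "\<dots> = (\<Oplus>\<^bsub>V\<^esub>i\<in>{..<card B}. c v (e i) \<odot>\<^bsub>V\<^esub> e i)"
      using e BV by (intro V.add.finprod_reindex) (auto simp: bij_betw_def)
    finally show "v = (\<Oplus>\<^bsub>V\<^esub>i\<in>{..<card B}. c v (e i) \<odot>\<^bsub>V\<^esub> e i)" .
  qed
  then show thesis ..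
qed

lemma dual_bases_eqI:
  assumes V: "complex_vectorspace V" and l: "dual_bases V n e l"
    and v: "v \<in> carrier V" "w \<in> carrier V" and eq: "\<And>i. i < n \<Longrightarrow> l i v = l i w"
  shows "v = w"
proof -
  interpret V: vectorspace class_ring V by fact
  have "v = (\<Oplus>\<^bsub>V\<^esub>i\<in>{..<n}. l i v \<odot>\<^bsub>V\<^esub> e i)" "w = (\<Oplus>\<^bsub>V\<^esub>i\<in>{..<n}. l i w \<odot>\<^bsub>V\<^esub> e i)"
    using l v by (auto simp: dual_bases_def)
  moreover have "(\<Oplus>\<^bsub>V\<^esub>i\<in>{..<n}. l i v \<odot>\<^bsub>V\<^esub> e i) = (\<Oplus>\<^bsub>V\<^esub>i\<in>{..<n}. l i w \<odot>\<^bsub>V\<^esub> e i)"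
    using eq l by (intro V.finsum_cong') (auto simp: dual_bases_def)
  ultimately show ?thesis by simp
qed

lemma finsum_complex_vs: "(\<Oplus>\<^bsub>complex_vs\<^esub>i\<in>A. f i) = sum f A"
proof -
  interpret C: vectorspace class_ring complex_vs by (rule complex_vectorspace_complex_vs)
  show ?thesis by (induction A rule: infinite_finite_induct) auto
qed

lemma dual_bases_apply_finsum:
  assumes V: "complex_vectorspace V" and l: "dual_bases V n e l" and f: "f \<in> linear_maps V complex_vs"
  shows "f (\<Oplus>\<^bsub>V\<^esub>i\<in>{..<n}. a i \<odot>\<^bsub>V\<^esub> e i) = (\<Sum>i<n. a i * f (e i))"
proof -
  have "f (\<Oplus>\<^bsub>V\<^esub>i\<in>{..<n}. a i \<odot>\<^bsub>V\<^esub> e i) = (\<Oplus>\<^bsub>complex_vs\<^esub>i\<in>{..<n}. f (a i \<odot>\<^bsub>V\<^esub> e i))"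
    using l V by (intro linear_maps_finsum[OF V complex_vectorspace_complex_vs f])
      (auto simp: dual_bases_def complex_vectorspace_smult)
  also have "\<dots> = (\<Sum>i<n. a i * f (e i))"
    using linear_mapsD(3)[OF f] l by (simp add: finsum_complex_vs dual_bases_def)
  finally show ?thesis .
qed

lemma dual_bases_coord:
  assumes V: "complex_vectorspace V" and l: "dual_bases V n e l" and i: "i < n"
  shows "l i (\<Oplus>\<^bsub>V\<^esub>j\<in>{..<n}. a j \<odot>\<^bsub>V\<^esub> e j) = a i"
proof -
  have "l i (\<Oplus>\<^bsub>V\<^esub>j\<in>{..<n}. a j \<odot>\<^bsub>V\<^esub> e j) = (\<Sum>j<n. a j * l i (e j))"
    using i l by (intro dual_bases_apply_finsum[OF V l]) (auto simp: dual_bases_def)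
  also have "\<dots> = (\<Sum>j<n. if j = i then a j else 0)"
    using i l by (intro sum.cong) (auto simp: dual_bases_def)
  also have "\<dots> = a i" using i by simp
  finally show ?thesis .
qed

lemma dual_bases_finsum_closed:
  assumes V: "complex_vectorspace V" and l: "dual_bases V n e l"
  shows "(\<Oplus>\<^bsub>V\<^esub>i\<in>{..<n}. a i \<odot>\<^bsub>V\<^esub> e i) \<in> carrier V"
proof -
  interpret V: vectorspace class_ring V by fact
  show ?thesis using l by (intro V.finsum_closed) (auto simp: dual_bases_def)
qed

text \<open>Evaluating all functionals embeds V in the space of complex vectors of length n, where n
  is the number of functionals; then \<open>fd_vs_inj\<close> applies.\<close>

lemma fd_vs_of_functionals:
  fixes V :: "(complex, 'v) module" and l :: "'i \<Rightarrow> 'v \<Rightarrow> complex"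
  assumes V: "complex_vectorspace V" and "finite I"
    and l: "\<And>i. i \<in> I \<Longrightarrow> l i \<in> linear_maps V complex_vs"
    and inj: "\<And>v. v \<in> carrier V \<Longrightarrow> (\<And>i. i \<in> I \<Longrightarrow> l i v = 0) \<Longrightarrow> v = \<zero>\<^bsub>V\<^esub>"
  shows "fd_vs V"
proof -
  define n where "n = card I"
  obtain e where e: "bij_betw e {..<n} I"
    using ex_bij_betw_nat_finite[OF \<open>finite I\<close>] by (auto simp: atLeast0LessThan n_def)
  have eI: "e i \<in> I" if "i < n" for i using e that by (auto simp: bij_betw_def)
  interpret W: vec_space "TYPE(complex)" n .
  let ?f = "\<lambda>v. vec n (\<lambda>i. l (e i) v)"
  have f: "?f \<in> linear_maps V (module_vec TYPE(complex) n)"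
    using linear_mapsD[OF l[OF eI]] by (intro linear_mapsI) (auto simp: module_vec_simps)
  have "inj_on ?f (carrier V)"
    unfolding linear_maps_inj_iff[OF V W.vectorspace_axioms f]
  proof (intro ballI impI)
    fix v assume v: "v \<in> carrier V" and "?f v = \<zero>\<^bsub>module_vec TYPE(complex) n\<^esub>"
    then have "l (e i) v = 0" if "i < n" for i
      using that by (metis index_vec index_zero_vec(1) module_vec_simps(2))
    then show "v = \<zero>\<^bsub>V\<^esub>"
      using e v by (intro inj) (auto simp: bij_betw_def)
  qed
  then show ?thesis
    by (rule fd_vs_inj(1)[OF V W.vectorspace_axioms W.fin_dim f])
qed

text \<open>Composing each map with the coordinate functionals of its target yields finitely many
  functionals with trivial common kernel. This gives finite dimension for the hom-spaces of
  \<open>Vect\<close> (values on a basis), for direct sums (the two projections) and for natural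
  transformations (components at representatives).\<close>

lemma fd_vs_of_linear_maps:
  fixes V :: "(complex, 'v) module" and W :: "'i \<Rightarrow> (complex, 'w) module"
  assumes V: "complex_vectorspace V" and "finite I" and W: "\<And>i. i \<in> I \<Longrightarrow> fd_vs (W i)"
    and f: "\<And>i. i \<in> I \<Longrightarrow> f i \<in> linear_maps V (W i)"
    and inj: "\<And>v. v \<in> carrier V \<Longrightarrow> (\<And>i. i \<in> I \<Longrightarrow> f i v = \<zero>\<^bsub>W i\<^esub>) \<Longrightarrow> v = \<zero>\<^bsub>V\<^esub>"
  shows "fd_vs V"
proof -
  \<comment> \<open>One predicate bundles the properties, so that n and l can be chosen for all i at
    once.\<close>
  define separating where "separating i n l \<longleftrightarrow> (\<forall>j<n. l j \<in> linear_maps (W i) complex_vs) \<and>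
      (\<forall>v\<in>carrier (W i). (\<forall>j<n. l j v = 0) \<longrightarrow> v = \<zero>\<^bsub>W i\<^esub>)"
    for i and n :: nat and l
  have "\<exists>n l. separating i n l" if i: "i \<in> I" for i
  proof -
    obtain n e l where l: "dual_bases (W i) n e l" by (rule fd_vs_dual_bases[OF W[OF i]])
    have W: "complex_vectorspace (W i)" using W[OF i] by (simp add: fd_vs_def)
    then interpret W: vectorspace class_ring "W i" .
    have lin: "l j \<in> linear_maps (W i) complex_vs" if "j < n" for j
      using l that by (simp add: dual_bases_def)
    have l0: "l j \<zero>\<^bsub>W i\<^esub> = 0" if "j < n" for j
      using linear_maps_zero[OF W complex_vectorspace_complex_vs lin[OF that]] by simp
    have "v = \<zero>\<^bsub>W i\<^esub>" if "v \<in> carrier (W i)" "\<forall>j<n. l j v = 0" for v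
      using that(2) l0 by (intro dual_bases_eqI[OF W l that(1) W.zero_closed]) simp
    with lin show ?thesis unfolding separating_def by blast
  qed
  then obtain n l where "\<And>i. i \<in> I \<Longrightarrow> separating i (n i) (l i)" by metis
  then have l: "\<And>i j. i \<in> I \<Longrightarrow> j < n i \<Longrightarrow> l i j \<in> linear_maps (W i) complex_vs"
    and 0: "\<And>i v. i \<in> I \<Longrightarrow> v \<in> carrier (W i) \<Longrightarrow> (\<forall>j<n i. l i j v = 0) \<Longrightarrow> v = \<zero>\<^bsub>W i\<^esub>"
    unfolding separating_def by blast+
  show ?thesis
  proof (rule fd_vs_of_functionals[OF V, of "Sigma I (\<lambda>i. {..<n i})" "\<lambda>(i, j) v. l i j (f i v)"])
    fix p assume "p \<in> Sigma I (\<lambda>i. {..<n i})"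
    then obtain i j where "p = (i, j)" "i \<in> I" "j < n i" by auto
    then show "(case p of (i, j) \<Rightarrow> \<lambda>v. l i j (f i v)) \<in> linear_maps V complex_vs"
      using linear_mapsD[OF l] linear_mapsD[OF f] by (auto intro!: linear_mapsI)
  next
    fix v assume v: "v \<in> carrier V"
      and *: "\<And>p. p \<in> Sigma I (\<lambda>i. {..<n i}) \<Longrightarrow> (case p of (i, j) \<Rightarrow> \<lambda>v. l i j (f i v)) v = 0"
    then show "v = \<zero>\<^bsub>V\<^esub>"
      using linear_mapsD(1)[OF f] by (intro inj 0) auto
  qed (use \<open>finite I\<close> in auto)
qed

section \<open>Quasi-inverses, eigenvectors and functionals\<close>

lemma linear_map_quasi_inverse:
  fixes V :: "(complex, 'v) module" and W :: "(complex, 'w) module"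
  assumes V: "fd_vs V" and W: "fd_vs W" and f: "f \<in> linear_maps V W"
  obtains g where "g \<in> linear_maps W V" "\<And>v. v \<in> carrier V \<Longrightarrow> f (g (f v)) = f v"
proof -
  obtain n e l where l: "dual_bases V n e l" by (rule fd_vs_dual_bases[OF V])
  obtain m d k where k: "dual_bases W m d k" by (rule fd_vs_dual_bases[OF W])
  note VV = fd_vsD(1)[OF V] and WW = fd_vsD(1)[OF W]
  interpret V: vectorspace class_ring V by (rule VV)
  interpret W: vectorspace class_ring W by (rule WW)
  have e: "e i \<in> carrier V" "l i \<in> linear_maps V complex_vs" if "i < n" for i
    using l that by (auto simp: dual_bases_def)
  have kl: "k j \<in> linear_maps W complex_vs" if "j < m" for j
    using k that by (auto simp: dual_bases_def)
  have kf: "(\<lambda>v. k j (f v)) \<in> linear_maps V complex_vs" if "j < m" for j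
    using linear_mapsD[OF kl[OF that]] linear_mapsD[OF f] by (intro linear_mapsI) auto
  \<comment> \<open>Coordinate tuples are modelled as sequences, which form a vector space on a
    whole type under pointwise operations; there a linear map has a linear right inverse on its
    range.\<close>
  define s :: "complex \<Rightarrow> (nat \<Rightarrow> complex) \<Rightarrow> nat \<Rightarrow> complex" where "s = (\<lambda>c u i. c * u i)"
  interpret S: vector_space_pair s s
    by unfold_locales (auto simp: s_def fun_eq_iff algebra_simps)
  \<comment> \<open>The matrix of f in the two bases, padded with zeros: only the first n entries of
    u are read and only the first m entries of the result can be nonzero, so the infinite dimension
    of the sequence space does no harm.\<close>
  define F :: "(nat \<Rightarrow> complex) \<Rightarrow> nat \<Rightarrow> complex"
    where "F u = (\<lambda>j. if j < m then \<Sum>i<n. u i * k j (f (e i)) else 0)" for u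
  have "Vector_Spaces.linear s s F"
    unfolding Vector_Spaces.linear_iff using S.vs1.vector_space_axioms
    by (auto simp: F_def s_def fun_eq_iff algebra_simps sum.distrib sum_distrib_left)
  from S.linear_exists_right_inverse_on[OF this S.vs1.subspace_UNIV]
  obtain G where G: "Vector_Spaces.linear s s G" and FGF: "\<And>u. F (G (F u)) = F u"
    by auto
  \<comment> \<open>Coordinates of w, padded exactly like the values of F, so that
    \<open>q (f v)\<close> lies in the range of F, where G is a right inverse.\<close>
  define q where "q w = (\<lambda>j. if j < m then k j w else 0)" for w
  define g where "g w = (\<Oplus>\<^bsub>V\<^esub>i\<in>{..<n}. G (q w) i \<odot>\<^bsub>V\<^esub> e i)" for w
  have g_closed: "g w \<in> carrier V" for w
    unfolding g_def by (rule dual_bases_finsum_closed[OF VV l])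
  have lg: "l i (g w) = G (q w) i" if "i < n" for i w
    unfolding g_def by (rule dual_bases_coord[OF VV l that])
  show thesis
  proof
    show "g \<in> linear_maps W V"
    proof (rule linear_mapsI)
      fix v w assume vw: "v \<in> carrier W" "w \<in> carrier W"
      have "q (v \<oplus>\<^bsub>W\<^esub> w) = q v + q w"
        using linear_mapsD(2)[OF kl] vw by (auto simp: q_def fun_eq_iff)
      then have "G (q (v \<oplus>\<^bsub>W\<^esub> w)) = G (q v) + G (q w)"
        using G by (simp add: Vector_Spaces.linear_iff)
      then show "g (v \<oplus>\<^bsub>W\<^esub> w) = g v \<oplus>\<^bsub>V\<^esub> g w"
        using linear_mapsD(2)[OF e(2)] g_closed
        by (intro dual_bases_eqI[OF VV l]) (auto simp: lg)
    next
      fix c w assume w: "w \<in> carrier W"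
      have "q (c \<odot>\<^bsub>W\<^esub> w) = s c (q w)"
        using linear_mapsD(3)[OF kl] w by (auto simp: q_def s_def fun_eq_iff)
      then have "G (q (c \<odot>\<^bsub>W\<^esub> w)) = s c (G (q w))"
        using G by (simp add: Vector_Spaces.linear_iff)
      then show "g (c \<odot>\<^bsub>W\<^esub> w) = c \<odot>\<^bsub>V\<^esub> g w"
        using linear_mapsD(3)[OF e(2)] g_closed
        by (intro dual_bases_eqI[OF VV l]) (auto simp: lg s_def)
    qed (rule g_closed)
    fix v assume v: "v \<in> carrier V"
    have kF: "k j (f u) = F (\<lambda>i. l i u) j" if "j < m" "u \<in> carrier V" for j u
    proof -
      have "k j (f u) = k j (f (\<Oplus>\<^bsub>V\<^esub>i\<in>{..<n}. l i u \<odot>\<^bsub>V\<^esub> e i))"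
        using l that by (auto simp: dual_bases_def)
      then show ?thesis
        using dual_bases_apply_finsum[OF VV l kf[OF that(1)]] that by (simp add: F_def)
    qed
    have F_cong: "F u = F u'" if "\<And>i. i < n \<Longrightarrow> u i = u' i" for u u'
      using that by (auto simp: F_def intro!: ext sum.cong)
    show "f (g (f v)) = f v"
    proof (rule dual_bases_eqI[OF WW k])
      fix j assume j: "j < m"
      have "k j (f (g (f v))) = F (\<lambda>i. l i (g (f v))) j"
        by (rule kF[OF j g_closed])
      also have "F (\<lambda>i. l i (g (f v))) = F (G (q (f v)))"
        by (rule F_cong) (simp add: lg)
      also have "q (f v) = F (\<lambda>i. l i v)"
        using kF[OF _ v] by (auto simp: q_def F_def)
      also have "F (G (F (\<lambda>i. l i v))) j = k j (f v)"
        using kF[OF j v] by (simp add: FGF)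
      finally show "k j (f (g (f v))) = k j (f v)" .
    qed (use linear_mapsD(1)[OF f] g_closed v in auto)
  qed
qed

text \<open>An eigenvector of the matrix of f in a basis gives the coordinates of u. The nonzero v
  forces positive dimension, without which the spectrum would be empty.\<close>

lemma linear_map_eigenvector:
  fixes V :: "(complex, 'v) module"
  assumes V: "fd_vs V" and f: "f \<in> linear_maps V V" and v: "v \<in> carrier V" "v \<noteq> \<zero>\<^bsub>V\<^esub>"
  obtains c u where "u \<in> carrier V" "u \<noteq> \<zero>\<^bsub>V\<^esub>" "f u = c \<odot>\<^bsub>V\<^esub> u"
proof -
  obtain n e l where l: "dual_bases V n e l" by (rule fd_vs_dual_bases[OF V])
  note VV = fd_vsD(1)[OF V]
  interpret V: vectorspace class_ring V by (rule VV)
  have e: "e i \<in> carrier V" "l i \<in> linear_maps V complex_vs" if "i < n" for i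
    using l that by (auto simp: dual_bases_def)
  have lf: "(\<lambda>v. l i (f v)) \<in> linear_maps V complex_vs" if "i < n" for i
    using linear_mapsD[OF e(2)[OF that]] linear_mapsD[OF f] by (intro linear_mapsI) auto
  have "n \<noteq> 0"
    using dual_bases_eqI[OF VV l v(1) V.zero_closed] v(2) by (intro notI) simp
  define A where "A = mat n n (\<lambda>(i, j). l i (f (e j)))"
  have "A \<in> carrier_mat n n" by (simp add: A_def)
  then obtain c where "c \<in> spectrum A"
    using spectrum_non_empty[of A n] \<open>n \<noteq> 0\<close> by auto
  then obtain x where x: "x \<in> carrier_vec n" "x \<noteq> 0\<^sub>v n" "A *\<^sub>v x = c \<cdot>\<^sub>v x"
    by (auto simp: spectrum_def eigenvalue_def eigenvector_def A_def)
  define u where "u = (\<Oplus>\<^bsub>V\<^esub>i\<in>{..<n}. (x $ i) \<odot>\<^bsub>V\<^esub> e i)"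
  have u: "u \<in> carrier V" unfolding u_def by (rule dual_bases_finsum_closed[OF VV l])
  have lu: "l i u = x $ i" if "i < n" for i
    unfolding u_def by (rule dual_bases_coord[OF VV l that])
  obtain i where i: "i < n" "x $ i \<noteq> 0"
    using x by (metis carrier_vecD eq_vecI index_zero_vec)
  have "u \<noteq> \<zero>\<^bsub>V\<^esub>"
    using lu[OF i(1)] i linear_maps_zero[OF VV complex_vectorspace_complex_vs e(2)[OF i(1)]] by auto
  moreover have "f u = c \<odot>\<^bsub>V\<^esub> u"
  proof (rule dual_bases_eqI[OF VV l])
    fix i assume i: "i < n"
    have "l i (f u) = (\<Sum>j<n. x $ j * l i (f (e j)))"
      unfolding u_def by (rule dual_bases_apply_finsum[OF VV l lf[OF i]])
    also have "\<dots> = (A *\<^sub>v x) $ i"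
      using i x(1) by (auto simp: A_def scalar_prod_def atLeast0LessThan mult.commute intro!: sum.cong)
    also have "\<dots> = c * x $ i" using i x(1) by (simp add: x(3))
    also have "\<dots> = l i (c \<odot>\<^bsub>V\<^esub> u)"
      using linear_mapsD(3)[OF e(2)[OF i] u] lu[OF i] by simp
    finally show "l i (f u) = l i (c \<odot>\<^bsub>V\<^esub> u)" .
  qed (use u linear_mapsD(1)[OF f] in auto)
  ultimately show thesis using that u by blast
qed

lemma ex_nonzero_functional:
  assumes V: "fd_vs V" and v: "v \<in> carrier V" "v \<noteq> \<zero>\<^bsub>V\<^esub>"
  obtains l where "l \<in> linear_maps V complex_vs" "l v \<noteq> 0"
proof -
  obtain n e l where l: "dual_bases V n e l" by (rule fd_vs_dual_bases[OF V])
  note VV = fd_vsD(1)[OF V]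
  interpret V: vectorspace class_ring V by (rule VV)
  have lin: "l i \<in> linear_maps V complex_vs" if "i < n" for i
    using l that by (auto simp: dual_bases_def)
  have "l i \<zero>\<^bsub>V\<^esub> = 0" if "i < n" for i
    using linear_maps_zero[OF VV complex_vectorspace_complex_vs lin[OF that]] by simp
  then have "\<exists>i<n. l i v \<noteq> 0"
    using dual_bases_eqI[OF VV l v(1) V.zero_closed] v(2) by metis
  then show thesis using that lin by blast
qed

section \<open>Linear categories\<close>

lemma (in abelian_monoid) finsum_lessThan_add:
  fixes n m :: nat
  assumes "\<And>i. i < n + m \<Longrightarrow> f i \<in> carrier G"
  shows "(\<Oplus>i\<in>{..<n + m}. f i) = (\<Oplus>i\<in>{..<n}. f i) \<oplus> (\<Oplus>i\<in>{..<m}. f (n + i))"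
  using assms
proof (induction m)
  case (Suc m)
  have "(\<Oplus>i\<in>{..<n + Suc m}. f i) = f (n + m) \<oplus> (\<Oplus>i\<in>{..<n + m}. f i)"
    unfolding add_Suc_right lessThan_Suc using Suc.prems by (intro finsum_insert) auto
  also have "\<dots> = f (n + m) \<oplus> ((\<Oplus>i\<in>{..<n}. f i) \<oplus> (\<Oplus>i\<in>{..<m}. f (n + i)))"
    using Suc by simp
  also have "\<dots> = (\<Oplus>i\<in>{..<n}. f i) \<oplus> (f (n + m) \<oplus> (\<Oplus>i\<in>{..<m}. f (n + i)))"
    using Suc.prems by (intro a_lcomm finsum_closed) auto
  also have "f (n + m) \<oplus> (\<Oplus>i\<in>{..<m}. f (n + i)) = (\<Oplus>i\<in>{..<Suc m}. f (n + i))"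
    unfolding lessThan_Suc using Suc.prems by (intro finsum_insert[symmetric]) auto
  finally show ?case .
qed auto

lemma complex_vectorspace_minus:
  assumes V: "complex_vectorspace V" and v: "v \<in> carrier V"
  shows "v \<oplus>\<^bsub>V\<^esub> (-1) \<odot>\<^bsub>V\<^esub> v = \<zero>\<^bsub>V\<^esub>"
  using complex_vectorspace_smult(5)[OF V v, of 1 "-1"] complex_vectorspace_smult(2,3)[OF V v]
  by simp

lemma complex_vectorspace_eq_smultI:
  assumes V: "complex_vectorspace V" and vw: "v \<in> carrier V" "w \<in> carrier V"
    and eq: "v \<oplus>\<^bsub>V\<^esub> (- c) \<odot>\<^bsub>V\<^esub> w = \<zero>\<^bsub>V\<^esub>"
  shows "v = c \<odot>\<^bsub>V\<^esub> w"
proof -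
  interpret V: vectorspace class_ring V by fact
  note [simp] = complex_vectorspace_smult[OF V]
  have "v = v \<oplus>\<^bsub>V\<^esub> (- c + c) \<odot>\<^bsub>V\<^esub> w" using vw by simp
  also have "\<dots> = (v \<oplus>\<^bsub>V\<^esub> (- c) \<odot>\<^bsub>V\<^esub> w) \<oplus>\<^bsub>V\<^esub> c \<odot>\<^bsub>V\<^esub> w"
    unfolding complex_vectorspace_smult(5)[OF V vw(2)] using vw by (simp add: V.a_assoc)
  also have "\<dots> = c \<odot>\<^bsub>V\<^esub> w" using vw by (simp add: eq)
  finally show ?thesis .
qed

section \<open>Hom-spaces and bilinearity of composition\<close>

context linear_category
begin

lemma Hom_vectorspace: "x \<in> Ob C \<Longrightarrow> y \<in> Ob C \<Longrightarrow> complex_vectorspace (Hom_vs C x y)"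
  using fd_vs_Hom_vs by (simp add: fd_vs_def)

lemma Hom_abelian_group: "x \<in> Ob C \<Longrightarrow> y \<in> Ob C \<Longrightarrow> abelian_group (Hom_vs C x y)"
  by (metis Hom_vectorspace vectorspace_def Module.module_def)

lemma Hom_closed:
  assumes "x \<in> Ob C" "y \<in> Ob C"
  shows "\<zero>\<^bsub>Hom_vs C x y\<^esub> \<in> Hom C x y"
    and "f \<in> Hom C x y \<Longrightarrow> g \<in> Hom C x y \<Longrightarrow> f \<oplus>\<^bsub>Hom_vs C x y\<^esub> g \<in> Hom C x y"
    and "f \<in> Hom C x y \<Longrightarrow> c \<odot>\<^bsub>Hom_vs C x y\<^esub> f \<in> Hom C x y"
    and "(\<And>i. i \<in> A \<Longrightarrow> F i \<in> Hom C x y) \<Longrightarrow> (\<Oplus>\<^bsub>Hom_vs C x y\<^esub>i\<in>A. F i) \<in> Hom C x y"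
proof -
  interpret V: vectorspace class_ring "Hom_vs C x y" by (rule Hom_vectorspace) fact+
  note car = carrier_Hom_vs[OF assms, symmetric]
  show "\<zero>\<^bsub>Hom_vs C x y\<^esub> \<in> Hom C x y"
    "f \<in> Hom C x y \<Longrightarrow> g \<in> Hom C x y \<Longrightarrow> f \<oplus>\<^bsub>Hom_vs C x y\<^esub> g \<in> Hom C x y"
    by (simp_all add: car)
  show "f \<in> Hom C x y \<Longrightarrow> c \<odot>\<^bsub>Hom_vs C x y\<^esub> f \<in> Hom C x y"
    unfolding car by (rule complex_vectorspace_smult(1)[OF V.vectorspace_axioms])
  show "(\<Oplus>\<^bsub>Hom_vs C x y\<^esub>i\<in>A. F i) \<in> Hom C x y" if "\<And>i. i \<in> A \<Longrightarrow> F i \<in> Hom C x y"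
    using that unfolding car by (intro V.finsum_closed) auto
qed

lemma Comp_right:
  assumes "x \<in> Ob C" "y \<in> Ob C" "z \<in> Ob C" "g \<in> Hom C y z"
  shows "Comp C x y z g \<zero>\<^bsub>Hom_vs C x y\<^esub> = \<zero>\<^bsub>Hom_vs C x z\<^esub>"
    and "f \<in> Hom C x y \<Longrightarrow> f' \<in> Hom C x y \<Longrightarrow>
      Comp C x y z g (f \<oplus>\<^bsub>Hom_vs C x y\<^esub> f') = Comp C x y z g f \<oplus>\<^bsub>Hom_vs C x z\<^esub> Comp C x y z g f'"
    and "f \<in> Hom C x y \<Longrightarrow>
      Comp C x y z g (c \<odot>\<^bsub>Hom_vs C x y\<^esub> f) = c \<odot>\<^bsub>Hom_vs C x z\<^esub> Comp C x y z g f"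
    and "(\<And>i. i \<in> A \<Longrightarrow> F i \<in> Hom C x y) \<Longrightarrow>
      Comp C x y z g (\<Oplus>\<^bsub>Hom_vs C x y\<^esub>i\<in>A. F i) = (\<Oplus>\<^bsub>Hom_vs C x z\<^esub>i\<in>A. Comp C x y z g (F i))"
proof -
  note lin = Comp_linear_right[OF assms]
  note V = Hom_vectorspace[OF assms(1,2)] and W = Hom_vectorspace[OF assms(1,3)]
  note car = carrier_Hom_vs[OF assms(1,2), symmetric]
  show "Comp C x y z g \<zero>\<^bsub>Hom_vs C x y\<^esub> = \<zero>\<^bsub>Hom_vs C x z\<^esub>"
    by (rule linear_maps_zero[OF V W lin])
  show "f \<in> Hom C x y \<Longrightarrow> f' \<in> Hom C x y \<Longrightarrow>
      Comp C x y z g (f \<oplus>\<^bsub>Hom_vs C x y\<^esub> f') = Comp C x y z g f \<oplus>\<^bsub>Hom_vs C x z\<^esub> Comp C x y z g f'"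
    "f \<in> Hom C x y \<Longrightarrow>
      Comp C x y z g (c \<odot>\<^bsub>Hom_vs C x y\<^esub> f) = c \<odot>\<^bsub>Hom_vs C x z\<^esub> Comp C x y z g f"
    using linear_mapsD(2,3)[OF lin] by (simp_all add: car)
  show "Comp C x y z g (\<Oplus>\<^bsub>Hom_vs C x y\<^esub>i\<in>A. F i) = (\<Oplus>\<^bsub>Hom_vs C x z\<^esub>i\<in>A. Comp C x y z g (F i))"
    if "\<And>i. i \<in> A \<Longrightarrow> F i \<in> Hom C x y"
    by (rule linear_maps_finsum[OF V W lin]) (use that car in auto)
qed

lemma Comp_left:
  assumes "x \<in> Ob C" "y \<in> Ob C" "z \<in> Ob C" "f \<in> Hom C x y"
  shows "Comp C x y z \<zero>\<^bsub>Hom_vs C y z\<^esub> f = \<zero>\<^bsub>Hom_vs C x z\<^esub>"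
    and "g \<in> Hom C y z \<Longrightarrow> g' \<in> Hom C y z \<Longrightarrow>
      Comp C x y z (g \<oplus>\<^bsub>Hom_vs C y z\<^esub> g') f = Comp C x y z g f \<oplus>\<^bsub>Hom_vs C x z\<^esub> Comp C x y z g' f"
    and "g \<in> Hom C y z \<Longrightarrow>
      Comp C x y z (c \<odot>\<^bsub>Hom_vs C y z\<^esub> g) f = c \<odot>\<^bsub>Hom_vs C x z\<^esub> Comp C x y z g f"
    and "(\<And>i. i \<in> A \<Longrightarrow> G i \<in> Hom C y z) \<Longrightarrow>
      Comp C x y z (\<Oplus>\<^bsub>Hom_vs C y z\<^esub>i\<in>A. G i) f = (\<Oplus>\<^bsub>Hom_vs C x z\<^esub>i\<in>A. Comp C x y z (G i) f)"
proof -
  note lin = Comp_linear_left[OF assms]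
  note V = Hom_vectorspace[OF assms(2,3)] and W = Hom_vectorspace[OF assms(1,3)]
  note car = carrier_Hom_vs[OF assms(2,3), symmetric]
  show "Comp C x y z \<zero>\<^bsub>Hom_vs C y z\<^esub> f = \<zero>\<^bsub>Hom_vs C x z\<^esub>"
    by (rule linear_maps_zero[OF V W lin])
  show "g \<in> Hom C y z \<Longrightarrow> g' \<in> Hom C y z \<Longrightarrow>
      Comp C x y z (g \<oplus>\<^bsub>Hom_vs C y z\<^esub> g') f = Comp C x y z g f \<oplus>\<^bsub>Hom_vs C x z\<^esub> Comp C x y z g' f"
    "g \<in> Hom C y z \<Longrightarrow>
      Comp C x y z (c \<odot>\<^bsub>Hom_vs C y z\<^esub> g) f = c \<odot>\<^bsub>Hom_vs C x z\<^esub> Comp C x y z g f"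
    using linear_mapsD(2,3)[OF lin] by (simp_all add: car)
  show "Comp C x y z (\<Oplus>\<^bsub>Hom_vs C y z\<^esub>i\<in>A. G i) f = (\<Oplus>\<^bsub>Hom_vs C x z\<^esub>i\<in>A. Comp C x y z (G i) f)"
    if "\<And>i. i \<in> A \<Longrightarrow> G i \<in> Hom C y z"
    by (rule linear_maps_finsum[OF V W lin]) (use that car in auto)
qed

lemma Hom_finsum_cong:
  assumes "x \<in> Ob C" "y \<in> Ob C" "\<And>i. i \<in> A \<Longrightarrow> F i = G i" "\<And>i. i \<in> A \<Longrightarrow> G i \<in> Hom C x y"
  shows "(\<Oplus>\<^bsub>Hom_vs C x y\<^esub>i\<in>A. F i) = (\<Oplus>\<^bsub>Hom_vs C x y\<^esub>i\<in>A. G i)"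
proof -
  interpret abelian_group "Hom_vs C x y" by (rule Hom_abelian_group) fact+
  show ?thesis using assms carrier_Hom_vs[OF assms(1,2)] by (intro finsum_cong') auto
qed

text \<open>Regroups a fourfold composite around its inner pair, to which the relations between
  projections and injections apply.\<close>

lemma Comp_middle:
  assumes "v \<in> Ob C" "w \<in> Ob C" "x \<in> Ob C" "y \<in> Ob C" "z \<in> Ob C"
    and "f \<in> Hom C v w" "g \<in> Hom C w x" "h \<in> Hom C x y" "k \<in> Hom C y z"
  shows "Comp C v x z (Comp C x y z k h) (Comp C v w x g f) =
    Comp C v y z k (Comp C v w y (Comp C w x y h g) f)"
  using assms by (simp add: Comp_assoc Comp_Hom)

lemma zero_objectI:
  assumes z: "z \<in> Ob C" and 0: "Idt C z = \<zero>\<^bsub>Hom_vs C z z\<^esub>"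
  shows "is_zero_object C z"
proof -
  have "f = \<zero>\<^bsub>Hom_vs C x z\<^esub>" if "x \<in> Ob C" "f \<in> Hom C x z" for x f
    using that z Comp_Idt_left[of x z f] Comp_left(1)[of x z z f] 0 by simp
  moreover have "f = \<zero>\<^bsub>Hom_vs C z x\<^esub>" if "x \<in> Ob C" "f \<in> Hom C z x" for x f
    using that z Comp_Idt_right[of z x f] Comp_right(1)[of z z x f] 0 by simp
  ultimately show ?thesis
    using z Hom_closed(1) unfolding is_zero_object_def by blast
qed

lemma biproduct_empty:
  assumes z: "z \<in> Ob C" and 0: "Idt C z = \<zero>\<^bsub>Hom_vs C z z\<^esub>"
  shows "is_biproduct C 0 s z"
proof -
  interpret abelian_group "Hom_vs C z z" by (rule Hom_abelian_group) fact+
  show ?thesis using z 0 by (simp add: is_biproduct_def)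
qed

lemma biproduct_singleton:
  assumes x: "x \<in> Ob C"
  shows "is_biproduct C (Suc 0) (\<lambda>_. x) x"
proof -
  interpret A: abelian_group "Hom_vs C x x" by (rule Hom_abelian_group) fact+
  note [simp] = Idt_Hom[OF x] Comp_Idt_left[OF x x] carrier_Hom_vs[OF x x]
  show ?thesis
    unfolding is_biproduct_def
  proof (intro conjI exI)
    show "\<forall>i<Suc 0. Idt C x \<in> Hom C x x \<and> Idt C x \<in> Hom C x x" by simp
  qed (use x in \<open>auto simp: lessThan_Suc\<close>)
qed

end

section \<open>Retracts and biproducts\<close>

definition retract ::
  "('o, 'm, 'c) category_scheme \<Rightarrow> 'o \<Rightarrow> 'o \<Rightarrow> 'm \<Rightarrow> 'm \<Rightarrow> bool" where
  "retract C b x i p \<longleftrightarrow> b \<in> Ob C \<and> x \<in> Ob C \<and> i \<in> Hom C x b \<and> p \<in> Hom C b x \<and>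
     Comp C x b x p i = Idt C x"

text \<open>The relations p j = 0 and q i = 0 follow from these equations and are derived in
  \<open>binary_biproduct_orthogonal\<close>, so a construction has less to check.\<close>

definition binary_biproduct ::
  "('o, 'm, 'c) linear_category_scheme \<Rightarrow> 'o \<Rightarrow> 'o \<Rightarrow> 'o \<Rightarrow> 'm \<Rightarrow> 'm \<Rightarrow> 'm \<Rightarrow> 'm \<Rightarrow> bool" where
  "binary_biproduct C x y b i p j q \<longleftrightarrow> retract C b x i p \<and> retract C b y j q \<and>
     Comp C b x b i p \<oplus>\<^bsub>Hom_vs C b b\<^esub> Comp C b y b j q = Idt C b"

context linear_category
begin

text \<open>Insert the identity i p + j q between p and j: since p i and q j are identities, p j = p
  j + p j, which forces p j = 0. Likewise for q i.\<close>

lemma binary_biproduct_orthogonal: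
  assumes "binary_biproduct C x y b i p j q"
  shows "Comp C y b x p j = \<zero>\<^bsub>Hom_vs C y x\<^esub>" "Comp C x b y q i = \<zero>\<^bsub>Hom_vs C x y\<^esub>"
proof -
  have *: "x \<in> Ob C" "y \<in> Ob C" "b \<in> Ob C" "i \<in> Hom C x b" "p \<in> Hom C b x"
    "j \<in> Hom C y b" "q \<in> Hom C b y" "Comp C x b x p i = Idt C x" "Comp C y b y q j = Idt C y"
    and sum: "Comp C b x b i p \<oplus>\<^bsub>Hom_vs C b b\<^esub> Comp C b y b j q = Idt C b"
    using assms by (auto simp: binary_biproduct_def retract_def)
  note [simp] = * Comp_Hom
  have cancel: "a = \<zero>\<^bsub>Hom_vs C u v\<^esub>"
    if uv: "u \<in> Ob C" "v \<in> Ob C" and a: "a \<in> Hom C u v" "a \<oplus>\<^bsub>Hom_vs C u v\<^esub> a = a" for u v a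
  proof -
    interpret abelian_group "Hom_vs C u v" by (rule Hom_abelian_group) fact+
    show ?thesis using a carrier_Hom_vs[OF uv] by (metis add.r_cancel_one')
  qed
  have "Comp C y b x p j = Comp C y b x p (Comp C y b b (Idt C b) j)"
    by (simp add: Comp_Idt_left)
  also have "\<dots> = Comp C y b x p (Comp C y b b (Comp C b x b i p) j) \<oplus>\<^bsub>Hom_vs C y x\<^esub>
      Comp C y b x p (Comp C y b b (Comp C b y b j q) j)"
    by (simp add: Comp_left(2) Comp_right(2) flip: sum)
  also have "Comp C y b x p (Comp C y b b (Comp C b x b i p) j) = Comp C y b x p j"
    by (simp add: Comp_assoc) (simp add: Comp_Idt_left flip: Comp_assoc[of y x b x])
  also have "Comp C y b x p (Comp C y b b (Comp C b y b j q) j) = Comp C y b x p j"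
    by (simp add: Comp_assoc Comp_Idt_right)
  finally show "Comp C y b x p j = \<zero>\<^bsub>Hom_vs C y x\<^esub>" by (intro cancel) auto
  have "Comp C x b y q i = Comp C x b y q (Comp C x b b (Idt C b) i)"
    by (simp add: Comp_Idt_left)
  also have "\<dots> = Comp C x b y q (Comp C x b b (Comp C b x b i p) i) \<oplus>\<^bsub>Hom_vs C x y\<^esub>
      Comp C x b y q (Comp C x b b (Comp C b y b j q) i)"
    by (simp add: Comp_left(2) Comp_right(2) flip: sum)
  also have "Comp C x b y q (Comp C x b b (Comp C b y b j q) i) = Comp C x b y q i"
    by (simp add: Comp_assoc) (simp add: Comp_Idt_left flip: Comp_assoc[of x y b y])
  also have "Comp C x b y q (Comp C x b b (Comp C b x b i p) i) = Comp C x b y q i"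
    by (simp add: Comp_assoc Comp_Idt_right)
  finally show "Comp C x b y q i = \<zero>\<^bsub>Hom_vs C x y\<^esub>" by (intro cancel) auto
qed

text \<open>The injections and projections are composites through x or y. For indices in different
  blocks the composite passes through p j or q i and vanishes; the sum splits at n into parts that
  collapse to i p and j q.\<close>

lemma biproduct_append:
  assumes b: "binary_biproduct C x y b i p j q"
    and x: "is_biproduct C n s x" and y: "is_biproduct C m t y"
  shows "is_biproduct C (n + m) (\<lambda>k. if k < n then s k else t (k - n)) b"
proof -
  have *: "x \<in> Ob C" "y \<in> Ob C" "b \<in> Ob C" "i \<in> Hom C x b" "p \<in> Hom C b x"
    "j \<in> Hom C y b" "q \<in> Hom C b y" "Comp C x b x p i = Idt C x" "Comp C y b y q j = Idt C y"
    and sum: "Comp C b x b i p \<oplus>\<^bsub>Hom_vs C b b\<^esub> Comp C b y b j q = Idt C b"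
    using b by (auto simp: binary_biproduct_def retract_def)
  obtain \<iota>1 \<pi>1 where 1: "\<And>k. k < n \<Longrightarrow> s k \<in> Ob C"
    "\<And>k. k < n \<Longrightarrow> \<iota>1 k \<in> Hom C (s k) x" "\<And>k. k < n \<Longrightarrow> \<pi>1 k \<in> Hom C x (s k)"
    and orth1: "\<And>k l. k < n \<Longrightarrow> l < n \<Longrightarrow> Comp C (s k) x (s l) (\<pi>1 l) (\<iota>1 k) =
      (if k = l then Idt C (s k) else \<zero>\<^bsub>Hom_vs C (s k) (s l)\<^esub>)"
    and sum1: "(\<Oplus>\<^bsub>Hom_vs C x x\<^esub>k\<in>{..<n}. Comp C x (s k) x (\<iota>1 k) (\<pi>1 k)) = Idt C x"
    using x unfolding is_biproduct_def by blast
  obtain \<iota>2 \<pi>2 where 2: "\<And>k. k < m \<Longrightarrow> t k \<in> Ob C"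
    "\<And>k. k < m \<Longrightarrow> \<iota>2 k \<in> Hom C (t k) y" "\<And>k. k < m \<Longrightarrow> \<pi>2 k \<in> Hom C y (t k)"
    and orth2: "\<And>k l. k < m \<Longrightarrow> l < m \<Longrightarrow> Comp C (t k) y (t l) (\<pi>2 l) (\<iota>2 k) =
      (if k = l then Idt C (t k) else \<zero>\<^bsub>Hom_vs C (t k) (t l)\<^esub>)"
    and sum2: "(\<Oplus>\<^bsub>Hom_vs C y y\<^esub>k\<in>{..<m}. Comp C y (t k) y (\<iota>2 k) (\<pi>2 k)) = Idt C y"
    using y unfolding is_biproduct_def by blast
  note [simp] = * 1 2 Comp_Hom Idt_Hom
  define u where "u k = (if k < n then s k else t (k - n))" for k
  define \<iota> where "\<iota> k = (if k < n then Comp C (s k) x b i (\<iota>1 k)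
    else Comp C (t (k - n)) y b j (\<iota>2 (k - n)))" for k
  define \<pi> where "\<pi> k = (if k < n then Comp C b x (s k) (\<pi>1 k) p
    else Comp C b y (t (k - n)) (\<pi>2 (k - n)) q)" for k
  have [simp]: "u k \<in> Ob C" "\<iota> k \<in> Hom C (u k) b" "\<pi> k \<in> Hom C b (u k)" if "k < n + m" for k
    using that by (auto simp: u_def \<iota>_def \<pi>_def)
  note orth = binary_biproduct_orthogonal[OF b]
  have "Comp C (u k) b (u l) (\<pi> l) (\<iota> k) =
      (if k = l then Idt C (u k) else \<zero>\<^bsub>Hom_vs C (u k) (u l)\<^esub>)"
    if "k < n + m" "l < n + m" for k l
  proof -
    have neq: "\<not> l < n \<Longrightarrow> \<not> k < n \<Longrightarrow> k - n = l - n \<longleftrightarrow> k = l" by auto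
    consider "k < n" "l < n" | "k < n" "\<not> l < n" | "\<not> k < n" "l < n" | "\<not> k < n" "\<not> l < n" by blast
    then show ?thesis
    proof cases
      case 1
      then show ?thesis
        by (auto simp: u_def \<iota>_def \<pi>_def Comp_middle[of _ x b x] Comp_Idt_left orth1)
    next
      case 2
      with that have "l - n < m" by auto
      with 2 show ?thesis
        by (auto simp: u_def \<iota>_def \<pi>_def Comp_middle[of _ x b y] orth Comp_left Comp_right)
    next
      case 3
      with that have "k - n < m" by auto
      with 3 show ?thesis
        by (auto simp: u_def \<iota>_def \<pi>_def Comp_middle[of _ y b x] orth Comp_left Comp_right)
    next
      case 4
      with that have "k - n < m" "l - n < m" by auto
      with 4 show ?thesis
        by (auto simp: u_def \<iota>_def \<pi>_def Comp_middle[of _ y b y] Comp_Idt_left orth2 neq)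
    qed
  qed
  moreover have "(\<Oplus>\<^bsub>Hom_vs C b b\<^esub>k\<in>{..<n + m}. Comp C b (u k) b (\<iota> k) (\<pi> k)) = Idt C b"
  proof -
    interpret B: abelian_group "Hom_vs C b b" by (rule Hom_abelian_group) fact+
    have "(\<Oplus>\<^bsub>Hom_vs C b b\<^esub>k\<in>{..<n + m}. Comp C b (u k) b (\<iota> k) (\<pi> k)) =
        (\<Oplus>\<^bsub>Hom_vs C b b\<^esub>k\<in>{..<n}. Comp C b (u k) b (\<iota> k) (\<pi> k)) \<oplus>\<^bsub>Hom_vs C b b\<^esub>
        (\<Oplus>\<^bsub>Hom_vs C b b\<^esub>k\<in>{..<m}. Comp C b (u (n + k)) b (\<iota> (n + k)) (\<pi> (n + k)))"
      by (rule B.finsum_lessThan_add) (simp add: carrier_Hom_vs)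
    also have "(\<Oplus>\<^bsub>Hom_vs C b b\<^esub>k\<in>{..<n}. Comp C b (u k) b (\<iota> k) (\<pi> k)) =
        (\<Oplus>\<^bsub>Hom_vs C b b\<^esub>k\<in>{..<n}. Comp C b x b i (Comp C b x x (Comp C x (s k) x (\<iota>1 k) (\<pi>1 k)) p))"
      by (rule Hom_finsum_cong) (auto simp: u_def \<iota>_def \<pi>_def Comp_middle)
    also have "\<dots> = Comp C b x b i (Comp C b x x (Idt C x) p)"
      unfolding sum1[symmetric] by (subst Comp_left(4), simp_all, subst Comp_right(4), simp_all)
    also have "\<dots> = Comp C b x b i p" by (simp add: Comp_Idt_left)
    also have "(\<Oplus>\<^bsub>Hom_vs C b b\<^esub>k\<in>{..<m}. Comp C b (u (n + k)) b (\<iota> (n + k)) (\<pi> (n + k))) =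
        (\<Oplus>\<^bsub>Hom_vs C b b\<^esub>k\<in>{..<m}. Comp C b y b j (Comp C b y y (Comp C y (t k) y (\<iota>2 k) (\<pi>2 k)) q))"
      by (rule Hom_finsum_cong) (auto simp: u_def \<iota>_def \<pi>_def Comp_middle)
    also have "\<dots> = Comp C b y b j (Comp C b y y (Idt C y) q)"
      unfolding sum2[symmetric] by (subst Comp_left(4), simp_all, subst Comp_right(4), simp_all)
    also have "\<dots> = Comp C b y b j q" by (simp add: Comp_Idt_left)
    finally show ?thesis by (simp add: sum)
  qed
  ultimately have "is_biproduct C (n + m) u b"
    unfolding is_biproduct_def by (intro conjI exI[of _ \<iota>] exI[of _ \<pi>]) auto
  then show ?thesis unfolding u_def[abs_def] .
qed

lemma Hom_vs_simps:
  assumes xy: "x \<in> Ob C" "y \<in> Ob C" and f: "f \<in> Hom C x y"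
  shows "f \<oplus>\<^bsub>Hom_vs C x y\<^esub> \<zero>\<^bsub>Hom_vs C x y\<^esub> = f" "0 \<odot>\<^bsub>Hom_vs C x y\<^esub> f = \<zero>\<^bsub>Hom_vs C x y\<^esub>"
    "\<zero>\<^bsub>Hom_vs C x y\<^esub> \<oplus>\<^bsub>Hom_vs C x y\<^esub> f = f"
    "1 \<odot>\<^bsub>Hom_vs C x y\<^esub> f = f" "(a * b) \<odot>\<^bsub>Hom_vs C x y\<^esub> f = a \<odot>\<^bsub>Hom_vs C x y\<^esub> (b \<odot>\<^bsub>Hom_vs C x y\<^esub> f)"
    "(a + b) \<odot>\<^bsub>Hom_vs C x y\<^esub> f = a \<odot>\<^bsub>Hom_vs C x y\<^esub> f \<oplus>\<^bsub>Hom_vs C x y\<^esub> b \<odot>\<^bsub>Hom_vs C x y\<^esub> f"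
    and "g \<in> Hom C x y \<Longrightarrow> f \<oplus>\<^bsub>Hom_vs C x y\<^esub> g = g \<oplus>\<^bsub>Hom_vs C x y\<^esub> f"
    and "g \<in> Hom C x y \<Longrightarrow> h \<in> Hom C x y \<Longrightarrow>
      (f \<oplus>\<^bsub>Hom_vs C x y\<^esub> g) \<oplus>\<^bsub>Hom_vs C x y\<^esub> h = f \<oplus>\<^bsub>Hom_vs C x y\<^esub> (g \<oplus>\<^bsub>Hom_vs C x y\<^esub> h)"
    and "g \<in> Hom C x y \<Longrightarrow>
      a \<odot>\<^bsub>Hom_vs C x y\<^esub> (f \<oplus>\<^bsub>Hom_vs C x y\<^esub> g) = a \<odot>\<^bsub>Hom_vs C x y\<^esub> f \<oplus>\<^bsub>Hom_vs C x y\<^esub> a \<odot>\<^bsub>Hom_vs C x y\<^esub> g"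
proof -
  interpret V: vectorspace class_ring "Hom_vs C x y" by (rule Hom_vectorspace) fact+
  note [simp] = carrier_Hom_vs[OF xy] f
  note smult = complex_vectorspace_smult[OF V.vectorspace_axioms, of f]
  show "f \<oplus>\<^bsub>Hom_vs C x y\<^esub> \<zero>\<^bsub>Hom_vs C x y\<^esub> = f" "0 \<odot>\<^bsub>Hom_vs C x y\<^esub> f = \<zero>\<^bsub>Hom_vs C x y\<^esub>"
    "\<zero>\<^bsub>Hom_vs C x y\<^esub> \<oplus>\<^bsub>Hom_vs C x y\<^esub> f = f"
    "1 \<odot>\<^bsub>Hom_vs C x y\<^esub> f = f" "(a * b) \<odot>\<^bsub>Hom_vs C x y\<^esub> f = a \<odot>\<^bsub>Hom_vs C x y\<^esub> (b \<odot>\<^bsub>Hom_vs C x y\<^esub> f)"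
    "(a + b) \<odot>\<^bsub>Hom_vs C x y\<^esub> f = a \<odot>\<^bsub>Hom_vs C x y\<^esub> f \<oplus>\<^bsub>Hom_vs C x y\<^esub> b \<odot>\<^bsub>Hom_vs C x y\<^esub> f"
    using smult V.r_zero[of f] V.l_zero[of f] by simp_all
  show "g \<in> Hom C x y \<Longrightarrow> f \<oplus>\<^bsub>Hom_vs C x y\<^esub> g = g \<oplus>\<^bsub>Hom_vs C x y\<^esub> f"
    "g \<in> Hom C x y \<Longrightarrow> h \<in> Hom C x y \<Longrightarrow>
      (f \<oplus>\<^bsub>Hom_vs C x y\<^esub> g) \<oplus>\<^bsub>Hom_vs C x y\<^esub> h = f \<oplus>\<^bsub>Hom_vs C x y\<^esub> (g \<oplus>\<^bsub>Hom_vs C x y\<^esub> h)"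
    "g \<in> Hom C x y \<Longrightarrow>
      a \<odot>\<^bsub>Hom_vs C x y\<^esub> (f \<oplus>\<^bsub>Hom_vs C x y\<^esub> g) = a \<odot>\<^bsub>Hom_vs C x y\<^esub> f \<oplus>\<^bsub>Hom_vs C x y\<^esub> a \<odot>\<^bsub>Hom_vs C x y\<^esub> g"
    using V.a_comm[of f g] V.a_assoc[of f g h] V.smult_r_distr[of a f g] by simp_all
qed

lemma Hom_smult_zero:
  assumes xy: "x \<in> Ob C" "y \<in> Ob C"
  shows "a \<odot>\<^bsub>Hom_vs C x y\<^esub> \<zero>\<^bsub>Hom_vs C x y\<^esub> = \<zero>\<^bsub>Hom_vs C x y\<^esub>"
proof -
  interpret V: vectorspace class_ring "Hom_vs C x y" by (rule Hom_vectorspace) fact+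
  show ?thesis using V.smult_r_null[of a] by simp
qed

lemma Hom_finsum_const:
  assumes xy: "x \<in> Ob C" "y \<in> Ob C" and f: "f \<in> Hom C x y" and A: "finite A"
  shows "(\<Oplus>\<^bsub>Hom_vs C x y\<^esub>i\<in>A. f) = of_nat (card A) \<odot>\<^bsub>Hom_vs C x y\<^esub> f"
proof -
  interpret V: abelian_group "Hom_vs C x y" by (rule Hom_abelian_group) fact+
  note [simp] = carrier_Hom_vs[OF xy] f Hom_closed[OF xy] Hom_vs_simps(2)[OF xy f]
  show ?thesis
    using A
  proof (induction A)
    case (insert a A)
    then have "(\<Oplus>\<^bsub>Hom_vs C x y\<^esub>i\<in>insert a A. f) = f \<oplus>\<^bsub>Hom_vs C x y\<^esub> of_nat (card A) \<odot>\<^bsub>Hom_vs C x y\<^esub> f"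
      by (subst V.finsum_insert) auto
    also have "\<dots> = (1 + of_nat (card A)) \<odot>\<^bsub>Hom_vs C x y\<^esub> f"
      using Hom_vs_simps(4,6)[OF xy f] by simp
    finally show ?case using insert by simp
  qed simp
qed

lemma binary_biproduct_proj:
  assumes b: "binary_biproduct C x y b i p j q" and w: "w \<in> Ob C"
  shows "f \<in> Hom C w x \<Longrightarrow> Comp C w b x p (Comp C w x b i f) = f"
    and "f \<in> Hom C w x \<Longrightarrow> Comp C w b y q (Comp C w x b i f) = \<zero>\<^bsub>Hom_vs C w y\<^esub>"
    and "g \<in> Hom C w y \<Longrightarrow> Comp C w b y q (Comp C w y b j g) = g"
    and "g \<in> Hom C w y \<Longrightarrow> Comp C w b x p (Comp C w y b j g) = \<zero>\<^bsub>Hom_vs C w x\<^esub>"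
proof -
  have * [simp]: "x \<in> Ob C" "y \<in> Ob C" "b \<in> Ob C" "i \<in> Hom C x b" "p \<in> Hom C b x"
    "j \<in> Hom C y b" "q \<in> Hom C b y" "Comp C x b x p i = Idt C x" "Comp C y b y q j = Idt C y"
    using b by (auto simp: binary_biproduct_def retract_def)
  note simps = binary_biproduct_orthogonal[OF b] Comp_Idt_left Comp_left
  show "f \<in> Hom C w x \<Longrightarrow> Comp C w b x p (Comp C w x b i f) = f"
    "f \<in> Hom C w x \<Longrightarrow> Comp C w b y q (Comp C w x b i f) = \<zero>\<^bsub>Hom_vs C w y\<^esub>"
    "g \<in> Hom C w y \<Longrightarrow> Comp C w b y q (Comp C w y b j g) = g"
    "g \<in> Hom C w y \<Longrightarrow> Comp C w b x p (Comp C w y b j g) = \<zero>\<^bsub>Hom_vs C w x\<^esub>"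
    using w by (simp_all add: simps flip: Comp_assoc)
qed

text \<open>Any h into b equals i p h + j q h, so its two projections determine it. The functor laws
  of pointwise biproducts, and the naturality of their injections, are checked in this way.\<close>

lemma binary_biproduct_eqI:
  assumes b: "binary_biproduct C x y b i p j q" and w: "w \<in> Ob C" and f: "f \<in> Hom C w b" "g \<in> Hom C w b"
    and eq: "Comp C w b x p f = Comp C w b x p g" "Comp C w b y q f = Comp C w b y q g"
  shows "f = g"
proof -
  have * [simp]: "x \<in> Ob C" "y \<in> Ob C" "b \<in> Ob C" "i \<in> Hom C x b" "p \<in> Hom C b x"
    "j \<in> Hom C y b" "q \<in> Hom C b y"
    and sum: "Comp C b x b i p \<oplus>\<^bsub>Hom_vs C b b\<^esub> Comp C b y b j q = Idt C b"
    using b by (auto simp: binary_biproduct_def retract_def)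
  have "h = Comp C w x b i (Comp C w b x p h) \<oplus>\<^bsub>Hom_vs C w b\<^esub> Comp C w y b j (Comp C w b y q h)"
    if "h \<in> Hom C w b" for h
  proof -
    have "h = Comp C w b b (Idt C b) h" using w that by (simp add: Comp_Idt_left)
    then show ?thesis
      unfolding sum[symmetric] using w that by (simp add: Comp_left(2) Comp_assoc Comp_Hom)
  qed
  then show ?thesis using f eq by metis
qed

text \<open>The product property of a biproduct: the lift is the sum of the composites of \<iota> k
  with u k, and writing the identity of b as the sum of all \<iota> k \<pi> k gives
  uniqueness.\<close>

lemma biproduct_lift:
  assumes b: "is_biproduct C n s b"
  obtains \<pi> where "\<And>k. k < n \<Longrightarrow> \<pi> k \<in> Hom C b (s k)"
    and "\<And>w u. w \<in> Ob C \<Longrightarrow> (\<And>k. k < n \<Longrightarrow> u k \<in> Hom C w (s k)) \<Longrightarrow>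
      \<exists>v\<in>Hom C w b. \<forall>k<n. Comp C w b (s k) (\<pi> k) v = u k"
    and "\<And>w u v. w \<in> Ob C \<Longrightarrow> u \<in> Hom C w b \<Longrightarrow> v \<in> Hom C w b \<Longrightarrow>
      (\<And>k. k < n \<Longrightarrow> Comp C w b (s k) (\<pi> k) u = Comp C w b (s k) (\<pi> k) v) \<Longrightarrow> u = v"
proof -
  have [simp]: "b \<in> Ob C" "\<And>k. k < n \<Longrightarrow> s k \<in> Ob C" using b by (auto simp: is_biproduct_def)
  obtain \<iota> \<pi> where
    [simp]: "\<And>k. k < n \<Longrightarrow> \<iota> k \<in> Hom C (s k) b" "\<And>k. k < n \<Longrightarrow> \<pi> k \<in> Hom C b (s k)"
    and orth: "\<And>k l. k < n \<Longrightarrow> l < n \<Longrightarrow> Comp C (s k) b (s l) (\<pi> l) (\<iota> k) =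
      (if k = l then Idt C (s k) else \<zero>\<^bsub>Hom_vs C (s k) (s l)\<^esub>)"
    and sum: "(\<Oplus>\<^bsub>Hom_vs C b b\<^esub>k\<in>{..<n}. Comp C b (s k) b (\<iota> k) (\<pi> k)) = Idt C b"
    using b unfolding is_biproduct_def by blast
  note [simp] = Comp_Hom
  show thesis
  proof
    fix w u assume w [simp]: "w \<in> Ob C" and u [simp]: "\<And>k. k < n \<Longrightarrow> u k \<in> Hom C w (s k)"
    define v where "v = (\<Oplus>\<^bsub>Hom_vs C w b\<^esub>k\<in>{..<n}. Comp C w (s k) b (\<iota> k) (u k))"
    have "Comp C w b (s l) (\<pi> l) v = u l" if l [simp]: "l < n" for l
    proof -
      interpret A: abelian_group "Hom_vs C w (s l)" by (rule Hom_abelian_group) auto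
      have "Comp C w b (s l) (\<pi> l) v =
          (\<Oplus>\<^bsub>Hom_vs C w (s l)\<^esub>k\<in>{..<n}. Comp C w b (s l) (\<pi> l) (Comp C w (s k) b (\<iota> k) (u k)))"
        unfolding v_def by (rule Comp_right(4)) auto
      also have "\<dots> = (\<Oplus>\<^bsub>Hom_vs C w (s l)\<^esub>k\<in>{..<n}. if l = k then u l else \<zero>\<^bsub>Hom_vs C w (s l)\<^esub>)"
        by (rule Hom_finsum_cong)
          (auto simp: orth Hom_closed Comp_Idt_left Comp_left simp flip: Comp_assoc)
      also have "\<dots> = u l"
        by (subst A.add.finprod_singleton) (auto simp: carrier_Hom_vs)
      finally show ?thesis .
    qed
    moreover have "v \<in> Hom C w b" unfolding v_def by (rule Hom_closed(4)) auto
    ultimately show "\<exists>v\<in>Hom C w b. \<forall>k<n. Comp C w b (s k) (\<pi> k) v = u k" by blast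
  next
    fix w u v assume w [simp]: "w \<in> Ob C" and uv: "u \<in> Hom C w b" "v \<in> Hom C w b"
      and eq: "\<And>k. k < n \<Longrightarrow> Comp C w b (s k) (\<pi> k) u = Comp C w b (s k) (\<pi> k) v"
    have expand: "h = (\<Oplus>\<^bsub>Hom_vs C w b\<^esub>k\<in>{..<n}. Comp C w (s k) b (\<iota> k) (Comp C w b (s k) (\<pi> k) h))"
      if h [simp]: "h \<in> Hom C w b" for h
    proof -
      have "h = Comp C w b b (\<Oplus>\<^bsub>Hom_vs C b b\<^esub>k\<in>{..<n}. Comp C b (s k) b (\<iota> k) (\<pi> k)) h"
        by (simp add: sum Comp_Idt_left)
      also have "\<dots> = (\<Oplus>\<^bsub>Hom_vs C w b\<^esub>k\<in>{..<n}. Comp C w b b (Comp C b (s k) b (\<iota> k) (\<pi> k)) h)"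
        by (rule Comp_left(4)) auto
      also have "\<dots> = (\<Oplus>\<^bsub>Hom_vs C w b\<^esub>k\<in>{..<n}. Comp C w (s k) b (\<iota> k) (Comp C w b (s k) (\<pi> k) h))"
        by (rule Hom_finsum_cong) (auto simp: Comp_assoc)
      finally show ?thesis .
    qed
    have "(\<Oplus>\<^bsub>Hom_vs C w b\<^esub>k\<in>{..<n}. Comp C w (s k) b (\<iota> k) (Comp C w b (s k) (\<pi> k) u)) =
        (\<Oplus>\<^bsub>Hom_vs C w b\<^esub>k\<in>{..<n}. Comp C w (s k) b (\<iota> k) (Comp C w b (s k) (\<pi> k) v))"
      using uv by (intro Hom_finsum_cong) (auto simp: eq)
    then show "u = v" using expand[OF uv(1)] expand[OF uv(2)] by simp
  qed auto
qed

end

section \<open>Semisimplicity from regularity\<close>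

context linear_category
begin

lemma biproduct_cong:
  assumes b: "is_biproduct C n s b" and eq: "\<And>k. k < n \<Longrightarrow> s k = t k"
  shows "is_biproduct C n t b"
proof -
  obtain \<iota> \<pi> where *: "b \<in> Ob C" "\<And>k. k < n \<Longrightarrow> s k \<in> Ob C"
    "\<And>k. k < n \<Longrightarrow> \<iota> k \<in> Hom C (s k) b" "\<And>k. k < n \<Longrightarrow> \<pi> k \<in> Hom C b (s k)"
    and orth: "\<And>k l. k < n \<Longrightarrow> l < n \<Longrightarrow> Comp C (s k) b (s l) (\<pi> l) (\<iota> k) =
      (if k = l then Idt C (s k) else \<zero>\<^bsub>Hom_vs C (s k) (s l)\<^esub>)"
    and sum: "(\<Oplus>\<^bsub>Hom_vs C b b\<^esub>k\<in>{..<n}. Comp C b (s k) b (\<iota> k) (\<pi> k)) = Idt C b"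
    using b unfolding is_biproduct_def by blast
  have "(\<Oplus>\<^bsub>Hom_vs C b b\<^esub>k\<in>{..<n}. Comp C b (t k) b (\<iota> k) (\<pi> k)) =
      (\<Oplus>\<^bsub>Hom_vs C b b\<^esub>k\<in>{..<n}. Comp C b (s k) b (\<iota> k) (\<pi> k))"
    by (rule Hom_finsum_cong) (auto simp: eq[symmetric] * Comp_Hom)
  then show ?thesis
    unfolding is_biproduct_def using * orth
    by (intro conjI exI[of _ \<iota>] exI[of _ \<pi>]) (auto simp: sum eq[symmetric])
qed

text \<open>The map a |-> i a p embeds the endomorphisms of y in those of x, with a recovered as p
  (i a p) i. If it hit the identity of x, then a would be the identity of y, and i p that of
  x.\<close>

lemma retract_dim_less:
  assumes r: "retract C x y i p" and ne: "Comp C x y x i p \<noteq> Idt C x"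
  shows "vs_dim (Hom_vs C y y) < vs_dim (Hom_vs C x x)"
proof -
  have * [simp]: "x \<in> Ob C" "y \<in> Ob C" "i \<in> Hom C y x" "p \<in> Hom C x y" "Comp C y x y p i = Idt C y"
    using r by (auto simp: retract_def)
  note [simp] = Comp_Hom Idt_Hom carrier_Hom_vs
  define \<phi> where "\<phi> a = Comp C x y x i (Comp C x y y a p)" for a
  have p\<phi>: "Comp C y x y (Comp C x x y p (\<phi> a)) i = a" if [simp]: "a \<in> Hom C y y" for a
  proof -
    have "Comp C x x y p (\<phi> a) = Comp C x y y (Comp C y x y p i) (Comp C x y y a p)"
      unfolding \<phi>_def by (subst Comp_assoc[of x y x y]) simp_all
    also have "\<dots> = Comp C x y y a p" by (simp add: Comp_Idt_left)
    finally show ?thesis by (simp add: Comp_assoc[of y x y y] Comp_Idt_right)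
  qed
  have lin: "\<phi> \<in> linear_maps (Hom_vs C y y) (Hom_vs C x x)"
    by (rule linear_mapsI) (simp_all add: \<phi>_def Comp_left Comp_right)
  have inj: "inj_on \<phi> (carrier (Hom_vs C y y))"
    using p\<phi> by (intro inj_onI) (metis *(2) carrier_Hom_vs)
  have "Idt C x \<notin> \<phi> ` carrier (Hom_vs C y y)"
  proof
    assume "Idt C x \<in> \<phi> ` carrier (Hom_vs C y y)"
    then obtain a where [simp]: "a \<in> Hom C y y" and a: "\<phi> a = Idt C x" by auto
    have "a = Idt C y" using p\<phi>[of a] by (simp add: a Comp_Idt_right)
    then show False using a ne by (simp add: \<phi>_def Comp_Idt_left)
  qed
  then show ?thesis
    by (intro fd_vs_inj(2)[OF _ _ _ lin inj]) (simp_all add: Hom_vectorspace fd_vsD fd_vs_Hom_vs)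
qed

text \<open>A linear bijection of hom(x, x) with the complex line amounts to a nonzero identity that
  spans; this is the form used from here on. A zero identity would make every endomorphism vanish,
  including the one sent to 1.\<close>

lemma simple_objectD:
  assumes "simple_object C x"
  shows "x \<in> Ob C" "Idt C x \<noteq> \<zero>\<^bsub>Hom_vs C x x\<^esub>"
    and "a \<in> Hom C x x \<Longrightarrow> \<exists>c. a = c \<odot>\<^bsub>Hom_vs C x x\<^esub> Idt C x"
proof -
  show x: "x \<in> Ob C" using assms by (simp add: simple_object_def)
  note [simp] = x Idt_Hom[OF x] carrier_Hom_vs[OF x x] Hom_closed[OF x x]
  note V = Hom_vectorspace[OF x x]
  obtain \<phi> where \<phi>: "\<phi> \<in> linear_maps (Hom_vs C x x) complex_vs" and bij: "bij_betw \<phi> (Hom C x x) UNIV"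
    using assms by (auto simp: simple_object_def)
  have 0: "\<phi> \<zero>\<^bsub>Hom_vs C x x\<^esub> = 0"
    using linear_maps_zero[OF V complex_vectorspace_complex_vs \<phi>] by simp
  obtain b where b: "b \<in> Hom C x x" "\<phi> b = 1"
    using bij by (metis UNIV_I bij_betw_imp_surj_on imageE)
  show ne: "Idt C x \<noteq> \<zero>\<^bsub>Hom_vs C x x\<^esub>"
  proof
    assume "Idt C x = \<zero>\<^bsub>Hom_vs C x x\<^esub>"
    then have "b = \<zero>\<^bsub>Hom_vs C x x\<^esub>"
      using Comp_Idt_left[of x x b] Comp_left(1)[of x x x b] b by simp
    then show False using b 0 by simp
  qed
  have inj: "inj_on \<phi> (Hom C x x)" using bij by (simp add: bij_betw_def)
  then have 1: "\<phi> (Idt C x) \<noteq> 0"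
    using ne 0 by (metis Hom_closed(1) Idt_Hom inj_onD x)
  assume a: "a \<in> Hom C x x"
  have "\<phi> a = \<phi> ((\<phi> a / \<phi> (Idt C x)) \<odot>\<^bsub>Hom_vs C x x\<^esub> Idt C x)"
    using linear_mapsD(3)[OF \<phi>, of "Idt C x"] 1 by simp
  then have "a = (\<phi> a / \<phi> (Idt C x)) \<odot>\<^bsub>Hom_vs C x x\<^esub> Idt C x"
    using inj a by (auto dest: inj_onD)
  then show "\<exists>c. a = c \<odot>\<^bsub>Hom_vs C x x\<^esub> Idt C x" by blast
qed

text \<open>A functional that does not vanish at the identity is the required bijection, because
  every endomorphism is a multiple of the identity.\<close>

lemma simple_objectI:
  assumes x: "x \<in> Ob C" and ne: "Idt C x \<noteq> \<zero>\<^bsub>Hom_vs C x x\<^esub>"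
    and scalar: "\<And>a. a \<in> Hom C x x \<Longrightarrow> \<exists>c. a = c \<odot>\<^bsub>Hom_vs C x x\<^esub> Idt C x"
  shows "simple_object C x"
proof -
  note [simp] = x Idt_Hom[OF x] carrier_Hom_vs[OF x x] Hom_closed[OF x x]
  note V = Hom_vectorspace[OF x x]
  obtain l where l: "l \<in> linear_maps (Hom_vs C x x) complex_vs" and l1: "l (Idt C x) \<noteq> 0"
    using ex_nonzero_functional[OF fd_vs_Hom_vs[OF x x], of "Idt C x"] ne by auto
  have ls: "l (c \<odot>\<^bsub>Hom_vs C x x\<^esub> Idt C x) = c * l (Idt C x)" for c
    using linear_mapsD(3)[OF l, of "Idt C x" c] by simp
  have "inj_on l (Hom C x x)"
  proof (rule inj_onI)
    fix a b assume ab: "a \<in> Hom C x x" "b \<in> Hom C x x" "l a = l b"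
    obtain c d where "a = c \<odot>\<^bsub>Hom_vs C x x\<^esub> Idt C x" "b = d \<odot>\<^bsub>Hom_vs C x x\<^esub> Idt C x"
      using scalar ab by metis
    then show "a = b" using ab l1 by (simp add: ls)
  qed
  moreover have "z \<in> l ` Hom C x x" for z
    using ls[of "z / l (Idt C x)"] l1 by (intro image_eqI[of _ _ "(z / l (Idt C x)) \<odot>\<^bsub>Hom_vs C x x\<^esub> Idt C x"]) auto
  ultimately have "bij_betw l (Hom C x x) UNIV" by (auto simp: bij_betw_def)
  then show ?thesis using l by (auto simp: simple_object_def)
qed

end

text \<open>The last assumption is von Neumann regularity, the form in which Maschke's theorem is used.\<close>

locale regular_linear_category = linear_category +
  assumes ex_null_object: "\<exists>z\<in>Ob C. Idt C z = \<zero>\<^bsub>Hom_vs C z z\<^esub>"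
    and ex_binary_biproduct:
      "x \<in> Ob C \<Longrightarrow> y \<in> Ob C \<Longrightarrow> \<exists>b i p j q. binary_biproduct C x y b i p j q"
    and idempotent_split: "x \<in> Ob C \<Longrightarrow> e \<in> Hom C x x \<Longrightarrow> Comp C x x x e e = e \<Longrightarrow>
      \<exists>y i p. retract C x y i p \<and> Comp C x y x i p = e"
    and quasi_inverse: "x \<in> Ob C \<Longrightarrow> y \<in> Ob C \<Longrightarrow> f \<in> Hom C x y \<Longrightarrow>
      \<exists>g\<in>Hom C y x. Comp C x x y f (Comp C x y x g f) = f"
begin

lemma ex_finite_biproduct:
  assumes "\<And>i. i < n \<Longrightarrow> s i \<in> Ob C"
  shows "\<exists>b. is_biproduct C n s b"
  using assms
proof (induction n)
  case 0
  then show ?case using ex_null_object biproduct_empty by blast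
next
  case (Suc n)
  then obtain x where x: "is_biproduct C n s x" by force
  then have "x \<in> Ob C" by (simp add: is_biproduct_def)
  then obtain b i p j q where b: "binary_biproduct C x (s n) b i p j q"
    using ex_binary_biproduct Suc.prems by (metis lessI)
  have 1: "is_biproduct C (n + Suc 0) (\<lambda>k. if k < n then s k else s n) b"
    by (rule biproduct_append[OF b x biproduct_singleton]) (simp add: Suc.prems)
  \<comment> \<open>The appended family is constant from n on and agrees with \<open>s\<close> only
    below \<open>Suc n\<close>.\<close>
  have "is_biproduct C (Suc n) s b"
    by (rule biproduct_cong[OF 1[unfolded add_Suc_right add_0_right]]) (auto simp: less_Suc_eq)
  then show ?case by blast
qed

sublocale linear_additive_category
  using ex_null_object zero_objectI ex_finite_biproduct by unfold_locales blast+

text \<open>A non-scalar endomorphism has an eigenvalue, as left multiplication is an operator on a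
  finite-dimensional space; subtracting it and multiplying by a quasi-inverse gives the idempotent.\<close>

lemma ex_proper_idempotent:
  assumes x: "x \<in> Ob C" and a: "a \<in> Hom C x x"
    and ns: "\<And>c. a \<noteq> c \<odot>\<^bsub>Hom_vs C x x\<^esub> Idt C x"
  obtains e where "e \<in> Hom C x x" "Comp C x x x e e = e" "e \<noteq> \<zero>\<^bsub>Hom_vs C x x\<^esub>" "e \<noteq> Idt C x"
proof -
  note V = Hom_vectorspace[OF x x]
  interpret V: vectorspace class_ring "Hom_vs C x x" by (rule V)
  note [simp] = x Idt_Hom[OF x] Comp_Hom[OF x x x] carrier_Hom_vs[OF x x] Hom_closed[OF x x]
  let ?o = "\<zero>\<^bsub>Hom_vs C x x\<^esub>" and ?c = "Comp C x x x"
  have ne: "Idt C x \<noteq> ?o"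
  proof
    assume "Idt C x = ?o"
    then have "a = ?o" using Comp_Idt_left[OF x x a] Comp_left(1)[OF x x x a] by simp
    moreover have "0 \<odot>\<^bsub>Hom_vs C x x\<^esub> Idt C x = ?o"
      using complex_vectorspace_smult(2)[OF V, of "Idt C x"] by simp
    ultimately show False using ns[of 0] by simp
  qed
  obtain c u where u: "u \<in> Hom C x x" "u \<noteq> ?o" "?c a u = c \<odot>\<^bsub>Hom_vs C x x\<^esub> u"
    by (rule linear_map_eigenvector[OF fd_vs_Hom_vs[OF x x] Comp_linear_right[OF x x x a], of "Idt C x"])
      (use ne that in auto)
  define n where "n = a \<oplus>\<^bsub>Hom_vs C x x\<^esub> (- c) \<odot>\<^bsub>Hom_vs C x x\<^esub> Idt C x"
  have n: "n \<in> Hom C x x" using a by (simp add: n_def)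
  have "n \<noteq> ?o"
    using complex_vectorspace_eq_smultI[OF V, of a "Idt C x" c] a ns[of c] by (auto simp: n_def)
  have "?c n u = c \<odot>\<^bsub>Hom_vs C x x\<^esub> u \<oplus>\<^bsub>Hom_vs C x x\<^esub> (- c) \<odot>\<^bsub>Hom_vs C x x\<^esub> u"
    unfolding n_def using u a by (simp add: Comp_left(2,3) Comp_Idt_left)
  also have "\<dots> = ?o"
    using complex_vectorspace_smult(5)[OF V, of u c "- c"] complex_vectorspace_smult(2)[OF V, of u] u
    by simp
  finally have nu: "?c n u = ?o" .
  obtain g where g: "g \<in> Hom C x x" "?c n (?c g n) = n"
    using quasi_inverse[OF x x n] by auto
  define e where "e = ?c g n"
  have e: "e \<in> Hom C x x" using g n by (simp add: e_def)
  have "?c e e = ?c g (?c n (?c g n))"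
    unfolding e_def by (rule Comp_assoc) (use g n in auto)
  then have "?c e e = e" using g(2) by (simp add: e_def)
  moreover have "e \<noteq> ?o"
    using g \<open>n \<noteq> ?o\<close> Comp_right(1)[OF x x x n] by (auto simp: e_def)
  \<comment> \<open>\<open>n\<close> kills the nonzero \<open>u\<close>, hence so does e, the
    composite of g and \<open>n\<close>.\<close>
  moreover have "e \<noteq> Idt C x"
  proof
    assume *: "e = Idt C x"
    have "u = ?c e u" using u by (simp add: * Comp_Idt_left)
    also have "\<dots> = ?c g (?c n u)" unfolding e_def using g n u by (simp add: Comp_assoc)
    also have "\<dots> = ?o" using g by (simp add: nu Comp_right(1))
    finally show False using u by simp
  qed
  ultimately show thesis using that e by blast
qed

text \<open>Since e (1 - e) = 0, the complement 1 - e is idempotent as well. Splitting both yields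
  complementary retracts, because e + (1 - e) is the identity.\<close>

lemma idempotent_binary_biproduct:
  assumes x: "x \<in> Ob C" and e: "e \<in> Hom C x x" "Comp C x x x e e = e"
  obtains y z i p j q where "binary_biproduct C y z x i p j q" "Comp C x y x i p = e"
    "Comp C x z x j q = Idt C x \<oplus>\<^bsub>Hom_vs C x x\<^esub> (-1) \<odot>\<^bsub>Hom_vs C x x\<^esub> e"
proof -
  note V = Hom_vectorspace[OF x x]
  interpret V: vectorspace class_ring "Hom_vs C x x" by (rule V)
  note [simp] = x e Idt_Hom[OF x] Comp_Hom[OF x x x] carrier_Hom_vs[OF x x] Hom_closed[OF x x]
  let ?o = "\<zero>\<^bsub>Hom_vs C x x\<^esub>" and ?c = "Comp C x x x"
  define d where "d = Idt C x \<oplus>\<^bsub>Hom_vs C x x\<^esub> (-1) \<odot>\<^bsub>Hom_vs C x x\<^esub> e"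
  have d: "d \<in> Hom C x x" by (simp add: d_def)
  have "?c e d = ?o"
    using complex_vectorspace_minus[OF V, of e] by (simp add: d_def Comp_right Comp_Idt_right)
  then have "?c d d = d"
    using d V.smult_r_null[of "-1"] Comp_left(2)[OF x x x d, of "Idt C x" "(-1) \<odot>\<^bsub>Hom_vs C x x\<^esub> e"]
    by (simp add: Comp_left(3) Comp_Idt_left V.r_zero flip: d_def)
  with d idempotent_split[OF x d] idempotent_split[OF x e]
  obtain y i p z j q where *: "retract C x y i p" "Comp C x y x i p = e"
    "retract C x z j q" "Comp C x z x j q = d"
    by blast
  have "e \<oplus>\<^bsub>Hom_vs C x x\<^esub> d = Idt C x \<oplus>\<^bsub>Hom_vs C x x\<^esub> (e \<oplus>\<^bsub>Hom_vs C x x\<^esub> (-1) \<odot>\<^bsub>Hom_vs C x x\<^esub> e)"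
    unfolding d_def by (rule V.a_lcomm) simp_all
  also have "\<dots> = Idt C x"
    using complex_vectorspace_minus[OF V, of e] V.r_zero[of "Idt C x"] by simp
  finally have "binary_biproduct C y z x i p j q"
    using * by (simp add: binary_biproduct_def)
  with * that show thesis by (simp add: d_def)
qed

text \<open>Both pieces cut out by a proper idempotent e have smaller endomorphism spaces, since e
  and 1 - e differ from the identity; induction applies to them, and \<open>biproduct_append\<close>
  concatenates the decompositions. An object with zero identity is the empty biproduct.\<close>

lemma ex_simple_decomposition:
  assumes "x \<in> Ob C"
  shows "\<exists>n s. (\<forall>i<n. simple_object C (s i)) \<and> is_biproduct C n s x"
  using assms
proof (induction "vs_dim (Hom_vs C x x)" arbitrary: x rule: less_induct)
  case less
  note x = less.prems
  note V = Hom_vectorspace[OF x x]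
  interpret V: vectorspace class_ring "Hom_vs C x x" by (rule V)
  note [simp] = x Idt_Hom[OF x] carrier_Hom_vs[OF x x] Hom_closed[OF x x]
  consider "Idt C x = \<zero>\<^bsub>Hom_vs C x x\<^esub>" | "simple_object C x"
    | a where "a \<in> Hom C x x" "\<And>c. a \<noteq> c \<odot>\<^bsub>Hom_vs C x x\<^esub> Idt C x"
    using simple_objectI[OF x] by blast
  then show ?case
  proof cases
    case 1
    then show ?thesis using biproduct_empty[OF x] by (intro exI[of _ 0]) auto
  next
    case 2
    then show ?thesis using biproduct_singleton[OF x]
      by (intro exI[of _ "Suc 0"] exI[of _ "\<lambda>_. x"]) simp
  next
    case (3 a)
    obtain e where e: "e \<in> Hom C x x" "Comp C x x x e e = e" "e \<noteq> \<zero>\<^bsub>Hom_vs C x x\<^esub>" "e \<noteq> Idt C x"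
      by (rule ex_proper_idempotent[OF x 3])
    obtain y z i p j q where b: "binary_biproduct C y z x i p j q" "Comp C x y x i p = e"
      "Comp C x z x j q = Idt C x \<oplus>\<^bsub>Hom_vs C x x\<^esub> (-1) \<odot>\<^bsub>Hom_vs C x x\<^esub> e"
      by (rule idempotent_binary_biproduct[OF x e(1,2)])
    then have r: "retract C x y i p" "retract C x z j q" by (simp_all add: binary_biproduct_def)
    have "Comp C x z x j q \<noteq> Idt C x"
    proof
      assume *: "Comp C x z x j q = Idt C x"
      have "(-1) \<odot>\<^bsub>Hom_vs C x x\<^esub> e = \<zero>\<^bsub>Hom_vs C x x\<^esub>"
        using b(3) * e(1) V.add.l_cancel_one'[of "Idt C x" "(-1) \<odot>\<^bsub>Hom_vs C x x\<^esub> e"] by simp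
      then show False
        using complex_vectorspace_minus[OF V, of e] e by (simp add: V.r_zero)
    qed
    then have "vs_dim (Hom_vs C z z) < vs_dim (Hom_vs C x x)" by (rule retract_dim_less[OF r(2)])
    then obtain m t where t: "\<forall>i<m. simple_object C (t i)" "is_biproduct C m t z"
      using less.hyps[of z] r by (auto simp: retract_def)
    have "vs_dim (Hom_vs C y y) < vs_dim (Hom_vs C x x)"
      using e b by (intro retract_dim_less[OF r(1)]) simp
    then obtain n s where s: "\<forall>i<n. simple_object C (s i)" "is_biproduct C n s y"
      using less.hyps[of y] r by (auto simp: retract_def)
    have "is_biproduct C (n + m) (\<lambda>k. if k < n then s k else t (k - n)) x"
      by (rule biproduct_append[OF b(1) s(2) t(2)])
    moreover have "\<forall>k<n + m. simple_object C (if k < n then s k else t (k - n))"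
      using s(1) t(1) by auto
    ultimately show ?thesis
      by (intro exI[of _ "n + m"] exI[of _ "\<lambda>k. if k < n then s k else t (k - n)"]) simp
  qed
qed

text \<open>A form of Schur's lemma. For a quasi-inverse g, simplicity makes g f and f g scalars c
  and d; then f = f g f gives f = c f = d f, so c = d = 1 because f is nonzero.\<close>

lemma simple_isomorphic:
  assumes x: "simple_object C x" and y: "simple_object C y"
    and f: "f \<in> Hom C x y" "f \<noteq> \<zero>\<^bsub>Hom_vs C x y\<^esub>"
  shows "isomorphic C x y"
proof -
  note [simp] = simple_objectD(1)[OF x] simple_objectD(1)[OF y] f(1) Idt_Hom Comp_Hom carrier_Hom_vs
  obtain g where [simp]: "g \<in> Hom C y x" and fgf: "Comp C x x y f (Comp C x y x g f) = f"
    using quasi_inverse[of x y f] by auto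
  note smult = complex_vectorspace_smult[OF Hom_vectorspace]
  interpret A: vectorspace class_ring "Hom_vs C x y" by (rule Hom_vectorspace) simp_all
  obtain c where c: "Comp C x y x g f = c \<odot>\<^bsub>Hom_vs C x x\<^esub> Idt C x"
    using simple_objectD(3)[OF x, of "Comp C x y x g f"] by auto
  obtain d where d: "Comp C y x y f g = d \<odot>\<^bsub>Hom_vs C y y\<^esub> Idt C y"
    using simple_objectD(3)[OF y, of "Comp C y x y f g"] by auto
  have unit: "k = 1" if "f = k \<odot>\<^bsub>Hom_vs C x y\<^esub> f" for k
  proof (rule ccontr)
    assume "k \<noteq> 1"
    have "f \<oplus>\<^bsub>Hom_vs C x y\<^esub> (-1) \<odot>\<^bsub>Hom_vs C x y\<^esub> f = (k - 1) \<odot>\<^bsub>Hom_vs C x y\<^esub> f"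
      using smult(5)[of x y f k "-1"] that by simp
    then have "(k - 1) \<odot>\<^bsub>Hom_vs C x y\<^esub> f = \<zero>\<^bsub>Hom_vs C x y\<^esub>"
      using complex_vectorspace_minus[OF Hom_vectorspace, of x y f] by simp
    moreover have "inverse (k - 1) \<odot>\<^bsub>Hom_vs C x y\<^esub> ((k - 1) \<odot>\<^bsub>Hom_vs C x y\<^esub> f) = f"
      using smult(4)[of x y f "inverse (k - 1)" "k - 1"] smult(3)[of x y f] \<open>k \<noteq> 1\<close> by simp
    moreover have "inverse (k - 1) \<odot>\<^bsub>Hom_vs C x y\<^esub> \<zero>\<^bsub>Hom_vs C x y\<^esub> = \<zero>\<^bsub>Hom_vs C x y\<^esub>"
      by (simp add: A.smult_r_null)
    ultimately show False using f(2) by simp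
  qed
  have "f = c \<odot>\<^bsub>Hom_vs C x y\<^esub> f"
    using fgf by (simp add: c Comp_right(3) Comp_Idt_right)
  then have "c = 1" by (rule unit)
  have "Comp C x y y (Comp C y x y f g) f = f"
    using fgf by (simp add: Comp_assoc)
  then have "f = d \<odot>\<^bsub>Hom_vs C x y\<^esub> f"
    by (simp add: d Comp_left(3) Comp_Idt_left)
  then have "d = 1" by (rule unit)
  have "Comp C x y x g f = Idt C x" "Comp C y x y f g = Idt C y"
    using c d smult(3)[of x x "Idt C x"] smult(3)[of y y "Idt C y"] by (simp_all add: \<open>c = 1\<close> \<open>d = 1\<close>)
  then show ?thesis by (auto simp: isomorphic_def is_iso_def intro!: exI[of _ f] bexI[of _ g])
qed

text \<open>f is the sum of the composites \<iota> k \<pi> k f, so the maps \<pi> k f cannot all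
  vanish.\<close>

lemma nonzero_projection:
  assumes b: "is_biproduct C n s b" and x: "x \<in> Ob C"
    and f: "f \<in> Hom C x b" "f \<noteq> \<zero>\<^bsub>Hom_vs C x b\<^esub>"
  obtains i g where "i < n" "g \<in> Hom C x (s i)" "g \<noteq> \<zero>\<^bsub>Hom_vs C x (s i)\<^esub>"
proof -
  have [simp]: "b \<in> Ob C" "\<And>k. k < n \<Longrightarrow> s k \<in> Ob C" using b by (auto simp: is_biproduct_def)
  obtain \<iota> \<pi> where
    [simp]: "\<And>k. k < n \<Longrightarrow> \<iota> k \<in> Hom C (s k) b" "\<And>k. k < n \<Longrightarrow> \<pi> k \<in> Hom C b (s k)"
    and sum: "(\<Oplus>\<^bsub>Hom_vs C b b\<^esub>k\<in>{..<n}. Comp C b (s k) b (\<iota> k) (\<pi> k)) = Idt C b"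
    using b unfolding is_biproduct_def by blast
  note [simp] = x f(1) Comp_Hom
  interpret A: abelian_group "Hom_vs C x b" by (rule Hom_abelian_group) auto
  have "\<exists>k<n. Comp C x b (s k) (\<pi> k) f \<noteq> \<zero>\<^bsub>Hom_vs C x (s k)\<^esub>"
  proof (rule ccontr)
    assume "\<not> ?thesis"
    then have 0: "Comp C x b (s k) (\<pi> k) f = \<zero>\<^bsub>Hom_vs C x (s k)\<^esub>" if "k < n" for k
      using that by blast
    have "f = Comp C x b b (\<Oplus>\<^bsub>Hom_vs C b b\<^esub>k\<in>{..<n}. Comp C b (s k) b (\<iota> k) (\<pi> k)) f"
      by (simp add: sum Comp_Idt_left)
    also have "\<dots> = (\<Oplus>\<^bsub>Hom_vs C x b\<^esub>k\<in>{..<n}. Comp C x b b (Comp C b (s k) b (\<iota> k) (\<pi> k)) f)"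
      by (rule Comp_left(4)) auto
    also have "\<dots> = (\<Oplus>\<^bsub>Hom_vs C x b\<^esub>k\<in>{..<n}. \<zero>\<^bsub>Hom_vs C x b\<^esub>)"
      by (rule Hom_finsum_cong) (auto simp: Comp_assoc 0 Comp_right Hom_closed)
    finally show False using f(2) by simp
  qed
  then show thesis using that by (metis Comp_Hom \<open>b \<in> Ob C\<close> \<open>\<And>k. k < n \<Longrightarrow> \<pi> k \<in> Hom C b (s k)\<close>
    \<open>\<And>k. k < n \<Longrightarrow> s k \<in> Ob C\<close> f(1) x)
qed

text \<open>A simple object with a nonzero map to a member g of G has a nonzero map to some simple
  summand of g and is isomorphic to it. Hence the summands in chosen decompositions of the members
  of G represent all simple objects.\<close>

theorem KV_2_vector_spaceI:
  assumes G: "finite G" "G \<subseteq> Ob C"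
    and cogen: "\<And>x. x \<in> Ob C \<Longrightarrow> Idt C x \<noteq> \<zero>\<^bsub>Hom_vs C x x\<^esub> \<Longrightarrow>
      \<exists>g\<in>G. \<exists>f\<in>Hom C x g. f \<noteq> \<zero>\<^bsub>Hom_vs C x g\<^esub>"
  shows "KV_2_vector_space C"
proof
  have "\<exists>p. (\<forall>i<fst p. simple_object C (snd p i)) \<and> is_biproduct C (fst p) (snd p) g" if "g \<in> G" for g
    using ex_simple_decomposition[of g] that G by auto
  then obtain p where p: "\<And>g i. g \<in> G \<Longrightarrow> i < fst (p g) \<Longrightarrow> simple_object C (snd (p g) i)"
    "\<And>g. g \<in> G \<Longrightarrow> is_biproduct C (fst (p g)) (snd (p g)) g"
    by metis
  define S where "S = (\<Union>g\<in>G. snd (p g) ` {..<fst (p g)})"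
  have "\<exists>s\<in>S. isomorphic C x s" if x: "simple_object C x" for x
  proof -
    obtain g f where g: "g \<in> G" and f: "f \<in> Hom C x g" "f \<noteq> \<zero>\<^bsub>Hom_vs C x g\<^esub>"
      using cogen simple_objectD(1,2)[OF x] by blast
    obtain i h where "i < fst (p g)" "h \<in> Hom C x (snd (p g) i)" "h \<noteq> \<zero>\<^bsub>Hom_vs C x (snd (p g) i)\<^esub>"
      by (rule nonzero_projection[OF p(2)[OF g] simple_objectD(1)[OF x] f])
    then show ?thesis
      using simple_isomorphic[OF x p(1)[OF g]] g by (auto simp: S_def)
  qed
  moreover have "finite S" "\<forall>s\<in>S. simple_object C s" using G p(1) by (auto simp: S_def)
  ultimately show "\<exists>S. finite S \<and> (\<forall>s\<in>S. simple_object C s) \<and>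
      (\<forall>x. simple_object C x \<longrightarrow> (\<exists>s\<in>S. isomorphic C x s))"
    by blast
qed (rule ex_simple_decomposition)

end

text \<open>The power of c by a finite set H, read off from an n-fold biproduct through an
  enumeration of H. The universal property is one closed formula so that
  \<open>ex_coinduced_functor\<close> can choose such powers for all objects at once.\<close>

lemma (in regular_linear_category) ex_power:
  assumes c: "c \<in> Ob C" and H: "finite H"
  shows "\<exists>b \<pi>. b \<in> Ob C \<and> (\<forall>h\<in>H. \<pi> h \<in> Hom C b c) \<and>
    (\<forall>w\<in>Ob C. \<forall>u. (\<forall>h\<in>H. u h \<in> Hom C w c) \<longrightarrow> (\<exists>v\<in>Hom C w b. \<forall>h\<in>H. Comp C w b c (\<pi> h) v = u h)) \<and>
    (\<forall>w\<in>Ob C. \<forall>u\<in>Hom C w b. \<forall>v\<in>Hom C w b.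
      (\<forall>h\<in>H. Comp C w b c (\<pi> h) u = Comp C w b c (\<pi> h) v) \<longrightarrow> u = v)"
proof -
  define n where "n = card H"
  obtain e where e: "bij_betw e H {..<n}"
    using ex_bij_betw_finite_nat[OF H] by (auto simp: atLeast0LessThan n_def)
  define e' where "e' = inv_into H e"
  have e1: "e h < n" if "h \<in> H" for h using e that by (auto simp: bij_betw_def)
  have e2: "e' k \<in> H" "e (e' k) = k" if "k < n" for k
    using e that unfolding e'_def bij_betw_def by (metis inv_into_into f_inv_into_f lessThan_iff)+
  have e3: "e' (e h) = h" if "h \<in> H" for h
    using e that by (simp add: e'_def bij_betw_def)
  obtain b where b: "is_biproduct C n (\<lambda>_. c) b" using ex_biproduct[of n "\<lambda>_. c"] c by blast
  then have "b \<in> Ob C" by (simp add: is_biproduct_def)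
  obtain \<pi> where \<pi>: "\<And>k. k < n \<Longrightarrow> \<pi> k \<in> Hom C b c"
    and ex: "\<And>w u. w \<in> Ob C \<Longrightarrow> (\<And>k. k < n \<Longrightarrow> u k \<in> Hom C w c) \<Longrightarrow>
      \<exists>v\<in>Hom C w b. \<forall>k<n. Comp C w b c (\<pi> k) v = u k"
    and unique: "\<And>w u v. w \<in> Ob C \<Longrightarrow> u \<in> Hom C w b \<Longrightarrow> v \<in> Hom C w b \<Longrightarrow>
      (\<And>k. k < n \<Longrightarrow> Comp C w b c (\<pi> k) u = Comp C w b c (\<pi> k) v) \<Longrightarrow> u = v"
    by (rule biproduct_lift[OF b]) blast
  show ?thesis
  proof (intro exI[of _ b] exI[of _ "\<lambda>h. \<pi> (e h)"] conjI ballI allI impI)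
    show "\<pi> (e h) \<in> Hom C b c" if "h \<in> H" for h using that e1 \<pi> by blast
    show "\<exists>v\<in>Hom C w b. \<forall>h\<in>H. Comp C w b c (\<pi> (e h)) v = u h"
      if w: "w \<in> Ob C" and u: "\<forall>h\<in>H. u h \<in> Hom C w c" for w u
    proof -
      obtain v where "v \<in> Hom C w b" "\<forall>k<n. Comp C w b c (\<pi> k) v = u (e' k)"
        using ex[of w "\<lambda>k. u (e' k)"] w u e2 by blast
      then show ?thesis using e1 e3 by (intro bexI[of _ v]) auto
    qed
    show "u = v" if "w \<in> Ob C" "u \<in> Hom C w b" "v \<in> Hom C w b"
      "\<forall>h\<in>H. Comp C w b c (\<pi> (e h)) u = Comp C w b c (\<pi> (e h)) v" for w u v
      using that(4) e2 by (intro unique[OF that(1-3)]) metis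
  qed fact
qed

section \<open>The category of vector spaces\<close>

lemma Vect_simps:
  "Ob Vect = {V. fd_vs V}"
  "Hom Vect V W = linear_maps V W \<inter> extensional (carrier V)"
  "Idt Vect V = (\<lambda>v\<in>carrier V. v)"
  "Comp Vect U V W g f = compose (carrier U) g f"
  "carrier (Hom_vs Vect V W) = Hom Vect V W"
  "\<zero>\<^bsub>Hom_vs Vect V W\<^esub> = (\<lambda>v\<in>carrier V. \<zero>\<^bsub>W\<^esub>)"
  "f \<oplus>\<^bsub>Hom_vs Vect V W\<^esub> g = (\<lambda>v\<in>carrier V. f v \<oplus>\<^bsub>W\<^esub> g v)"
  "c \<odot>\<^bsub>Hom_vs Vect V W\<^esub> f = (\<lambda>v\<in>carrier V. c \<odot>\<^bsub>W\<^esub> f v)"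
  by (simp_all add: Vect_def Let_def)

lemma Vect_HomD:
  assumes "f \<in> Hom Vect V W"
  shows "v \<in> carrier V \<Longrightarrow> f v \<in> carrier W"
    and "v \<in> carrier V \<Longrightarrow> w \<in> carrier V \<Longrightarrow> f (v \<oplus>\<^bsub>V\<^esub> w) = f v \<oplus>\<^bsub>W\<^esub> f w"
    and "v \<in> carrier V \<Longrightarrow> f (c \<odot>\<^bsub>V\<^esub> v) = c \<odot>\<^bsub>W\<^esub> f v"
    and "f \<in> extensional (carrier V)"
  using assms linear_mapsD[of f V W] by (auto simp: Vect_simps)

lemma Vect_Hom_restrictI:
  assumes V: "complex_vectorspace V"
    and "\<And>v. v \<in> carrier V \<Longrightarrow> f v \<in> carrier W"
    and "\<And>v w. v \<in> carrier V \<Longrightarrow> w \<in> carrier V \<Longrightarrow> f (v \<oplus>\<^bsub>V\<^esub> w) = f v \<oplus>\<^bsub>W\<^esub> f w"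
    and "\<And>c v. v \<in> carrier V \<Longrightarrow> f (c \<odot>\<^bsub>V\<^esub> v) = c \<odot>\<^bsub>W\<^esub> f v"
  shows "(\<lambda>v\<in>carrier V. f v) \<in> Hom Vect V W"
proof -
  interpret V: vectorspace class_ring V by fact
  show ?thesis
    using assms by (auto simp: Vect_simps complex_vectorspace_smult[OF V] intro!: linear_mapsI)
qed

lemma complex_vectorspace_Vect_Hom:
  assumes V: "complex_vectorspace V" and W: "complex_vectorspace W"
  shows "complex_vectorspace (Hom_vs Vect V W)"
proof -
  interpret V: vectorspace class_ring V by fact
  interpret W: vectorspace class_ring W by fact
  have smult_add: "a \<odot>\<^bsub>W\<^esub> (v \<oplus>\<^bsub>W\<^esub> w) = a \<odot>\<^bsub>W\<^esub> v \<oplus>\<^bsub>W\<^esub> a \<odot>\<^bsub>W\<^esub> w"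
    if "v \<in> carrier W" "w \<in> carrier W" for a v w
    using W.smult_r_distr[of a v w] that by simp
  have swap: "(u \<oplus>\<^bsub>W\<^esub> v) \<oplus>\<^bsub>W\<^esub> (w \<oplus>\<^bsub>W\<^esub> x) = (u \<oplus>\<^bsub>W\<^esub> w) \<oplus>\<^bsub>W\<^esub> (v \<oplus>\<^bsub>W\<^esub> x)"
    if "u \<in> carrier W" "v \<in> carrier W" "w \<in> carrier W" "x \<in> carrier W" for u v w x
    using that by (simp add: W.a_ac)
  have smult_smult: "a \<odot>\<^bsub>W\<^esub> (b \<odot>\<^bsub>W\<^esub> w) = b \<odot>\<^bsub>W\<^esub> (a \<odot>\<^bsub>W\<^esub> w)" if "w \<in> carrier W" for a b w
    using complex_vectorspace_smult(4)[OF W that, of a b] complex_vectorspace_smult(4)[OF W that, of b a]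
    by (simp add: mult.commute)
  note simps [simp] = complex_vectorspace_smult(1-3)[OF W] Vect_HomD Vect_simps(5-8)
  show ?thesis
  proof (rule complex_vectorspaceI)
    show "\<zero>\<^bsub>Hom_vs Vect V W\<^esub> \<in> carrier (Hom_vs Vect V W)"
      unfolding Vect_simps(5,6) using V W.smult_r_null
      by (intro Vect_Hom_restrictI) auto
  next
    fix f g assume *: "f \<in> carrier (Hom_vs Vect V W)" "g \<in> carrier (Hom_vs Vect V W)"
    then show "f \<oplus>\<^bsub>Hom_vs Vect V W\<^esub> g \<in> carrier (Hom_vs Vect V W)"
      unfolding Vect_simps(5,7) using V
      by (intro Vect_Hom_restrictI) (auto simp: swap smult_add)
  next
    fix f c assume *: "f \<in> carrier (Hom_vs Vect V W)"
    then show "c \<odot>\<^bsub>Hom_vs Vect V W\<^esub> f \<in> carrier (Hom_vs Vect V W)"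
      unfolding Vect_simps(5,8) using V
      by (intro Vect_Hom_restrictI) (auto simp: smult_add smult_smult)
  next
    fix f assume "f \<in> carrier (Hom_vs Vect V W)"
    then have f: "f \<in> Hom Vect V W" by simp
    then show "f \<oplus>\<^bsub>Hom_vs Vect V W\<^esub> \<zero>\<^bsub>Hom_vs Vect V W\<^esub> = f"
      and "1 \<odot>\<^bsub>Hom_vs Vect V W\<^esub> f = f"
      using Vect_HomD(4)[OF f] by (auto simp: restrict_def extensional_def fun_eq_iff)
  qed (auto intro!: restrict_ext simp: W.a_ac smult_add complex_vectorspace_smult(4,5)[OF W])
qed

text \<open>A linear map is determined by its values on a basis of V, so the evaluations at the
  basis vectors have trivial common kernel.\<close>

lemma fd_vs_Vect_Hom:
  assumes V: "fd_vs V" and W: "fd_vs W"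
  shows "fd_vs (Hom_vs Vect V W)"
proof -
  note VV = fd_vsD(1)[OF V] and WW = fd_vsD(1)[OF W]
  interpret W: vectorspace class_ring W by (rule WW)
  obtain n e l where l: "dual_bases V n e l" by (rule fd_vs_dual_bases[OF V])
  then have e: "e i \<in> carrier V" if "i < n" for i using that by (simp add: dual_bases_def)
  show ?thesis
  proof (rule fd_vs_of_linear_maps[of _ "{..<n}" "\<lambda>_. W" "\<lambda>i f. f (e i)"])
    show "complex_vectorspace (Hom_vs Vect V W)" by (rule complex_vectorspace_Vect_Hom[OF VV WW])
    show "(\<lambda>f. f (e i)) \<in> linear_maps (Hom_vs Vect V W) W" if "i \<in> {..<n}" for i
      using that e by (intro linear_mapsI) (auto simp: Vect_simps(5-8) Vect_HomD)
    fix f assume "f \<in> carrier (Hom_vs Vect V W)" and 0: "\<And>i. i \<in> {..<n} \<Longrightarrow> f (e i) = \<zero>\<^bsub>W\<^esub>"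
    then have f: "f \<in> Hom Vect V W" by (simp add: Vect_simps(5))
    then have lin: "f \<in> linear_maps V W" by (simp add: Vect_simps)
    have "f v = \<zero>\<^bsub>W\<^esub>" if v: "v \<in> carrier V" for v
    proof -
      have "f v = f (\<Oplus>\<^bsub>V\<^esub>i\<in>{..<n}. l i v \<odot>\<^bsub>V\<^esub> e i)"
        using l v by (simp add: dual_bases_def)
      also have "\<dots> = (\<Oplus>\<^bsub>W\<^esub>i\<in>{..<n}. f (l i v \<odot>\<^bsub>V\<^esub> e i))"
        using e complex_vectorspace_smult(1)[OF VV] by (intro linear_maps_finsum[OF VV WW lin]) auto
      also have "\<dots> = (\<Oplus>\<^bsub>W\<^esub>i\<in>{..<n}. \<zero>\<^bsub>W\<^esub>)"
        using 0 e f W.smult_r_null by (intro W.finsum_cong') (auto simp: Vect_HomD)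
      finally show ?thesis by simp
    qed
    then show "f = \<zero>\<^bsub>Hom_vs Vect V W\<^esub>"
      using Vect_HomD(4)[OF f] by (auto simp: Vect_simps(6) restrict_def extensional_def fun_eq_iff)
  qed (use W in auto)
qed

lemma Vect_Comp_Hom:
  assumes "U \<in> Ob Vect" and "f \<in> Hom Vect U V" "g \<in> Hom Vect V W"
  shows "Comp Vect U V W g f \<in> Hom Vect U W"
  unfolding Vect_simps(4) compose_def using assms
  by (intro Vect_Hom_restrictI) (auto simp: Vect_HomD Vect_simps(1) fd_vsD)

lemma linear_category_Vect: "linear_category Vect"
proof
  fix U :: "(complex, 'v) module" assume "U \<in> Ob Vect"
  then show "Idt Vect U \<in> Hom Vect U U"
    unfolding Vect_simps(3) by (intro Vect_Hom_restrictI) (auto simp: Vect_simps fd_vsD)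
next
  fix U V W :: "(complex, 'v) module" and f g
  assume *: "U \<in> Ob Vect" "V \<in> Ob Vect" "W \<in> Ob Vect" and f: "f \<in> Hom Vect U V" and g: "g \<in> Hom Vect V W"
  show "Comp Vect U V W g f \<in> Hom Vect U W"
    by (rule Vect_Comp_Hom[OF *(1) f g])
next
  fix U V :: "(complex, 'v) module" and f
  assume f: "f \<in> Hom Vect U V"
  then show "Comp Vect U U V f (Idt Vect U) = f" "Comp Vect U V V (Idt Vect V) f = f"
    using Vect_HomD(1,4)[OF f]
    by (auto simp: Vect_simps(3,4) compose_def restrict_def extensional_def fun_eq_iff)
next
  fix T U V W :: "(complex, 'v) module" and f g h
  assume "f \<in> Hom Vect T U"
  then show "Comp Vect T U W (Comp Vect U V W h g) f = Comp Vect T V W h (Comp Vect T U V g f)"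
    by (auto simp: Vect_simps(4) compose_def Vect_HomD intro!: restrict_ext)
next
  fix V W :: "(complex, 'v) module" assume "V \<in> Ob Vect" "W \<in> Ob Vect"
  then show "carrier (Hom_vs Vect V W) = Hom Vect V W" "fd_vs (Hom_vs Vect V W)"
    by (simp_all add: Vect_simps(1,5) fd_vs_Vect_Hom)
next
  fix U V W :: "(complex, 'v) module" and g
  assume "U \<in> Ob Vect" "V \<in> Ob Vect" "W \<in> Ob Vect" and g: "g \<in> Hom Vect V W"
  then show "(\<lambda>f. Comp Vect U V W g f) \<in> linear_maps (Hom_vs Vect U V) (Hom_vs Vect U W)"
    using Vect_Comp_Hom
    by (intro linear_mapsI) (auto simp: Vect_simps(4-8) compose_def Vect_HomD intro!: restrict_ext)
next
  fix U V W :: "(complex, 'v) module" and f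
  assume "U \<in> Ob Vect" "V \<in> Ob Vect" "W \<in> Ob Vect" and f: "f \<in> Hom Vect U V"
  then show "(\<lambda>g. Comp Vect U V W g f) \<in> linear_maps (Hom_vs Vect V W) (Hom_vs Vect U W)"
    using Vect_Comp_Hom
    by (intro linear_mapsI) (auto simp: Vect_simps(4-8) compose_def Vect_HomD intro!: restrict_ext)
qed

section \<open>Null object, biproducts, splittings and quasi-inverses in Vect\<close>

lemma ex_Vect_null_object:
  "\<exists>Z :: (complex, 'v) module \<in> Ob Vect. Idt Vect Z = \<zero>\<^bsub>Hom_vs Vect Z Z\<^esub>"
proof -
  \<comment> \<open>The type is only known to be inhabited; \<open>undefined\<close> names the
    single point of the zero space.\<close>
  define Z :: "(complex, 'v) module" where
    "Z = mk_vs {undefined} undefined (\<lambda>_ _. undefined) (\<lambda>_ _. undefined)"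
  have [simp]: "carrier Z = {undefined}" "\<zero>\<^bsub>Z\<^esub> = undefined" "x \<oplus>\<^bsub>Z\<^esub> y = undefined" "c \<odot>\<^bsub>Z\<^esub> x = undefined"
    for x y c by (simp_all add: Z_def)
  have "fd_vs Z"
    by (rule fd_vs_of_functionals[of _ "{}"]) (auto intro!: complex_vectorspaceI)
  moreover have "Idt Vect Z = \<zero>\<^bsub>Hom_vs Vect Z Z\<^esub>"
    by (auto simp: Vect_simps intro!: restrict_ext)
  ultimately show ?thesis by (auto simp: Vect_simps(1))
qed

text \<open>If v is nonzero, distinct scalars give distinct multiples of v, and there are infinitely
  many scalars. This settles the case of a finite type in \<open>ex_pairing\<close>.\<close>

lemma complex_vectorspace_finite_carrier:
  assumes V: "complex_vectorspace V" and fin: "finite (carrier V)"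
  shows "carrier V = {\<zero>\<^bsub>V\<^esub>}"
proof -
  interpret V: vectorspace class_ring V by fact
  have "v = \<zero>\<^bsub>V\<^esub>" if v: "v \<in> carrier V" for v
  proof (rule ccontr)
    assume "v \<noteq> \<zero>\<^bsub>V\<^esub>"
    have "inj (\<lambda>c. c \<odot>\<^bsub>V\<^esub> v)"
    proof (rule injI, rule ccontr)
      fix a b assume eq: "a \<odot>\<^bsub>V\<^esub> v = b \<odot>\<^bsub>V\<^esub> v" and "a \<noteq> b"
      have "(a - b) \<odot>\<^bsub>V\<^esub> v = \<zero>\<^bsub>V\<^esub>"
        using complex_vectorspace_smult(5)[OF V v, of a "- b"] complex_vectorspace_smult(5)[OF V v, of b "- b"]
          complex_vectorspace_smult(2)[OF V v] eq by simp
      moreover have "inverse (a - b) \<odot>\<^bsub>V\<^esub> ((a - b) \<odot>\<^bsub>V\<^esub> v) = v"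
        using complex_vectorspace_smult(4)[OF V v, of "inverse (a - b)" "a - b"]
          complex_vectorspace_smult(3)[OF V v] \<open>a \<noteq> b\<close> by simp
      ultimately show False using V.smult_r_null \<open>v \<noteq> \<zero>\<^bsub>V\<^esub>\<close> by simp
    qed
    moreover have "range (\<lambda>c. c \<odot>\<^bsub>V\<^esub> v) \<subseteq> carrier V"
      using complex_vectorspace_smult(1)[OF V v] by auto
    ultimately have "finite (UNIV :: complex set)"
      using fin by (meson finite_imageD finite_subset)
    then show False using infinite_UNIV_char_0 by blast
  qed
  then show ?thesis by auto
qed

text \<open>For a finite type the only spaces are zero; for an infinite type
  \<open>'v \<times> 'v\<close> is equipotent to \<open>'v\<close>.\<close>

lemma ex_pairing:
  fixes V W :: "(complex, 'v) module"
  assumes V: "complex_vectorspace V" and W: "complex_vectorspace W"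
  obtains J :: "'v \<times> 'v \<Rightarrow> 'v" where "inj_on J (carrier V \<times> carrier W)"
proof (cases "finite (UNIV :: 'v set)")
  case True
  then have "carrier V = {\<zero>\<^bsub>V\<^esub>}"
    using complex_vectorspace_finite_carrier[OF V] finite_subset[OF subset_UNIV] by blast
  then have "inj_on snd (carrier V \<times> carrier W)" by (auto simp: inj_on_def)
  then show thesis by (rule that)
next
  case False
  then have "ordIso2 (card_of ((UNIV :: 'v set) \<times> (UNIV :: 'v set))) (card_of (UNIV :: 'v set))"
    by (rule card_of_Times_same_infinite)
  then obtain J where "bij_betw J ((UNIV :: 'v set) \<times> (UNIV :: 'v set)) (UNIV :: 'v set)"
    using card_of_ordIso by blast
  then have "inj_on J (carrier V \<times> carrier W)"
    by (auto simp: bij_betw_def intro: inj_on_subset)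
  then show thesis by (rule that)
qed

text \<open>The product of the carriers lies in \<open>'v \<times> 'v\<close>, while objects of
  \<open>Vect\<close> have carriers in \<open>'v\<close>; so the direct sum is carried by the image
  of an injection \<open>J\<close>, and \<open>K\<close> decodes it. Finite dimension comes from the
  two projections, whose common kernel is trivial.\<close>

lemma ex_Vect_binary_biproduct:
  fixes V W :: "(complex, 'v) module"
  assumes V: "V \<in> Ob Vect" and W: "W \<in> Ob Vect"
  shows "\<exists>B i p j q. binary_biproduct Vect V W B i p j q"
proof -
  have fd: "fd_vs V" "fd_vs W" using V W by (simp_all add: Vect_simps)
  note VV = fd_vsD(1)[OF fd(1)] and WW = fd_vsD(1)[OF fd(2)]
  interpret V: vectorspace class_ring V by (rule VV)
  interpret W: vectorspace class_ring W by (rule WW)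
  obtain J :: "'v \<times> 'v \<Rightarrow> 'v" where J: "inj_on J (carrier V \<times> carrier W)" by (rule ex_pairing[OF VV WW])
  define P where "P = carrier V \<times> carrier W"
  define K where "K = inv_into P J"
  have KJ [simp]: "K (J (v, w)) = (v, w)" if "v \<in> carrier V" "w \<in> carrier W" for v w
    using J that by (simp add: K_def P_def)
  define B where "B = mk_vs (J ` P) (J (\<zero>\<^bsub>V\<^esub>, \<zero>\<^bsub>W\<^esub>))
    (\<lambda>a b. J (fst (K a) \<oplus>\<^bsub>V\<^esub> fst (K b), snd (K a) \<oplus>\<^bsub>W\<^esub> snd (K b)))
    (\<lambda>c a. J (c \<odot>\<^bsub>V\<^esub> fst (K a), c \<odot>\<^bsub>W\<^esub> snd (K a)))"
  have B [simp]: "carrier B = J ` P" "\<zero>\<^bsub>B\<^esub> = J (\<zero>\<^bsub>V\<^esub>, \<zero>\<^bsub>W\<^esub>)"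
    "\<And>v w v' w'. \<lbrakk>v \<in> carrier V; w \<in> carrier W; v' \<in> carrier V; w' \<in> carrier W\<rbrakk> \<Longrightarrow>
      J (v, w) \<oplus>\<^bsub>B\<^esub> J (v', w') = J (v \<oplus>\<^bsub>V\<^esub> v', w \<oplus>\<^bsub>W\<^esub> w')"
    "\<And>c v w. \<lbrakk>v \<in> carrier V; w \<in> carrier W\<rbrakk> \<Longrightarrow> c \<odot>\<^bsub>B\<^esub> J (v, w) = J (c \<odot>\<^bsub>V\<^esub> v, c \<odot>\<^bsub>W\<^esub> w)"
    by (simp_all add: B_def)
  note [simp] = complex_vectorspace_smult(1-3)[OF VV] complex_vectorspace_smult(1-3)[OF WW]
  have smult_add: "a \<odot>\<^bsub>V\<^esub> (v \<oplus>\<^bsub>V\<^esub> v') = a \<odot>\<^bsub>V\<^esub> v \<oplus>\<^bsub>V\<^esub> a \<odot>\<^bsub>V\<^esub> v'"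
    "a \<odot>\<^bsub>W\<^esub> (w \<oplus>\<^bsub>W\<^esub> w') = a \<odot>\<^bsub>W\<^esub> w \<oplus>\<^bsub>W\<^esub> a \<odot>\<^bsub>W\<^esub> w'"
    if "v \<in> carrier V" "v' \<in> carrier V" "w \<in> carrier W" "w' \<in> carrier W" for a v v' w w'
    using that V.smult_r_distr[of a v v'] W.smult_r_distr[of a w w'] by simp_all
  have smult_zero [simp]: "a \<odot>\<^bsub>V\<^esub> \<zero>\<^bsub>V\<^esub> = \<zero>\<^bsub>V\<^esub>" "a \<odot>\<^bsub>W\<^esub> \<zero>\<^bsub>W\<^esub> = \<zero>\<^bsub>W\<^esub>" for a
    using V.smult_r_null[of a] W.smult_r_null[of a] by simp_all
  have BB: "complex_vectorspace B"
    by (rule complex_vectorspaceI)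
      (auto simp: P_def V.a_ac W.a_ac smult_add
        complex_vectorspace_smult(4,5)[OF VV] complex_vectorspace_smult(4,5)[OF WW])
  have P1: "(\<lambda>a. fst (K a)) \<in> linear_maps B V" and P2: "(\<lambda>a. snd (K a)) \<in> linear_maps B W"
    by (auto intro!: linear_mapsI simp: P_def)
  have "fd_vs B"
  proof (rule fd_vs_of_linear_maps[of B "UNIV :: bool set" "\<lambda>b. if b then V else W"
        "\<lambda>b. if b then \<lambda>a. fst (K a) else (\<lambda>a. snd (K a))"])
    fix a assume "a \<in> carrier B" and 0: "\<And>b. b \<in> UNIV \<Longrightarrow>
      (if b then \<lambda>a. fst (K a) else (\<lambda>a. snd (K a))) a = \<zero>\<^bsub>if b then V else W\<^esub>"
    then show "a = \<zero>\<^bsub>B\<^esub>" using 0[of True] 0[of False] by (auto simp: P_def)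
  qed (use BB fd P1 P2 in auto)
  define i where "i = (\<lambda>v\<in>carrier V. J (v, \<zero>\<^bsub>W\<^esub>))"
  define j where "j = (\<lambda>w\<in>carrier W. J (\<zero>\<^bsub>V\<^esub>, w))"
  define p where "p = (\<lambda>a\<in>carrier B. fst (K a))"
  define q where "q = (\<lambda>a\<in>carrier B. snd (K a))"
  have "i \<in> Hom Vect V B"
    unfolding i_def by (rule Vect_Hom_restrictI[OF VV]) (auto simp: P_def)
  moreover have "j \<in> Hom Vect W B"
    unfolding j_def by (rule Vect_Hom_restrictI[OF WW]) (auto simp: P_def)
  moreover have "p \<in> Hom Vect B V"
    unfolding p_def by (rule Vect_Hom_restrictI[OF BB]) (use linear_mapsD[OF P1] in auto)
  moreover have "q \<in> Hom Vect B W"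
    unfolding q_def by (rule Vect_Hom_restrictI[OF BB]) (use linear_mapsD[OF P2] in auto)
  ultimately have "binary_biproduct Vect V W B i p j q"
    using \<open>fd_vs B\<close> fd
    by (auto simp: binary_biproduct_def retract_def Vect_simps(1,3,4,7) compose_def
        i_def j_def p_def q_def P_def intro!: restrict_ext)
  then show ?thesis by blast
qed

text \<open>The splitting object is the image of e; the inclusion is i, and e itself, seen as a map
  onto its image, is p.\<close>

lemma Vect_idempotent_split:
  assumes V: "V \<in> Ob Vect" and e: "e \<in> Hom Vect V V" "Comp Vect V V V e e = e"
  shows "\<exists>Y i p. retract Vect V Y i p \<and> Comp Vect V Y V i p = e"
proof -
  have fd: "fd_vs V" using V by (simp add: Vect_simps)
  note VV = fd_vsD(1)[OF fd]
  interpret V: vectorspace class_ring V by (rule VV)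
  note eD = Vect_HomD[OF e(1)]
  have ee [simp]: "e (e v) = e v" if "v \<in> carrier V" for v
    using fun_cong[OF e(2), of v] that by (simp add: Vect_simps compose_def)
  define Y where "Y = V\<lparr>carrier := e ` carrier V\<rparr>"
  have [simp]: "carrier Y = e ` carrier V" "\<zero>\<^bsub>Y\<^esub> = \<zero>\<^bsub>V\<^esub>" "x \<oplus>\<^bsub>Y\<^esub> y = x \<oplus>\<^bsub>V\<^esub> y" "c \<odot>\<^bsub>Y\<^esub> x = c \<odot>\<^bsub>V\<^esub> x"
    for x y c by (simp_all add: Y_def)
  have smult_add: "a \<odot>\<^bsub>V\<^esub> (v \<oplus>\<^bsub>V\<^esub> w) = a \<odot>\<^bsub>V\<^esub> v \<oplus>\<^bsub>V\<^esub> a \<odot>\<^bsub>V\<^esub> w"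
    if "v \<in> carrier V" "w \<in> carrier V" for a v w
    using V.smult_r_distr[of a v w] that by simp
  have e0: "e \<zero>\<^bsub>V\<^esub> = \<zero>\<^bsub>V\<^esub>"
    using e(1) by (intro linear_maps_zero[OF VV VV]) (simp add: Vect_simps)
  note [simp] = complex_vectorspace_smult(1-3)[OF VV] eD(1)
  have YY: "complex_vectorspace Y"
  proof (rule complex_vectorspaceI)
    show "\<zero>\<^bsub>Y\<^esub> \<in> carrier Y" using e0 by (auto intro: image_eqI[of _ _ "\<zero>\<^bsub>V\<^esub>"])
    show "v \<oplus>\<^bsub>Y\<^esub> w \<in> carrier Y" if "v \<in> carrier Y" "w \<in> carrier Y" for v w
      using that by (auto simp flip: eD(2))
    show "c \<odot>\<^bsub>Y\<^esub> v \<in> carrier Y" if "v \<in> carrier Y" for c v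
      using that by (auto simp flip: eD(3))
  qed (auto simp: V.a_ac smult_add complex_vectorspace_smult(4,5)[OF VV])
  have "(\<lambda>y. y) \<in> linear_maps Y V" by (rule linear_mapsI) auto
  then have "fd_vs Y"
    by (rule fd_vs_inj(1)[OF YY VV fd_vsD(2)[OF fd]]) (simp add: inj_on_def)
  define i where "i = (\<lambda>y\<in>carrier Y. y)"
  have "i \<in> Hom Vect Y V"
    unfolding i_def by (rule Vect_Hom_restrictI[OF YY]) auto
  moreover have "e \<in> Hom Vect V Y"
    using eD by (auto simp: Vect_simps intro!: linear_mapsI)
  moreover have "Comp Vect V Y V i e = e"
    using eD(4) by (auto simp: Vect_simps compose_def i_def fun_eq_iff extensional_def)
  ultimately have "retract Vect V Y i e \<and> Comp Vect V Y V i e = e"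
    using fd \<open>fd_vs Y\<close>
    by (auto simp: retract_def Vect_simps(1,3,4) compose_def i_def intro!: restrict_ext)
  then show ?thesis by blast
qed

lemma Vect_quasi_inverse:
  assumes "V \<in> Ob Vect" "W \<in> Ob Vect" and f: "f \<in> Hom Vect V W"
  shows "\<exists>g\<in>Hom Vect W V. Comp Vect V V W f (Comp Vect V W V g f) = f"
proof -
  have fd: "fd_vs V" "fd_vs W" "f \<in> linear_maps V W" using assms by (auto simp: Vect_simps)
  obtain g where g: "g \<in> linear_maps W V" "\<And>v. v \<in> carrier V \<Longrightarrow> f (g (f v)) = f v"
    by (rule linear_map_quasi_inverse[OF fd]) blast
  show ?thesis
  proof (rule bexI)
    show "(\<lambda>w\<in>carrier W. g w) \<in> Hom Vect W V"
      using linear_mapsD[OF g(1)] by (intro Vect_Hom_restrictI[OF fd_vsD(1)[OF fd(2)]]) auto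
    show "Comp Vect V V W f (Comp Vect V W V (\<lambda>w\<in>carrier W. g w) f) = f"
      using g(2) Vect_HomD(1,4)[OF f]
      by (auto simp: Vect_simps(4) compose_def fun_eq_iff extensional_def)
  qed
qed

lemma regular_linear_category_Vect: "regular_linear_category Vect"
  by (intro regular_linear_category.intro regular_linear_category_axioms.intro linear_category_Vect
      ex_Vect_null_object ex_Vect_binary_biproduct Vect_idempotent_split Vect_quasi_inverse)

text \<open>The complex line need not fit in \<open>'v\<close>, so any nonzero space W takes its
  place: a functional l with l v nonzero gives the nonzero map x |-> (l x) w for a fixed nonzero w
  in W. If all spaces on \<open>'v\<close> are zero, the implication is vacuous and any object will
  do.\<close>

lemma ex_Vect_cogenerator:
  "\<exists>W :: (complex, 'v) module \<in> Ob Vect. \<forall>V\<in>Ob Vect. Idt Vect V \<noteq> \<zero>\<^bsub>Hom_vs Vect V V\<^esub> \<longrightarrow>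
     (\<exists>f\<in>Hom Vect V W. f \<noteq> \<zero>\<^bsub>Hom_vs Vect V W\<^esub>)"
proof (cases "\<exists>W\<in>Ob Vect :: (complex, 'v) module set. \<exists>w\<in>carrier W. w \<noteq> \<zero>\<^bsub>W\<^esub>")
  case True
  then obtain W :: "(complex, 'v) module" and w where
    W: "fd_vs W" and w: "w \<in> carrier W" "w \<noteq> \<zero>\<^bsub>W\<^esub>" by (auto simp: Vect_simps)
  have "\<exists>f\<in>Hom Vect V W. f \<noteq> \<zero>\<^bsub>Hom_vs Vect V W\<^esub>"
    if V: "V \<in> Ob Vect" "Idt Vect V \<noteq> \<zero>\<^bsub>Hom_vs Vect V V\<^esub>" for V
  proof -
    have fd: "fd_vs V" using V by (simp add: Vect_simps)
    note VV = fd_vsD(1)[OF fd] and WW = fd_vsD(1)[OF W]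
    obtain v where v: "v \<in> carrier V" "v \<noteq> \<zero>\<^bsub>V\<^esub>"
      using V by (force simp: Vect_simps intro: restrict_ext)
    obtain l where l: "l \<in> linear_maps V complex_vs" "l v \<noteq> 0"
      by (rule ex_nonzero_functional[OF fd v])
    note lD = linear_mapsD[OF l(1)] and smult = complex_vectorspace_smult[OF WW w(1)]
    define f where "f = (\<lambda>x\<in>carrier V. l x \<odot>\<^bsub>W\<^esub> w)"
    have "f \<in> Hom Vect V W"
      unfolding f_def using lD smult by (intro Vect_Hom_restrictI[OF VV]) auto
    moreover have "f v \<noteq> \<zero>\<^bsub>W\<^esub>"
    proof
      interpret W: vectorspace class_ring W by (rule WW)
      assume "f v = \<zero>\<^bsub>W\<^esub>"
      then have "inverse (l v) \<odot>\<^bsub>W\<^esub> (l v \<odot>\<^bsub>W\<^esub> w) = \<zero>\<^bsub>W\<^esub>"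
        using v W.smult_r_null[of "inverse (l v)"] by (simp add: f_def)
      then show False using smult(4)[of "inverse (l v)" "l v"] smult(3) l(2) w by simp
    qed
    ultimately show ?thesis using v by (auto simp: Vect_simps(6) intro!: bexI[of _ f])
  qed
  then show ?thesis using W by (auto simp: Vect_simps(1))
next
  case False
  have "Idt Vect V = \<zero>\<^bsub>Hom_vs Vect V V\<^esub>" if "V \<in> Ob Vect" for V :: "(complex, 'v) module"
    unfolding Vect_simps(3,6) by (rule restrict_ext) (use False that in blast)
  then show ?thesis using ex_Vect_null_object by blast
qed

section \<open>Functors and essentially finite groupoids\<close>

definition functor_of ::
  "('o, 'm, 'c) category_scheme \<Rightarrow> ('o \<Rightarrow> 'p) \<Rightarrow> ('o \<Rightarrow> 'o \<Rightarrow> 'm \<Rightarrow> 'q) \<Rightarrow> ('o, 'm, 'p, 'q) cat_functor" where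
  "functor_of X a h = \<lparr>on_Ob = (\<lambda>x\<in>Ob X. a x),
     on_Hom = (\<lambda>x y f. if x \<in> Ob X \<and> y \<in> Ob X \<and> f \<in> Hom X x y then h x y f else undefined)\<rparr>"

lemma functor_of_simps [simp]:
  "x \<in> Ob X \<Longrightarrow> on_Ob (functor_of X a h) x = a x"
  "x \<in> Ob X \<Longrightarrow> y \<in> Ob X \<Longrightarrow> f \<in> Hom X x y \<Longrightarrow> on_Hom (functor_of X a h) x y f = h x y f"
  by (simp_all add: functor_of_def)

lemma is_functorD:
  assumes "is_functor X D F" and "x \<in> Ob X"
  shows "on_Ob F x \<in> Ob D"
    and "y \<in> Ob X \<Longrightarrow> f \<in> Hom X x y \<Longrightarrow> on_Hom F x y f \<in> Hom D (on_Ob F x) (on_Ob F y)"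
    and "on_Hom F x x (Idt X x) = Idt D (on_Ob F x)"
    and "y \<in> Ob X \<Longrightarrow> z \<in> Ob X \<Longrightarrow> f \<in> Hom X x y \<Longrightarrow> g \<in> Hom X y z \<Longrightarrow>
      on_Hom F x z (Comp X x y z g f) =
        Comp D (on_Ob F x) (on_Ob F y) (on_Ob F z) (on_Hom F y z g) (on_Hom F x y f)"
  using assms by (auto simp: is_functor_def)

lemma nat_transD:
  assumes "\<eta> \<in> nat_trans X D F G"
  shows "x \<in> Ob X \<Longrightarrow> \<eta> x \<in> Hom D (on_Ob F x) (on_Ob G x)"
    and "x \<in> Ob X \<Longrightarrow> y \<in> Ob X \<Longrightarrow> f \<in> Hom X x y \<Longrightarrow>
      Comp D (on_Ob F x) (on_Ob F y) (on_Ob G y) (\<eta> y) (on_Hom F x y f) =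
      Comp D (on_Ob F x) (on_Ob G x) (on_Ob G y) (on_Hom G x y f) (\<eta> x)"
    and "\<eta> \<in> extensional (Ob X)"
  using assms by (auto simp: nat_trans_def PiE_def)

lemma nat_transI:
  assumes "\<And>x. x \<in> Ob X \<Longrightarrow> \<eta> x \<in> Hom D (on_Ob F x) (on_Ob G x)"
    and "\<And>x y f. x \<in> Ob X \<Longrightarrow> y \<in> Ob X \<Longrightarrow> f \<in> Hom X x y \<Longrightarrow>
      Comp D (on_Ob F x) (on_Ob F y) (on_Ob G y) (\<eta> y) (on_Hom F x y f) =
      Comp D (on_Ob F x) (on_Ob G x) (on_Ob G y) (on_Hom G x y f) (\<eta> x)"
  shows "(\<lambda>x\<in>Ob X. \<eta> x) \<in> nat_trans X D F G"
  using assms by (auto simp: nat_trans_def)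

lemma functor_category_simps:
  "Ob (functor_category X D) = {F. is_functor X D F}"
  "Hom (functor_category X D) = nat_trans X D"
  "Idt (functor_category X D) F = (\<lambda>x\<in>Ob X. Idt D (on_Ob F x))"
  "Comp (functor_category X D) F G H \<beta> \<alpha> =
    (\<lambda>x\<in>Ob X. Comp D (on_Ob F x) (on_Ob G x) (on_Ob H x) (\<beta> x) (\<alpha> x))"
  "carrier (Hom_vs (functor_category X D) F G) = nat_trans X D F G"
  "\<zero>\<^bsub>Hom_vs (functor_category X D) F G\<^esub> = (\<lambda>x\<in>Ob X. \<zero>\<^bsub>Hom_vs D (on_Ob F x) (on_Ob G x)\<^esub>)"
  "\<alpha> \<oplus>\<^bsub>Hom_vs (functor_category X D) F G\<^esub> \<beta> =
    (\<lambda>x\<in>Ob X. \<alpha> x \<oplus>\<^bsub>Hom_vs D (on_Ob F x) (on_Ob G x)\<^esub> \<beta> x)"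
  "c \<odot>\<^bsub>Hom_vs (functor_category X D) F G\<^esub> \<alpha> =
    (\<lambda>x\<in>Ob X. c \<odot>\<^bsub>Hom_vs D (on_Ob F x) (on_Ob G x)\<^esub> \<alpha> x)"
  by (simp_all add: functor_category_def)

text \<open>\<open>r\<close> picks a representative of each isomorphism class.\<close>

locale represented_groupoid = groupoid X for X :: "('o, 'm, 'c) category_scheme" +
  fixes r :: "'o \<Rightarrow> 'o"
  assumes finite_Hom: "x \<in> Ob X \<Longrightarrow> y \<in> Ob X \<Longrightarrow> finite (Hom X x y)"
    and r_Ob: "x \<in> Ob X \<Longrightarrow> r x \<in> Ob X"
    and ex_Hom_r: "x \<in> Ob X \<Longrightarrow> Hom X x (r x) \<noteq> {}"
    and r_eq: "x \<in> Ob X \<Longrightarrow> y \<in> Ob X \<Longrightarrow> f \<in> Hom X x y \<Longrightarrow> r x = r y"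
    and finite_r: "finite (r ` Ob X)"
begin

definition inverse_of :: "'o \<Rightarrow> 'o \<Rightarrow> 'm \<Rightarrow> 'm" where
  "inverse_of x y f = (SOME g. g \<in> Hom X y x \<and> Comp X x y x g f = Idt X x \<and> Comp X y x y f g = Idt X y)"

lemma inverse_of:
  assumes "x \<in> Ob X" "y \<in> Ob X" "f \<in> Hom X x y"
  shows "inverse_of x y f \<in> Hom X y x"
    and "Comp X x y x (inverse_of x y f) f = Idt X x" "Comp X y x y f (inverse_of x y f) = Idt X y"
proof -
  have "\<exists>g. g \<in> Hom X y x \<and> Comp X x y x g f = Idt X x \<and> Comp X y x y f g = Idt X y"
    using all_iso[OF assms] by (auto simp: is_iso_def)
  from someI_ex[OF this] show "inverse_of x y f \<in> Hom X y x"
    "Comp X x y x (inverse_of x y f) f = Idt X x" "Comp X y x y f (inverse_of x y f) = Idt X y"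
    by (simp_all add: inverse_of_def)
qed

text \<open>Needed for the naturality of the average in \<open>FC_quasi_inverse\<close>: F(g) turns
  the factor F((h g)^-1) of a summand into F(h^-1).\<close>

lemma Comp_inverse_of_Comp:
  assumes "x \<in> Ob X" "y \<in> Ob X" "z \<in> Ob X" "g \<in> Hom X x y" "h \<in> Hom X y z"
  shows "Comp X z x y g (inverse_of x z (Comp X x y z h g)) = inverse_of y z h"
proof -
  define k where "k = inverse_of x z (Comp X x y z h g)"
  have hg: "Comp X x y z h g \<in> Hom X x z" using assms by (simp add: Comp_Hom)
  have k: "k \<in> Hom X z x" "Comp X z x z (Comp X x y z h g) k = Idt X z"
    using inverse_of[OF assms(1,3) hg] by (simp_all add: k_def)
  note inv = inverse_of[OF assms(2,3,5)]
  have "Comp X z x y g k = Comp X z y y (Comp X y z y (inverse_of y z h) h) (Comp X z x y g k)"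
    using assms k by (simp add: inv Comp_Idt_left Comp_Hom)
  also have "\<dots> = Comp X z z y (inverse_of y z h) (Comp X z x z (Comp X x y z h g) k)"
    using assms k inv(1) by (simp add: Comp_assoc Comp_Hom)
  also have "\<dots> = inverse_of y z h"
    using assms inv(1) by (simp add: k Comp_Idt_right)
  finally show ?thesis by (simp add: k_def)
qed

text \<open>Composition with the inverse of g undoes composition with g. The bijection reindexes a
  sum over morphisms out of x as a sum over morphisms out of y.\<close>

lemma bij_betw_Comp_right:
  assumes "x \<in> Ob X" "y \<in> Ob X" "z \<in> Ob X" and g: "g \<in> Hom X x y"
  shows "bij_betw (\<lambda>h. Comp X x y z h g) (Hom X y z) (Hom X x z)"
proof (rule bij_betw_byWitness[where f' = "\<lambda>k. Comp X y x z k (inverse_of x y g)"])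
  note inv = inverse_of[OF assms(1,2,4)]
  show "\<forall>h\<in>Hom X y z. Comp X y x z (Comp X x y z h g) (inverse_of x y g) = h"
    "\<forall>k\<in>Hom X x z. Comp X x y z (Comp X y x z k (inverse_of x y g)) g = k"
    using assms inv by (simp_all add: Comp_assoc Comp_Idt_right)
  show "(\<lambda>h. Comp X x y z h g) ` Hom X y z \<subseteq> Hom X x z"
    "(\<lambda>k. Comp X y x z k (inverse_of x y g)) ` Hom X x z \<subseteq> Hom X y z"
    using assms inv(1) by (auto simp: Comp_Hom)
qed

end

text \<open>The natural isomorphism \<alpha> from GF to the identity makes F faithful, so hom-sets
  inherit finiteness from D. Moreover x is isomorphic to G(F x), so every representative is already
  that of G a for one of the finitely many objects a of D.\<close>

lemma essentially_finite_represented: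
  assumes X: "groupoid X" and ef: "essentially_finite X"
  obtains r where "represented_groupoid X r"
proof -
  interpret groupoid X by fact
  obtain D :: "(nat, nat) category" and F G \<alpha> where
    D: "finite_groupoid D" and F: "is_functor X D F" and G: "is_functor D X G"
    and \<alpha>: "\<alpha> \<in> nat_trans X X (comp_functor X G F) (id_functor X)"
    and iso: "\<And>x. x \<in> Ob X \<Longrightarrow> is_iso X (on_Ob (comp_functor X G F) x) (on_Ob (id_functor X) x) (\<alpha> x)"
    using ef by (auto simp: essentially_finite_def equivalent_categories_def nat_iso_def)
  let ?GF = "\<lambda>x. on_Ob G (on_Ob F x)"
  have Ob [simp]: "?GF x \<in> Ob X" "on_Ob F x \<in> Ob D" if "x \<in> Ob X" for x
    using is_functorD(1)[OF F that] is_functorD(1)[OF G] by auto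
  have \<alpha>_Hom [simp]: "\<alpha> x \<in> Hom X (?GF x) x" if "x \<in> Ob X" for x
    using nat_transD(1)[OF \<alpha> that] that by (simp add: comp_functor_def id_functor_def)
  have inv: "\<exists>g\<in>Hom X x (?GF x). Comp X x (?GF x) x (\<alpha> x) g = Idt X x" if "x \<in> Ob X" for x
    using iso[OF that] that by (auto simp: is_iso_def comp_functor_def id_functor_def)
  have fin: "finite (Hom X x y)" if xy: "x \<in> Ob X" "y \<in> Ob X" for x y
  proof -
    have "inj_on (on_Hom F x y) (Hom X x y)"
    proof (rule inj_onI)
      fix f g assume f: "f \<in> Hom X x y" and g: "g \<in> Hom X x y" and eq: "on_Hom F x y f = on_Hom F x y g"
      obtain k where k: "k \<in> Hom X x (?GF x)" "Comp X x (?GF x) x (\<alpha> x) k = Idt X x"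
        using inv xy by blast
      have nat: "Comp X (?GF x) (?GF y) y (\<alpha> y) (on_Hom G (on_Ob F x) (on_Ob F y) (on_Hom F x y h)) =
          Comp X (?GF x) x y h (\<alpha> x)" if "h \<in> Hom X x y" for h
        using nat_transD(2)[OF \<alpha> xy that] xy that by (simp add: comp_functor_def id_functor_def)
      \<comment> \<open>By naturality f \<alpha> x depends only on the image of f under F; the right
        inverse k of \<alpha> x then recovers f.\<close>
      have "Comp X (?GF x) x y f (\<alpha> x) = Comp X (?GF x) x y g (\<alpha> x)"
        using nat[OF f] nat[OF g] eq by simp
      then have "Comp X x (?GF x) y (Comp X (?GF x) x y f (\<alpha> x)) k =
          Comp X x (?GF x) y (Comp X (?GF x) x y g (\<alpha> x)) k" by simp
      then show "f = g"
        using xy f g k by (simp add: Comp_assoc Comp_Idt_right)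
    qed
    moreover have "on_Hom F x y ` Hom X x y \<subseteq> Hom D (on_Ob F x) (on_Ob F y)"
      using is_functorD(2)[OF F] xy by auto
    moreover have "finite (Hom D (on_Ob F x) (on_Ob F y))"
      using D xy by (simp add: finite_groupoid_def)
    ultimately show ?thesis by (meson finite_imageD finite_subset)
  qed
  \<comment> \<open>The predicate under \<open>SOME\<close> depends only on the isomorphism class of
    x, so isomorphic objects get literally the same representative.\<close>
  define r where "r x = (SOME y. y \<in> Ob X \<and> Hom X x y \<noteq> {})" for x
  have r: "r x \<in> Ob X \<and> Hom X x (r x) \<noteq> {}" if "x \<in> Ob X" for x
    unfolding r_def by (rule someI[of _ x]) (use that Idt_Hom in auto)
  have r_eq: "r x = r y" if xy: "x \<in> Ob X" "y \<in> Ob X" and f: "f \<in> Hom X x y" for x y f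
  proof -
    obtain g where "g \<in> Hom X y x" using all_iso[OF xy f] by (auto simp: is_iso_def)
    then have "Hom X x z \<noteq> {} \<longleftrightarrow> Hom X y z \<noteq> {}" if "z \<in> Ob X" for z
      using Comp_Hom[OF xy(1,2) that f] Comp_Hom[OF xy(2,1) that] by blast
    then have "(\<lambda>z. z \<in> Ob X \<and> Hom X x z \<noteq> {}) = (\<lambda>z. z \<in> Ob X \<and> Hom X y z \<noteq> {})"
      by (intro ext) blast
    then show ?thesis by (simp add: r_def)
  qed
  have "r ` Ob X \<subseteq> (\<lambda>a. r (on_Ob G a)) ` Ob D"
  proof
    fix y assume "y \<in> r ` Ob X"
    then obtain x where x: "x \<in> Ob X" "y = r x" by auto
    then have "y = r (?GF x)" using r_eq[OF Ob(1)[OF x(1)] x(1) \<alpha>_Hom[OF x(1)]] by simp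
    then show "y \<in> (\<lambda>a. r (on_Ob G a)) ` Ob D" using x by auto
  qed
  moreover have "finite (Ob D)" using D by (simp add: finite_groupoid_def)
  ultimately have "finite (r ` Ob X)" by (meson finite_imageI finite_subset)
  then have "represented_groupoid X r"
    using fin r r_eq by unfold_locales auto
  then show thesis by (rule that)
qed

section \<open>Functor categories\<close>

text \<open>The target D is an arbitrary regular linear category; what is used of
  \<open>Vect\<close> is its regularity and, at the end, its cogenerator.\<close>

locale groupoid_functor_category =
  X: represented_groupoid X r + D: regular_linear_category D
  for X :: "('o, 'm, 'c) category_scheme" and r :: "'o \<Rightarrow> 'o"
    and D :: "('p, 'q, 'd) linear_category_scheme"
begin

abbreviation "FC \<equiv> functor_category X D"

lemmas functorD = is_functorD[where X = X and D = D]
lemmas transD = nat_transD[where X = X and D = D]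
lemmas closed [simp] = functorD(1,2) D.Comp_Hom D.Idt_Hom D.Hom_closed X.Comp_Hom X.Idt_Hom
  X.r_Ob

lemma functor_ofI:
  assumes "\<And>x. x \<in> Ob X \<Longrightarrow> a x \<in> Ob D"
    and "\<And>x y f. x \<in> Ob X \<Longrightarrow> y \<in> Ob X \<Longrightarrow> f \<in> Hom X x y \<Longrightarrow> h x y f \<in> Hom D (a x) (a y)"
    and "\<And>x. x \<in> Ob X \<Longrightarrow> h x x (Idt X x) = Idt D (a x)"
    and "\<And>x y z f g. x \<in> Ob X \<Longrightarrow> y \<in> Ob X \<Longrightarrow> z \<in> Ob X \<Longrightarrow> f \<in> Hom X x y \<Longrightarrow> g \<in> Hom X y z \<Longrightarrow>
      h x z (Comp X x y z g f) = Comp D (a x) (a y) (a z) (h y z g) (h x y f)"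
  shows "is_functor X D (functor_of X a h)"
  unfolding is_functor_def
proof (intro conjI ballI allI impI)
  show "on_Ob (functor_of X a h) \<in> Ob X \<rightarrow>\<^sub>E Ob D" using assms(1) by (auto simp: functor_of_def)
  show "on_Hom (functor_of X a h) x y f = undefined"
    if "\<not> (x \<in> Ob X \<and> y \<in> Ob X \<and> f \<in> Hom X x y)" for x y f
    using that by (auto simp: functor_of_def)
qed (use assms in auto)

section \<open>Natural transformations as vector spaces\<close>

lemma complex_vectorspace_nat_trans:
  assumes F: "is_functor X D F" and G: "is_functor X D G"
  shows "complex_vectorspace (Hom_vs FC F G)"
proof -
  note [simp] = F G transD(1) functor_category_simps(5-8)
  note simps = D.Hom_vs_simps D.Comp_right D.Comp_left D.Hom_smult_zero
  show ?thesis
  proof (rule complex_vectorspaceI)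
    show "\<zero>\<^bsub>Hom_vs FC F G\<^esub> \<in> carrier (Hom_vs FC F G)"
      unfolding functor_category_simps(5,6) by (rule nat_transI) (auto simp: D.Comp_right D.Comp_left)
  next
    fix \<alpha> \<beta> assume "\<alpha> \<in> carrier (Hom_vs FC F G)" "\<beta> \<in> carrier (Hom_vs FC F G)"
    then have *: "\<alpha> \<in> nat_trans X D F G" "\<beta> \<in> nat_trans X D F G" by simp_all
    then show "\<alpha> \<oplus>\<^bsub>Hom_vs FC F G\<^esub> \<beta> \<in> carrier (Hom_vs FC F G)"
      unfolding functor_category_simps(5,7)
      by (intro nat_transI) (auto simp: D.Comp_right D.Comp_left transD(2)[OF *(1)] transD(2)[OF *(2)])
  next
    fix \<alpha> c assume "\<alpha> \<in> carrier (Hom_vs FC F G)"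
    then have *: "\<alpha> \<in> nat_trans X D F G" by simp
    then show "c \<odot>\<^bsub>Hom_vs FC F G\<^esub> \<alpha> \<in> carrier (Hom_vs FC F G)"
      unfolding functor_category_simps(5,8)
      by (intro nat_transI) (auto simp: D.Comp_right D.Comp_left transD(2)[OF *])
  next
    fix \<alpha> assume "\<alpha> \<in> carrier (Hom_vs FC F G)"
    then have \<alpha>: "\<alpha> \<in> nat_trans X D F G" by simp
    show "\<alpha> \<oplus>\<^bsub>Hom_vs FC F G\<^esub> \<zero>\<^bsub>Hom_vs FC F G\<^esub> = \<alpha>" "1 \<odot>\<^bsub>Hom_vs FC F G\<^esub> \<alpha> = \<alpha>"
      using \<alpha> transD(3)[OF \<alpha>]
      by (auto simp: simps(1-4) restrict_def extensional_def fun_eq_iff)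
  next
    fix \<alpha> \<beta> assume "\<alpha> \<in> carrier (Hom_vs FC F G)" "\<beta> \<in> carrier (Hom_vs FC F G)"
    then show "\<alpha> \<oplus>\<^bsub>Hom_vs FC F G\<^esub> \<beta> = \<beta> \<oplus>\<^bsub>Hom_vs FC F G\<^esub> \<alpha>"
      by (auto intro!: restrict_ext simps(7))
  qed (auto intro!: restrict_ext simp: simps(2,5,6,8,9))
qed

text \<open>If h leads from x to its representative and k is the inverse of h, naturality gives
  \<eta> x = G(k) \<eta> (r x) F(h); so the components at the finitely many representatives
  determine \<eta>.\<close>

lemma fd_vs_nat_trans:
  assumes F: "is_functor X D F" and G: "is_functor X D G"
  shows "fd_vs (Hom_vs FC F G)"
proof (rule fd_vs_of_linear_maps[of _ "r ` Ob X" "\<lambda>s. Hom_vs D (on_Ob F s) (on_Ob G s)" "\<lambda>s \<eta>. \<eta> s"])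
  note [simp] = F G transD(1)
  show "complex_vectorspace (Hom_vs FC F G)" by (rule complex_vectorspace_nat_trans) fact+
  show "finite (r ` Ob X)" by (rule X.finite_r)
  fix s assume "s \<in> r ` Ob X"
  then have s [simp]: "s \<in> Ob X" by auto
  then show "fd_vs (Hom_vs D (on_Ob F s) (on_Ob G s))" by (simp add: D.fd_vs_Hom_vs)
  show "(\<lambda>\<eta>. \<eta> s) \<in> linear_maps (Hom_vs FC F G) (Hom_vs D (on_Ob F s) (on_Ob G s))"
    by (rule linear_mapsI) (auto simp: functor_category_simps D.carrier_Hom_vs)
next
  note [simp] = F G transD(1)
  fix \<eta> assume "\<eta> \<in> carrier (Hom_vs FC F G)"
    and 0: "\<And>s. s \<in> r ` Ob X \<Longrightarrow> \<eta> s = \<zero>\<^bsub>Hom_vs D (on_Ob F s) (on_Ob G s)\<^esub>"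
  then have \<eta>: "\<eta> \<in> nat_trans X D F G" by (simp add: functor_category_simps)
  have "\<eta> x = \<zero>\<^bsub>Hom_vs D (on_Ob F x) (on_Ob G x)\<^esub>" if x [simp]: "x \<in> Ob X" for x
  proof -
    obtain h where h [simp]: "h \<in> Hom X x (r x)" using X.ex_Hom_r[OF x] by blast
    define k where "k = X.inverse_of x (r x) h"
    have k [simp]: "k \<in> Hom X (r x) x" "Comp X x (r x) x k h = Idt X x"
      using X.inverse_of(1,2)[OF x _ h] by (simp_all add: k_def)
    have "\<eta> x = Comp D (on_Ob F x) (on_Ob G x) (on_Ob G x) (on_Hom G x x (Comp X x (r x) x k h)) (\<eta> x)"
      using \<eta> by (simp add: functorD(3)[OF G] D.Comp_Idt_left)
    also have "\<dots> = Comp D (on_Ob F x) (on_Ob G (r x)) (on_Ob G x) (on_Hom G (r x) x k)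
        (Comp D (on_Ob F x) (on_Ob G x) (on_Ob G (r x)) (on_Hom G x (r x) h) (\<eta> x))"
      using \<eta> by (simp add: functorD(4)[OF G] D.Comp_assoc del: k(2))
    also have "Comp D (on_Ob F x) (on_Ob G x) (on_Ob G (r x)) (on_Hom G x (r x) h) (\<eta> x) =
        Comp D (on_Ob F x) (on_Ob F (r x)) (on_Ob G (r x)) (\<eta> (r x)) (on_Hom F x (r x) h)"
      using transD(2)[OF \<eta>, of x "r x" h] by simp
    finally show ?thesis
      using 0[of "r x"] by (simp add: D.Comp_left D.Comp_right)
  qed
  then show "\<eta> = \<zero>\<^bsub>Hom_vs FC F G\<^esub>"
    using transD(3)[OF \<eta>]
    by (auto simp: functor_category_simps restrict_def extensional_def fun_eq_iff)
qed

lemma Comp_nat_trans: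
  assumes F: "is_functor X D F" and G: "is_functor X D G" and H: "is_functor X D H"
    and \<alpha>: "\<alpha> \<in> nat_trans X D F G" and \<beta>: "\<beta> \<in> nat_trans X D G H"
  shows "Comp FC F G H \<beta> \<alpha> \<in> nat_trans X D F H"
  unfolding functor_category_simps
proof (rule nat_transI)
  note [simp] = F G H transD(1)[OF \<alpha>] transD(1)[OF \<beta>]
  fix x y f assume [simp]: "x \<in> Ob X" "y \<in> Ob X" "f \<in> Hom X x y"
  have "Comp D (on_Ob F x) (on_Ob F y) (on_Ob H y)
        (Comp D (on_Ob F y) (on_Ob G y) (on_Ob H y) (\<beta> y) (\<alpha> y)) (on_Hom F x y f) =
      Comp D (on_Ob F x) (on_Ob G x) (on_Ob H y)
        (Comp D (on_Ob G x) (on_Ob G y) (on_Ob H y) (\<beta> y) (on_Hom G x y f)) (\<alpha> x)"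
    by (simp add: D.Comp_assoc transD(2)[OF \<alpha>])
  then show "Comp D (on_Ob F x) (on_Ob F y) (on_Ob H y)
        (Comp D (on_Ob F y) (on_Ob G y) (on_Ob H y) (\<beta> y) (\<alpha> y)) (on_Hom F x y f) =
      Comp D (on_Ob F x) (on_Ob H x) (on_Ob H y) (on_Hom H x y f)
        (Comp D (on_Ob F x) (on_Ob G x) (on_Ob H x) (\<beta> x) (\<alpha> x))"
    by (simp add: D.Comp_assoc transD(2)[OF \<beta>])
qed (use assms transD(1) in auto)

lemma linear_category_FC: "linear_category FC"
proof
  note [simp] = transD(1) functor_category_simps
  {
    fix F assume "F \<in> Ob FC"
    then show "Idt FC F \<in> Hom FC F F"
      by (auto intro!: nat_transI simp: D.Comp_Idt_left D.Comp_Idt_right)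
  next
    fix F G H \<alpha> \<beta> assume "F \<in> Ob FC" "G \<in> Ob FC" "H \<in> Ob FC" "\<alpha> \<in> Hom FC F G" "\<beta> \<in> Hom FC G H"
    then show "Comp FC F G H \<beta> \<alpha> \<in> Hom FC F H"
      using Comp_nat_trans[of F G H \<alpha> \<beta>] by simp
  next
    fix F G \<alpha> assume *: "F \<in> Ob FC" "G \<in> Ob FC" and \<alpha>: "\<alpha> \<in> Hom FC F G"
    then show "Comp FC F F G \<alpha> (Idt FC F) = \<alpha>" "Comp FC F G G (Idt FC G) \<alpha> = \<alpha>"
      using transD(3)[of \<alpha> F G]
      by (auto simp: D.Comp_Idt_left D.Comp_Idt_right restrict_def extensional_def fun_eq_iff)
  next
    fix E F G H \<alpha> \<beta> \<gamma>
    assume "E \<in> Ob FC" "F \<in> Ob FC" "G \<in> Ob FC" "H \<in> Ob FC"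
      "\<alpha> \<in> Hom FC E F" "\<beta> \<in> Hom FC F G" "\<gamma> \<in> Hom FC G H"
    then show "Comp FC E F H (Comp FC F G H \<gamma> \<beta>) \<alpha> = Comp FC E G H \<gamma> (Comp FC E F G \<beta> \<alpha>)"
      by (auto simp: D.Comp_assoc intro!: restrict_ext)
  next
    fix F G assume "F \<in> Ob FC" "G \<in> Ob FC"
    then show "carrier (Hom_vs FC F G) = Hom FC F G" "fd_vs (Hom_vs FC F G)"
      using fd_vs_nat_trans[of F G] by simp_all
  next
    fix F G H \<beta> assume *: "F \<in> Ob FC" "G \<in> Ob FC" "H \<in> Ob FC" "\<beta> \<in> Hom FC G H"
    then show "(\<lambda>\<alpha>. Comp FC F G H \<beta> \<alpha>) \<in> linear_maps (Hom_vs FC F G) (Hom_vs FC F H)"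
      using Comp_nat_trans[of F G H _ \<beta>]
      by (intro linear_mapsI) (auto simp: D.Comp_right intro!: restrict_ext)
  next
    fix F G H \<alpha> assume *: "F \<in> Ob FC" "G \<in> Ob FC" "H \<in> Ob FC" "\<alpha> \<in> Hom FC F G"
    then show "(\<lambda>\<beta>. Comp FC F G H \<beta> \<alpha>) \<in> linear_maps (Hom_vs FC G H) (Hom_vs FC F H)"
      using Comp_nat_trans[of F G H \<alpha>]
      by (intro linear_mapsI) (auto simp: D.Comp_left intro!: restrict_ext)
  }
qed

section \<open>Regularity of the functor category\<close>

lemma ex_null_functor: "\<exists>Z\<in>Ob FC. Idt FC Z = \<zero>\<^bsub>Hom_vs FC Z Z\<^esub>"
proof -
  obtain z where z: "z \<in> Ob D" "Idt D z = \<zero>\<^bsub>Hom_vs D z z\<^esub>" using D.ex_null_object by blast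
  define Z where "Z = functor_of X (\<lambda>_. z) (\<lambda>_ _ _. Idt D z)"
  have "is_functor X D Z"
    unfolding Z_def by (rule functor_ofI) (use z(1) in \<open>auto simp: D.Comp_Idt_left\<close>)
  moreover have "Idt FC Z = \<zero>\<^bsub>Hom_vs FC Z Z\<^esub>"
    using z by (auto simp: functor_category_simps Z_def intro!: restrict_ext)
  ultimately show ?thesis by (auto simp: functor_category_simps)
qed

text \<open>The biproducts b x are chosen independently for different x. The action i F(f) p + j
  G(f) q is the only one that makes the projections natural, and the functor laws follow by
  comparing projections.\<close>

lemma ex_binary_biproduct_functor:
  assumes F: "is_functor X D F" and G: "is_functor X D G"
  shows "\<exists>B i p j q. binary_biproduct FC F G B i p j q"
proof -
  note [simp] = F G
  have "\<exists>b i p j q. binary_biproduct D (on_Ob F x) (on_Ob G x) b i p j q" if "x \<in> Ob X" for x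
    using that by (intro D.ex_binary_biproduct) auto
  then obtain b i p j q where
    bb: "\<And>x. x \<in> Ob X \<Longrightarrow> binary_biproduct D (on_Ob F x) (on_Ob G x) (b x) (i x) (p x) (j x) (q x)"
    by metis
  note eqI = D.binary_biproduct_eqI[OF bb]
  have [simp]: "b x \<in> Ob D" "i x \<in> Hom D (on_Ob F x) (b x)" "p x \<in> Hom D (b x) (on_Ob F x)"
    "j x \<in> Hom D (on_Ob G x) (b x)" "q x \<in> Hom D (b x) (on_Ob G x)"
    and pi: "Comp D (on_Ob F x) (b x) (on_Ob F x) (p x) (i x) = Idt D (on_Ob F x)"
    and qj: "Comp D (on_Ob G x) (b x) (on_Ob G x) (q x) (j x) = Idt D (on_Ob G x)"
    and sum: "Comp D (b x) (on_Ob F x) (b x) (i x) (p x) \<oplus>\<^bsub>Hom_vs D (b x) (b x)\<^esub>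
      Comp D (b x) (on_Ob G x) (b x) (j x) (q x) = Idt D (b x)" if "x \<in> Ob X" for x
    using bb[OF that] by (simp_all add: binary_biproduct_def retract_def)
  note proj = D.binary_biproduct_proj[OF bb]
  define h where "h x y f =
      Comp D (b x) (on_Ob F y) (b y) (i y) (Comp D (b x) (on_Ob F x) (on_Ob F y) (on_Hom F x y f) (p x))
    \<oplus>\<^bsub>Hom_vs D (b x) (b y)\<^esub>
      Comp D (b x) (on_Ob G y) (b y) (j y) (Comp D (b x) (on_Ob G x) (on_Ob G y) (on_Hom G x y f) (q x))"
    for x y f
  have h_Hom [simp]: "h x y f \<in> Hom D (b x) (b y)" if "x \<in> Ob X" "y \<in> Ob X" "f \<in> Hom X x y" for x y f
    using that by (simp add: h_def)
  have ph: "Comp D (b x) (b y) (on_Ob F y) (p y) (h x y f) =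
        Comp D (b x) (on_Ob F x) (on_Ob F y) (on_Hom F x y f) (p x)"
    and qh: "Comp D (b x) (b y) (on_Ob G y) (q y) (h x y f) =
        Comp D (b x) (on_Ob G x) (on_Ob G y) (on_Hom G x y f) (q x)"
    if "x \<in> Ob X" "y \<in> Ob X" "f \<in> Hom X x y" for x y f
    using that by (simp_all add: h_def D.Comp_right(2) proj D.Hom_vs_simps(1,3))
  \<comment> \<open>The same relations with a further map u on the right, the shape that composites
    take once they are associated to the right.\<close>
  have ph2: "Comp D w (b y) (on_Ob F y) (p y) (Comp D w (b x) (b y) (h x y f) u) =
        Comp D w (on_Ob F x) (on_Ob F y) (on_Hom F x y f) (Comp D w (b x) (on_Ob F x) (p x) u)"
    and qh2: "Comp D w (b y) (on_Ob G y) (q y) (Comp D w (b x) (b y) (h x y f) u) =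
        Comp D w (on_Ob G x) (on_Ob G y) (on_Hom G x y f) (Comp D w (b x) (on_Ob G x) (q x) u)"
    if "x \<in> Ob X" "y \<in> Ob X" "f \<in> Hom X x y" "w \<in> Ob D" "u \<in> Hom D w (b x)" for w x y f u
    using that ph[OF that(1-3)] qh[OF that(1-3)] D.Comp_assoc[of w "b x" "b y" _ u "h x y f"]
      D.Comp_assoc[of w "b x" _ _ u _ "on_Hom F x y f"] D.Comp_assoc[of w "b x" _ _ u _ "on_Hom G x y f"]
    by (metis \<open>\<And>x. x \<in> Ob X \<Longrightarrow> b x \<in> Ob D\<close> \<open>\<And>x. x \<in> Ob X \<Longrightarrow> p x \<in> Hom D (b x) (on_Ob F x)\<close>
        \<open>\<And>x. x \<in> Ob X \<Longrightarrow> q x \<in> Hom D (b x) (on_Ob G x)\<close> F G functorD(1,2) h_Hom)+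
  define B where "B = functor_of X b h"
  have B: "is_functor X D B"
    unfolding B_def
  proof (rule functor_ofI)
    fix x assume [simp]: "x \<in> Ob X"
    show "h x x (Idt X x) = Idt D (b x)"
      by (rule eqI[of x "b x"]) (simp_all add: ph qh functorD(3) D.Comp_Idt_left D.Comp_Idt_right)
  next
    fix x y z f g assume [simp]: "x \<in> Ob X" "y \<in> Ob X" "z \<in> Ob X" "f \<in> Hom X x y" "g \<in> Hom X y z"
    show "h x z (Comp X x y z g f) = Comp D (b x) (b y) (b z) (h y z g) (h x y f)"
      by (rule eqI[of z "b x"]) (simp_all add: ph qh ph2 qh2 functorD(4) D.Comp_assoc)
  qed simp_all
  have B_simps [simp]: "on_Ob B x = b x" "y \<in> Ob X \<Longrightarrow> f \<in> Hom X x y \<Longrightarrow> on_Hom B x y f = h x y f"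
    if "x \<in> Ob X" for x y f
    using that by (simp_all add: B_def)
  have "(\<lambda>x\<in>Ob X. p x) \<in> nat_trans X D B F" "(\<lambda>x\<in>Ob X. q x) \<in> nat_trans X D B G"
    by (rule nat_transI; simp add: ph qh)+
  moreover have "(\<lambda>x\<in>Ob X. i x) \<in> nat_trans X D F B"
  proof (rule nat_transI)
    fix x y f assume [simp]: "x \<in> Ob X" "y \<in> Ob X" "f \<in> Hom X x y"
    show "Comp D (on_Ob F x) (on_Ob F y) (on_Ob B y) (i y) (on_Hom F x y f) =
        Comp D (on_Ob F x) (on_Ob B x) (on_Ob B y) (on_Hom B x y f) (i x)"
      by (rule eqI[of y "on_Ob F x"])
        (simp_all add: ph2 qh2 proj D.Comp_right D.binary_biproduct_orthogonal[OF bb] pi D.Comp_Idt_right)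
  qed simp
  moreover have "(\<lambda>x\<in>Ob X. j x) \<in> nat_trans X D G B"
  proof (rule nat_transI)
    fix x y f assume [simp]: "x \<in> Ob X" "y \<in> Ob X" "f \<in> Hom X x y"
    show "Comp D (on_Ob G x) (on_Ob G y) (on_Ob B y) (j y) (on_Hom G x y f) =
        Comp D (on_Ob G x) (on_Ob B x) (on_Ob B y) (on_Hom B x y f) (j x)"
      by (rule eqI[of y "on_Ob G x"])
        (simp_all add: ph2 qh2 proj D.Comp_right D.binary_biproduct_orthogonal[OF bb] qj D.Comp_Idt_right)
  qed simp
  ultimately have "binary_biproduct FC F G B (\<lambda>x\<in>Ob X. i x) (\<lambda>x\<in>Ob X. p x) (\<lambda>x\<in>Ob X. j x) (\<lambda>x\<in>Ob X. q x)"
    using B by (auto simp: binary_biproduct_def retract_def functor_category_simps pi qj sum intro!: restrict_ext)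
  then show ?thesis by blast
qed

text \<open>The splittings y x are chosen separately, and Y acts by p F(f) i. In a composite of two
  such maps the inner i p is e, which naturality moves past F(f), where i absorbs it because e i =
  i.\<close>

lemma FC_idempotent_split:
  assumes F: "is_functor X D F" and e: "e \<in> nat_trans X D F F" "Comp FC F F F e e = e"
  shows "\<exists>Y i p. retract FC F Y i p \<and> Comp FC F Y F i p = e"
proof -
  note [simp] = F transD(1)[OF e(1)]
  have ee: "Comp D (on_Ob F x) (on_Ob F x) (on_Ob F x) (e x) (e x) = e x" if "x \<in> Ob X" for x
    using fun_cong[OF e(2), of x] that by (simp add: functor_category_simps)
  have "\<exists>y i p. retract D (on_Ob F x) y i p \<and> Comp D (on_Ob F x) y (on_Ob F x) i p = e x"
    if "x \<in> Ob X" for x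
    using that ee by (intro D.idempotent_split) auto
  then obtain y i p where r: "\<And>x. x \<in> Ob X \<Longrightarrow> retract D (on_Ob F x) (y x) (i x) (p x)"
    and ip: "\<And>x. x \<in> Ob X \<Longrightarrow> Comp D (on_Ob F x) (y x) (on_Ob F x) (i x) (p x) = e x"
    by metis
  have [simp]: "y x \<in> Ob D" "i x \<in> Hom D (y x) (on_Ob F x)" "p x \<in> Hom D (on_Ob F x) (y x)"
    and pi: "Comp D (y x) (on_Ob F x) (y x) (p x) (i x) = Idt D (y x)" if "x \<in> Ob X" for x
    using r[OF that] by (simp_all add: retract_def)
  have ip2: "Comp D w (y x) (on_Ob F x) (i x) (Comp D w (on_Ob F x) (y x) (p x) u) =
      Comp D w (on_Ob F x) (on_Ob F x) (e x) u"
    if "x \<in> Ob X" "w \<in> Ob D" "u \<in> Hom D w (on_Ob F x)" for x w u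
    using that by (simp add: D.Comp_assoc flip: ip)
  have ei: "Comp D (y x) (on_Ob F x) (on_Ob F x) (e x) (i x) = i x" if [simp]: "x \<in> Ob X" for x
    unfolding ip[OF that, symmetric] by (simp add: D.Comp_assoc pi D.Comp_Idt_right)
  have pe: "Comp D (on_Ob F x) (on_Ob F x) (y x) (p x) (e x) = p x" if [simp]: "x \<in> Ob X" for x
  proof -
    have "Comp D (on_Ob F x) (on_Ob F x) (y x) (p x) (e x) =
        Comp D (on_Ob F x) (y x) (y x) (Comp D (y x) (on_Ob F x) (y x) (p x) (i x)) (p x)"
      unfolding ip[OF that, symmetric] by (simp add: D.Comp_assoc)
    then show ?thesis by (simp add: pi D.Comp_Idt_left)
  qed
  have eF: "Comp D (y x) (on_Ob F x') (on_Ob F x') (e x')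
      (Comp D (y x) (on_Ob F x) (on_Ob F x') (on_Hom F x x' f) (i x)) =
      Comp D (y x) (on_Ob F x) (on_Ob F x') (on_Hom F x x' f) (i x)"
    if [simp]: "x \<in> Ob X" "x' \<in> Ob X" "f \<in> Hom X x x'" for x x' f
  proof -
    have "Comp D (y x) (on_Ob F x') (on_Ob F x') (e x')
        (Comp D (y x) (on_Ob F x) (on_Ob F x') (on_Hom F x x' f) (i x)) =
        Comp D (y x) (on_Ob F x) (on_Ob F x')
          (Comp D (on_Ob F x) (on_Ob F x') (on_Ob F x') (e x') (on_Hom F x x' f)) (i x)"
      by (simp add: D.Comp_assoc)
    also have "Comp D (on_Ob F x) (on_Ob F x') (on_Ob F x') (e x') (on_Hom F x x' f) =
        Comp D (on_Ob F x) (on_Ob F x) (on_Ob F x') (on_Hom F x x' f) (e x)"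
      by (rule transD(2)[OF e(1)]) auto
    finally show ?thesis by (simp add: D.Comp_assoc ei)
  qed
  define h where "h x x' f = Comp D (y x) (on_Ob F x') (y x') (p x')
    (Comp D (y x) (on_Ob F x) (on_Ob F x') (on_Hom F x x' f) (i x))" for x x' f
  define Y where "Y = functor_of X y h"
  have Y: "is_functor X D Y"
    unfolding Y_def
  proof (rule functor_ofI)
    fix x assume [simp]: "x \<in> Ob X"
    show "h x x (Idt X x) = Idt D (y x)"
      by (simp add: h_def functorD(3) D.Comp_Idt_left pi)
  next
    fix u v w f g assume [simp]: "u \<in> Ob X" "v \<in> Ob X" "w \<in> Ob X" "f \<in> Hom X u v" "g \<in> Hom X v w"
    show "h u w (Comp X u v w g f) = Comp D (y u) (y v) (y w) (h v w g) (h u v f)"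
      by (simp add: h_def functorD(4) D.Comp_assoc ip2 eF)
  qed (simp_all add: h_def)
  have Y_simps [simp]: "on_Ob Y x = y x" "x' \<in> Ob X \<Longrightarrow> f \<in> Hom X x x' \<Longrightarrow> on_Hom Y x x' f = h x x' f"
    if "x \<in> Ob X" for x x' f
    using that by (simp_all add: Y_def)
  have "(\<lambda>x\<in>Ob X. i x) \<in> nat_trans X D Y F"
    by (rule nat_transI) (simp_all add: h_def ip2 eF)
  moreover have "(\<lambda>x\<in>Ob X. p x) \<in> nat_trans X D F Y"
  proof (rule nat_transI)
    fix x x' f assume [simp]: "x \<in> Ob X" "x' \<in> Ob X" "f \<in> Hom X x x'"
    have "Comp D (on_Ob F x) (y x) (y x') (h x x' f) (p x) =
        Comp D (on_Ob F x) (on_Ob F x') (y x') (p x')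
          (Comp D (on_Ob F x) (on_Ob F x) (on_Ob F x') (on_Hom F x x' f) (e x))"
      by (simp add: h_def D.Comp_assoc ip)
    also have "Comp D (on_Ob F x) (on_Ob F x) (on_Ob F x') (on_Hom F x x' f) (e x) =
        Comp D (on_Ob F x) (on_Ob F x') (on_Ob F x') (e x') (on_Hom F x x' f)"
      by (rule transD(2)[OF e(1), symmetric]) auto
    also have "Comp D (on_Ob F x) (on_Ob F x') (y x') (p x') \<dots> =
        Comp D (on_Ob F x) (on_Ob F x') (y x')
          (Comp D (on_Ob F x') (on_Ob F x') (y x') (p x') (e x')) (on_Hom F x x' f)"
      by (simp add: D.Comp_assoc)
    finally show "Comp D (on_Ob F x) (on_Ob F x') (on_Ob Y x') (p x') (on_Hom F x x' f) =
        Comp D (on_Ob F x) (on_Ob Y x) (on_Ob Y x') (on_Hom Y x x' f) (p x)"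
      by (simp add: pe)
  qed simp
  moreover have "Comp FC F Y F (\<lambda>x\<in>Ob X. i x) (\<lambda>x\<in>Ob X. p x) = e"
    using transD(3)[OF e(1)]
    by (auto simp: functor_category_simps ip restrict_def extensional_def fun_eq_iff)
  ultimately have "retract FC F Y (\<lambda>x\<in>Ob X. i x) (\<lambda>x\<in>Ob X. p x) \<and>
      Comp FC F Y F (\<lambda>x\<in>Ob X. i x) (\<lambda>x\<in>Ob X. p x) = e"
    using Y by (auto simp: retract_def functor_category_simps pi intro!: restrict_ext)
  then show ?thesis by blast
qed

text \<open>Averaging \<open>F(h)\<^sup>-\<^sup>1 S G(h)\<close> over all \<open>h\<close> from \<open>x\<close> to its representative turns a
  family \<open>S\<close> of quasi-inverses at the representatives into a natural one.\<close>

lemma FC_quasi_inverse: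
  assumes F: "is_functor X D F" and G: "is_functor X D G" and \<tau>: "\<tau> \<in> nat_trans X D F G"
  shows "\<exists>\<sigma>\<in>nat_trans X D G F. Comp FC F F G \<tau> (Comp FC F G F \<sigma> \<tau>) = \<tau>"
proof -
  note [simp] = F G transD(1)[OF \<tau>]
  have "\<exists>g. g \<in> Hom D (on_Ob G s) (on_Ob F s) \<and>
      Comp D (on_Ob F s) (on_Ob F s) (on_Ob G s) (\<tau> s) (Comp D (on_Ob F s) (on_Ob G s) (on_Ob F s) g (\<tau> s)) = \<tau> s"
    if "s \<in> Ob X" for s
    using D.quasi_inverse[of "on_Ob F s" "on_Ob G s" "\<tau> s"] that by auto
  \<comment> \<open>Quasi-inverses chosen without any naturality; those at representatives enter the
    average.\<close>
  then obtain S where S [simp]: "\<And>s. s \<in> Ob X \<Longrightarrow> S s \<in> Hom D (on_Ob G s) (on_Ob F s)"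
    and TST: "\<And>s. s \<in> Ob X \<Longrightarrow> Comp D (on_Ob F s) (on_Ob F s) (on_Ob G s) (\<tau> s)
      (Comp D (on_Ob F s) (on_Ob G s) (on_Ob F s) (S s) (\<tau> s)) = \<tau> s"
    by metis
  define ret where "ret x h = X.inverse_of x (r x) h" for x h
  have ret [simp]: "ret x h \<in> Hom X (r x) x" "Comp X x (r x) x (ret x h) h = Idt X x"
    if "x \<in> Ob X" "h \<in> Hom X x (r x)" for x h
    using X.inverse_of(1,2)[of x "r x" h] that by (simp_all add: ret_def)
  define A where "A x h = Comp D (on_Ob G x) (on_Ob F (r x)) (on_Ob F x) (on_Hom F (r x) x (ret x h))
    (Comp D (on_Ob G x) (on_Ob G (r x)) (on_Ob F (r x)) (S (r x)) (on_Hom G x (r x) h))" for x h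
  have A [simp]: "A x h \<in> Hom D (on_Ob G x) (on_Ob F x)" if "x \<in> Ob X" "h \<in> Hom X x (r x)" for x h
    using that by (simp add: A_def)
  define H where "H x = Hom X x (r x)" for x
  have fin: "finite (H x)" "card (H x) \<noteq> 0" if "x \<in> Ob X" for x
    using X.finite_Hom[OF that X.r_Ob[OF that]] X.ex_Hom_r[OF that] by (auto simp: H_def)
  \<comment> \<open>The divisor is the size of Hom(x, r x), nonzero because x is connected to its
    representative.\<close>
  define \<sigma> where "\<sigma> x = inverse (of_nat (card (H x))) \<odot>\<^bsub>Hom_vs D (on_Ob G x) (on_Ob F x)\<^esub>
    (\<Oplus>\<^bsub>Hom_vs D (on_Ob G x) (on_Ob F x)\<^esub>h\<in>H x. A x h)" for x
  have sumA [simp]: "(\<Oplus>\<^bsub>Hom_vs D (on_Ob G x) (on_Ob F x)\<^esub>h\<in>H x. A x h) \<in> Hom D (on_Ob G x) (on_Ob F x)"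
    if "x \<in> Ob X" for x
    using that by (intro D.Hom_closed(4)) (auto simp: H_def)
  have \<sigma>: "(\<lambda>x\<in>Ob X. \<sigma> x) \<in> nat_trans X D G F"
  proof (rule nat_transI)
    fix x y g assume x [simp]: "x \<in> Ob X" and y [simp]: "y \<in> Ob X" and g [simp]: "g \<in> Hom X x y"
    have r [simp]: "r x = r y" by (rule X.r_eq[OF x y g])
    have bij: "bij_betw (\<lambda>h. Comp X x y (r y) h g) (H y) (H x)"
      unfolding H_def r by (rule X.bij_betw_Comp_right) auto
    \<comment> \<open>Here k is the inverse of h g, so g k is the inverse of h, and G(h g) splits
      off G(g): the summand of x at h g matches the summand of y at h. Both contain the same
      \<open>S (r y)\<close>, as x and y share their representative.\<close>
    have AC: "Comp D (on_Ob G x) (on_Ob F x) (on_Ob F y) (on_Hom F x y g) (A x (Comp X x y (r y) h g)) =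
        Comp D (on_Ob G x) (on_Ob G y) (on_Ob F y) (A y h) (on_Hom G x y g)" if "h \<in> H y" for h
    proof -
      have h [simp]: "h \<in> Hom X y (r y)" using that by (simp add: H_def)
      define k where "k = ret x (Comp X x y (r y) h g)"
      have k: "k \<in> Hom X (r y) x" using ret(1)[of x "Comp X x y (r y) h g"] by (simp add: k_def)
      have gk: "Comp X (r y) x y g k = ret y h"
        using X.Comp_inverse_of_Comp[of x y "r y" g h] by (simp add: k_def ret_def)
      have "Comp D (on_Ob G x) (on_Ob F x) (on_Ob F y) (on_Hom F x y g) (A x (Comp X x y (r y) h g)) =
          Comp D (on_Ob G x) (on_Ob F (r y)) (on_Ob F y) (on_Hom F (r y) y (Comp X (r y) x y g k))
            (Comp D (on_Ob G x) (on_Ob G (r y)) (on_Ob F (r y)) (S (r y))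
              (on_Hom G x (r y) (Comp X x y (r y) h g)))"
        unfolding A_def k_def[symmetric] r using k by (simp add: functorD(4) D.Comp_assoc)
      also have "\<dots> = Comp D (on_Ob G x) (on_Ob G y) (on_Ob F y) (A y h) (on_Hom G x y g)"
        unfolding gk by (simp add: A_def functorD(4) D.Comp_assoc)
      finally show ?thesis .
    qed
    let ?V = "Hom_vs D (on_Ob G x) (on_Ob F y)"
    interpret V: abelian_group ?V by (rule D.Hom_abelian_group) auto
    have "Comp D (on_Ob G x) (on_Ob F x) (on_Ob F y) (on_Hom F x y g)
          (\<Oplus>\<^bsub>Hom_vs D (on_Ob G x) (on_Ob F x)\<^esub>h\<in>H x. A x h) =
        (\<Oplus>\<^bsub>?V\<^esub>h\<in>H x. Comp D (on_Ob G x) (on_Ob F x) (on_Ob F y) (on_Hom F x y g) (A x h))"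
      by (rule D.Comp_right(4)) (auto simp: H_def simp del: r)
    also have "\<dots> = (\<Oplus>\<^bsub>?V\<^esub>h\<in>(\<lambda>h. Comp X x y (r y) h g) ` H y.
        Comp D (on_Ob G x) (on_Ob F x) (on_Ob F y) (on_Hom F x y g) (A x h))"
      using bij by (simp add: bij_betw_def)
    also have "\<dots> = (\<Oplus>\<^bsub>?V\<^esub>h\<in>H y. Comp D (on_Ob G x) (on_Ob F x) (on_Ob F y) (on_Hom F x y g)
        (A x (Comp X x y (r y) h g)))"
    proof (rule V.add.finprod_reindex)
      show "(\<lambda>h. Comp D (on_Ob G x) (on_Ob F x) (on_Ob F y) (on_Hom F x y g) (A x h))
          \<in> (\<lambda>h. Comp X x y (r y) h g) ` H y \<rightarrow> carrier ?V"
        using bij unfolding bij_betw_def by (auto simp: D.carrier_Hom_vs H_def)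
    qed (use bij in \<open>simp add: bij_betw_def\<close>)
    also have "\<dots> = (\<Oplus>\<^bsub>?V\<^esub>h\<in>H y. Comp D (on_Ob G x) (on_Ob G y) (on_Ob F y) (A y h) (on_Hom G x y g))"
      by (rule D.Hom_finsum_cong) (auto simp: AC, auto simp: H_def)
    also have "\<dots> = Comp D (on_Ob G x) (on_Ob G y) (on_Ob F y)
        (\<Oplus>\<^bsub>Hom_vs D (on_Ob G y) (on_Ob F y)\<^esub>h\<in>H y. A y h) (on_Hom G x y g)"
      by (rule D.Comp_left(4)[symmetric]) (auto simp: H_def)
    \<comment> \<open>The normalizing factors at x and y agree, since \<open>bij\<close> gives the
      two hom-sets the same size.\<close>
    finally show "Comp D (on_Ob G x) (on_Ob G y) (on_Ob F y) (\<sigma> y) (on_Hom G x y g) =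
        Comp D (on_Ob G x) (on_Ob F x) (on_Ob F y) (on_Hom F x y g) (\<sigma> x)"
      using bij_betw_same_card[OF bij] by (simp add: \<sigma>_def D.Comp_left(3) D.Comp_right(3))
  qed (simp add: \<sigma>_def)
  have "Comp D (on_Ob F x) (on_Ob F x) (on_Ob G x) (\<tau> x) (Comp D (on_Ob F x) (on_Ob G x) (on_Ob F x) (\<sigma> x) (\<tau> x)) = \<tau> x"
    if x [simp]: "x \<in> Ob X" for x
  proof -
    let ?s = "r x"
    \<comment> \<open>Each single summand is already a quasi-inverse of \<tau> x: naturality moves
      \<tau> to the representative on both sides of \<open>S ?s\<close>, where \<open>TST\<close>
      applies, and then back.\<close>
    have TAT: "Comp D (on_Ob F x) (on_Ob F x) (on_Ob G x) (\<tau> x)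
        (Comp D (on_Ob F x) (on_Ob G x) (on_Ob F x) (A x h) (\<tau> x)) = \<tau> x" if "h \<in> H x" for h
    proof -
      have h [simp]: "h \<in> Hom X x (r x)" using that by (simp add: H_def)
      have n1: "Comp D (on_Ob F x) (on_Ob G x) (on_Ob G ?s) (on_Hom G x ?s h) (\<tau> x) =
          Comp D (on_Ob F x) (on_Ob F ?s) (on_Ob G ?s) (\<tau> ?s) (on_Hom F x ?s h)"
        by (rule transD(2)[OF \<tau>, symmetric]) auto
      have n2: "Comp D (on_Ob F ?s) (on_Ob F x) (on_Ob G x) (\<tau> x) (on_Hom F ?s x (ret x h)) =
          Comp D (on_Ob F ?s) (on_Ob G ?s) (on_Ob G x) (on_Hom G ?s x (ret x h)) (\<tau> ?s)"
        by (rule transD(2)[OF \<tau>]) auto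
      have "Comp D (on_Ob F x) (on_Ob F x) (on_Ob G x) (\<tau> x)
          (Comp D (on_Ob F x) (on_Ob G x) (on_Ob F x) (A x h) (\<tau> x)) =
        Comp D (on_Ob F x) (on_Ob F ?s) (on_Ob G x)
          (Comp D (on_Ob F ?s) (on_Ob F x) (on_Ob G x) (\<tau> x) (on_Hom F ?s x (ret x h)))
          (Comp D (on_Ob F x) (on_Ob G ?s) (on_Ob F ?s) (S ?s)
            (Comp D (on_Ob F x) (on_Ob G x) (on_Ob G ?s) (on_Hom G x ?s h) (\<tau> x)))"
        by (simp add: A_def D.Comp_assoc)
      also have "\<dots> = Comp D (on_Ob F x) (on_Ob G ?s) (on_Ob G x) (on_Hom G ?s x (ret x h))
          (Comp D (on_Ob F x) (on_Ob F ?s) (on_Ob G ?s)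
            (Comp D (on_Ob F ?s) (on_Ob F ?s) (on_Ob G ?s) (\<tau> ?s)
              (Comp D (on_Ob F ?s) (on_Ob G ?s) (on_Ob F ?s) (S ?s) (\<tau> ?s)))
            (on_Hom F x ?s h))"
        unfolding n1 n2 by (simp add: D.Comp_assoc)
      also have "\<dots> = Comp D (on_Ob F x) (on_Ob G x) (on_Ob G x)
          (on_Hom G x x (Comp X x ?s x (ret x h) h)) (\<tau> x)"
        unfolding TST[OF X.r_Ob[OF x]] n1[symmetric] by (simp add: functorD(4) D.Comp_assoc del: ret(2))
      also have "\<dots> = \<tau> x" by (simp add: functorD(3) D.Comp_Idt_left)
      finally show ?thesis .
    qed
    have "Comp D (on_Ob F x) (on_Ob F x) (on_Ob G x) (\<tau> x) (Comp D (on_Ob F x) (on_Ob G x) (on_Ob F x)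
        (\<Oplus>\<^bsub>Hom_vs D (on_Ob G x) (on_Ob F x)\<^esub>h\<in>H x. A x h) (\<tau> x)) =
      (\<Oplus>\<^bsub>Hom_vs D (on_Ob F x) (on_Ob G x)\<^esub>h\<in>H x. Comp D (on_Ob F x) (on_Ob F x) (on_Ob G x) (\<tau> x)
        (Comp D (on_Ob F x) (on_Ob G x) (on_Ob F x) (A x h) (\<tau> x)))"
      by (subst D.Comp_left(4), simp_all add: H_def, subst D.Comp_right(4), simp_all)
    also have "\<dots> = (\<Oplus>\<^bsub>Hom_vs D (on_Ob F x) (on_Ob G x)\<^esub>h\<in>H x. \<tau> x)"
      by (rule D.Hom_finsum_cong) (auto simp: TAT)
    also have "\<dots> = of_nat (card (H x)) \<odot>\<^bsub>Hom_vs D (on_Ob F x) (on_Ob G x)\<^esub> \<tau> x"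
      using fin by (intro D.Hom_finsum_const) auto
    finally show ?thesis
      using fin[OF x] D.Hom_vs_simps(4,5)[of "on_Ob F x" "on_Ob G x" "\<tau> x"]
      by (simp add: \<sigma>_def D.Comp_left(3) D.Comp_right(3) flip: D.Hom_vs_simps(5))
  qed
  then have "Comp FC F F G \<tau> (Comp FC F G F (\<lambda>x\<in>Ob X. \<sigma> x) \<tau>) = \<tau>"
    using transD(3)[OF \<tau>]
    by (auto simp: functor_category_simps restrict_def extensional_def fun_eq_iff)
  with \<sigma> show ?thesis by blast
qed

lemma regular_linear_category_FC: "regular_linear_category FC"
proof (intro regular_linear_category.intro regular_linear_category_axioms.intro linear_category_FC
    ex_null_functor)
  show "\<exists>B i p j q. binary_biproduct FC F G B i p j q" if "F \<in> Ob FC" "G \<in> Ob FC" for F G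
    using that ex_binary_biproduct_functor by (simp add: functor_category_simps(1))
  show "\<exists>Y i p. retract FC F Y i p \<and> Comp FC F Y F i p = e"
    if "F \<in> Ob FC" "e \<in> Hom FC F F" "Comp FC F F F e e = e" for F e
    using that FC_idempotent_split by (simp add: functor_category_simps(1,2))
  show "\<exists>\<sigma>\<in>Hom FC G F. Comp FC F F G \<tau> (Comp FC F G F \<sigma> \<tau>) = \<tau>"
    if "F \<in> Ob FC" "G \<in> Ob FC" "\<tau> \<in> Hom FC F G" for F G \<tau>
    using that FC_quasi_inverse by (simp add: functor_category_simps(1,2))
qed

text \<open>The coinduced functor \<open>x \<mapsto> c\<^bsup>Hom(x, s)\<^esup>\<close> represents \<open>F \<mapsto> Hom(F s, c)\<close>.\<close>

lemma ex_coinduced_functor: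
  assumes s: "s \<in> Ob X" and c: "c \<in> Ob D"
  obtains P where "is_functor X D P"
    "\<And>F l. is_functor X D F \<Longrightarrow> l \<in> Hom D (on_Ob F s) c \<Longrightarrow> l \<noteq> \<zero>\<^bsub>Hom_vs D (on_Ob F s) c\<^esub> \<Longrightarrow>
      \<exists>\<tau>\<in>nat_trans X D F P. \<tau> \<noteq> \<zero>\<^bsub>Hom_vs FC F P\<^esub>"
proof -
  note [simp] = s c
  \<comment> \<open>The universal property of the power of c by Hom(x, s), with projections \<pi> h;
    as a predicate it allows b and \<pi> to be chosen for all x together.\<close>
  define power where "power x b \<pi> \<longleftrightarrow> b \<in> Ob D \<and> (\<forall>h\<in>Hom X x s. \<pi> h \<in> Hom D b c) \<and>
    (\<forall>w\<in>Ob D. \<forall>u. (\<forall>h\<in>Hom X x s. u h \<in> Hom D w c) \<longrightarrow>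
      (\<exists>v\<in>Hom D w b. \<forall>h\<in>Hom X x s. Comp D w b c (\<pi> h) v = u h)) \<and>
    (\<forall>w\<in>Ob D. \<forall>u\<in>Hom D w b. \<forall>v\<in>Hom D w b.
      (\<forall>h\<in>Hom X x s. Comp D w b c (\<pi> h) u = Comp D w b c (\<pi> h) v) \<longrightarrow> u = v)" for x b \<pi>
  have "\<exists>b \<pi>. power x b \<pi>" if "x \<in> Ob X" for x
    unfolding power_def using that by (intro D.ex_power X.finite_Hom) auto
  then obtain b \<pi> where power: "\<And>x. x \<in> Ob X \<Longrightarrow> power x (b x) (\<pi> x)" by metis
  have b [simp]: "b x \<in> Ob D" if "x \<in> Ob X" for x
    using power[OF that] by (simp add: power_def)
  have \<pi> [simp]: "\<pi> x h \<in> Hom D (b x) c" if "x \<in> Ob X" "h \<in> Hom X x s" for x h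
    using power[OF that(1)] that(2) by (simp add: power_def)
  have lift: "\<exists>v. v \<in> Hom D w (b x) \<and> (\<forall>h\<in>Hom X x s. Comp D w (b x) c (\<pi> x h) v = u h)"
    if "x \<in> Ob X" "w \<in> Ob D" "\<And>h. h \<in> Hom X x s \<Longrightarrow> u h \<in> Hom D w c" for x w u
    using power[OF that(1)] that(2,3) unfolding power_def by blast
  have eqI: "u = v" if "x \<in> Ob X" "w \<in> Ob D" "u \<in> Hom D w (b x)" "v \<in> Hom D w (b x)"
    "\<And>h. h \<in> Hom X x s \<Longrightarrow> Comp D w (b x) c (\<pi> x h) u = Comp D w (b x) c (\<pi> x h) v" for x w u v
    using power[OF that(1)] that(2-5) unfolding power_def by blast
  \<comment> \<open>Coordinate h of the image is coordinate h f of the argument. Reindexing along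
    the contravariant x |-> Hom(x, s) makes the power covariant in x.\<close>
  define m where "m x y f = (SOME v. v \<in> Hom D (b x) (b y) \<and>
    (\<forall>h\<in>Hom X y s. Comp D (b x) (b y) c (\<pi> y h) v = \<pi> x (Comp X x y s h f)))" for x y f
  have m: "m x y f \<in> Hom D (b x) (b y) \<and>
    (\<forall>h\<in>Hom X y s. Comp D (b x) (b y) c (\<pi> y h) (m x y f) = \<pi> x (Comp X x y s h f))"
    if "x \<in> Ob X" "y \<in> Ob X" "f \<in> Hom X x y" for x y f
    unfolding m_def by (rule someI_ex, rule lift) (use that in auto)
  have m_Hom [simp]: "m x y f \<in> Hom D (b x) (b y)" if "x \<in> Ob X" "y \<in> Ob X" "f \<in> Hom X x y" for x y f
    using m[OF that] by simp
  have \<pi>m: "Comp D (b x) (b y) c (\<pi> y h) (m x y f) = \<pi> x (Comp X x y s h f)"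
    if "x \<in> Ob X" "y \<in> Ob X" "f \<in> Hom X x y" "h \<in> Hom X y s" for x y f h
    using m[OF that(1-3)] that(4) by simp
  have \<pi>m2: "Comp D w (b y) c (\<pi> y h) (Comp D w (b x) (b y) (m x y f) u) =
      Comp D w (b x) c (\<pi> x (Comp X x y s h f)) u"
    if "x \<in> Ob X" "y \<in> Ob X" "f \<in> Hom X x y" "h \<in> Hom X y s" "w \<in> Ob D" "u \<in> Hom D w (b x)"
    for w x y f h u
    using that by (simp add: \<pi>m flip: D.Comp_assoc)
  define P where "P = functor_of X b m"
  have P: "is_functor X D P"
    unfolding P_def
  proof (rule functor_ofI)
    fix x assume [simp]: "x \<in> Ob X"
    show "m x x (Idt X x) = Idt D (b x)"
      by (rule eqI[of x "b x"]) (simp_all add: \<pi>m X.Comp_Idt_right D.Comp_Idt_right)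
  next
    fix x y z f g assume [simp]: "x \<in> Ob X" "y \<in> Ob X" "z \<in> Ob X" "f \<in> Hom X x y" "g \<in> Hom X y z"
    show "m x z (Comp X x y z g f) = Comp D (b x) (b y) (b z) (m y z g) (m x y f)"
      by (rule eqI[of z "b x"]) (simp_all add: \<pi>m \<pi>m2 X.Comp_assoc)
  qed simp_all
  have P_simps [simp]: "on_Ob P x = b x" "y \<in> Ob X \<Longrightarrow> f \<in> Hom X x y \<Longrightarrow> on_Hom P x y f = m x y f"
    if "x \<in> Ob X" for x y f
    using that by (simp_all add: P_def)
  have "\<exists>\<tau>\<in>nat_trans X D F P. \<tau> \<noteq> \<zero>\<^bsub>Hom_vs FC F P\<^esub>"
    if F [simp]: "is_functor X D F" and l [simp]: "l \<in> Hom D (on_Ob F s) c"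
      and l0: "l \<noteq> \<zero>\<^bsub>Hom_vs D (on_Ob F s) c\<^esub>" for F l
  proof -
    \<comment> \<open>The transformation corresponding to l: its coordinate at h is l F(h).\<close>
    define \<tau> where "\<tau> x = (SOME v. v \<in> Hom D (on_Ob F x) (b x) \<and> (\<forall>h\<in>Hom X x s.
      Comp D (on_Ob F x) (b x) c (\<pi> x h) v = Comp D (on_Ob F x) (on_Ob F s) c l (on_Hom F x s h)))" for x
    have \<tau>: "\<tau> x \<in> Hom D (on_Ob F x) (b x) \<and> (\<forall>h\<in>Hom X x s.
      Comp D (on_Ob F x) (b x) c (\<pi> x h) (\<tau> x) = Comp D (on_Ob F x) (on_Ob F s) c l (on_Hom F x s h))"
      if "x \<in> Ob X" for x
      unfolding \<tau>_def by (rule someI_ex, rule lift) (use that in auto)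
    have \<tau>_Hom [simp]: "\<tau> x \<in> Hom D (on_Ob F x) (b x)" if "x \<in> Ob X" for x
      using \<tau>[OF that] by simp
    have \<pi>\<tau>: "Comp D (on_Ob F x) (b x) c (\<pi> x h) (\<tau> x) = Comp D (on_Ob F x) (on_Ob F s) c l (on_Hom F x s h)"
      if "x \<in> Ob X" "h \<in> Hom X x s" for x h
      using \<tau>[OF that(1)] that(2) by simp
    have "(\<lambda>x\<in>Ob X. \<tau> x) \<in> nat_trans X D F P"
    proof (rule nat_transI)
      fix x y f assume [simp]: "x \<in> Ob X" "y \<in> Ob X" "f \<in> Hom X x y"
      have "Comp D (on_Ob F x) (on_Ob F y) (b y) (\<tau> y) (on_Hom F x y f) =
          Comp D (on_Ob F x) (b x) (b y) (m x y f) (\<tau> x)"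
      proof (rule eqI[of y "on_Ob F x"])
        fix h assume [simp]: "h \<in> Hom X y s"
        have "Comp D (on_Ob F x) (b y) c (\<pi> y h) (Comp D (on_Ob F x) (on_Ob F y) (b y) (\<tau> y) (on_Hom F x y f)) =
            Comp D (on_Ob F x) (on_Ob F y) c (Comp D (on_Ob F y) (b y) c (\<pi> y h) (\<tau> y)) (on_Hom F x y f)"
          by (simp add: D.Comp_assoc)
        also have "\<dots> = Comp D (on_Ob F x) (b x) c (\<pi> x (Comp X x y s h f)) (\<tau> x)"
          by (simp add: \<pi>\<tau> D.Comp_assoc functorD(4))
        also have "\<dots> = Comp D (on_Ob F x) (b y) c (\<pi> y h) (Comp D (on_Ob F x) (b x) (b y) (m x y f) (\<tau> x))"
          by (simp add: \<pi>m2)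
        finally show "Comp D (on_Ob F x) (b y) c (\<pi> y h)
            (Comp D (on_Ob F x) (on_Ob F y) (b y) (\<tau> y) (on_Hom F x y f)) =
          Comp D (on_Ob F x) (b y) c (\<pi> y h) (Comp D (on_Ob F x) (b x) (b y) (m x y f) (\<tau> x))" .
      qed simp_all
      then show "Comp D (on_Ob F x) (on_Ob F y) (on_Ob P y) (\<tau> y) (on_Hom F x y f) =
          Comp D (on_Ob F x) (on_Ob P x) (on_Ob P y) (on_Hom P x y f) (\<tau> x)"
        by simp
    qed simp
    \<comment> \<open>The coordinate of \<tau> s at the identity of s is l itself.\<close>
    moreover have "\<tau> s \<noteq> \<zero>\<^bsub>Hom_vs D (on_Ob F s) (b s)\<^esub>"
    proof
      assume "\<tau> s = \<zero>\<^bsub>Hom_vs D (on_Ob F s) (b s)\<^esub>"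
      then show False
        using \<pi>\<tau>[of s "Idt X s"] l0 by (simp add: D.Comp_right functorD(3) D.Comp_Idt_right)
    qed
    then have "(\<lambda>x\<in>Ob X. \<tau> x) s \<noteq> \<zero>\<^bsub>Hom_vs FC F P\<^esub> s"
      by (simp add: functor_category_simps(6))
    then have "(\<lambda>x\<in>Ob X. \<tau> x) \<noteq> \<zero>\<^bsub>Hom_vs FC F P\<^esub>" by metis
    ultimately show ?thesis by blast
  qed
  with P show thesis by (rule that)
qed

text \<open>A nonzero F has a nonzero value at some x, hence at \<open>r x\<close>, because the
  identity of F(x) factors through F(r x). A nonzero map from there to c corresponds to a nonzero
  transformation into the functor coinduced at \<open>r x\<close>, so these finitely many functors
  cogenerate.\<close>

theorem KV_2_vector_space_FC:
  assumes c: "c \<in> Ob D"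
    and cogen: "\<And>d. d \<in> Ob D \<Longrightarrow> Idt D d \<noteq> \<zero>\<^bsub>Hom_vs D d d\<^esub> \<Longrightarrow> \<exists>f\<in>Hom D d c. f \<noteq> \<zero>\<^bsub>Hom_vs D d c\<^esub>"
  shows "KV_2_vector_space FC"
proof -
  have "\<exists>P. is_functor X D P \<and> (\<forall>F l. is_functor X D F \<longrightarrow> l \<in> Hom D (on_Ob F s) c \<longrightarrow>
      l \<noteq> \<zero>\<^bsub>Hom_vs D (on_Ob F s) c\<^esub> \<longrightarrow> (\<exists>\<tau>\<in>nat_trans X D F P. \<tau> \<noteq> \<zero>\<^bsub>Hom_vs FC F P\<^esub>))"
    if "s \<in> Ob X" for s
    by (rule ex_coinduced_functor[OF that c]) blast
  then obtain P where P: "\<And>s. s \<in> Ob X \<Longrightarrow> is_functor X D (P s)"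
    and P_Hom: "\<And>s F l. s \<in> Ob X \<Longrightarrow> is_functor X D F \<Longrightarrow> l \<in> Hom D (on_Ob F s) c \<Longrightarrow>
      l \<noteq> \<zero>\<^bsub>Hom_vs D (on_Ob F s) c\<^esub> \<Longrightarrow> \<exists>\<tau>\<in>nat_trans X D F (P s). \<tau> \<noteq> \<zero>\<^bsub>Hom_vs FC F (P s)\<^esub>"
    by metis
  interpret FC: regular_linear_category FC by (rule regular_linear_category_FC)
  show ?thesis
  proof (rule FC.KV_2_vector_spaceI[of "P ` r ` Ob X"])
    show "finite (P ` r ` Ob X)" using X.finite_r by simp
    show "P ` r ` Ob X \<subseteq> Ob FC" using P by (auto simp: functor_category_simps)
    fix F assume "F \<in> Ob FC" and ne: "Idt FC F \<noteq> \<zero>\<^bsub>Hom_vs FC F F\<^esub>"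
    then have F [simp]: "is_functor X D F" by (simp add: functor_category_simps)
    obtain x where x [simp]: "x \<in> Ob X" and "Idt D (on_Ob F x) \<noteq> \<zero>\<^bsub>Hom_vs D (on_Ob F x) (on_Ob F x)\<^esub>"
      using ne by (force simp: functor_category_simps intro: restrict_ext)
    have "Idt D (on_Ob F (r x)) \<noteq> \<zero>\<^bsub>Hom_vs D (on_Ob F (r x)) (on_Ob F (r x))\<^esub>"
    proof
      assume 0: "Idt D (on_Ob F (r x)) = \<zero>\<^bsub>Hom_vs D (on_Ob F (r x)) (on_Ob F (r x))\<^esub>"
      obtain h where h [simp]: "h \<in> Hom X x (r x)" using X.ex_Hom_r[OF x] by blast
      define k where "k = X.inverse_of x (r x) h"
      have k [simp]: "k \<in> Hom X (r x) x" "Comp X x (r x) x k h = Idt X x"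
        using X.inverse_of(1,2)[OF x _ h] by (simp_all add: k_def)
      have "Idt D (on_Ob F x) = Comp D (on_Ob F x) (on_Ob F (r x)) (on_Ob F x) (on_Hom F (r x) x k)
          (Comp D (on_Ob F x) (on_Ob F (r x)) (on_Ob F (r x)) (Idt D (on_Ob F (r x))) (on_Hom F x (r x) h))"
        using functorD(4)[OF F, of x "r x" x h k] by (simp add: D.Comp_Idt_left functorD(3))
      also have "\<dots> = \<zero>\<^bsub>Hom_vs D (on_Ob F x) (on_Ob F x)\<^esub>"
        unfolding 0 by (simp add: D.Comp_left D.Comp_right)
      finally show False using \<open>Idt D (on_Ob F x) \<noteq> _\<close> by simp
    qed
    then obtain l where "l \<in> Hom D (on_Ob F (r x)) c" "l \<noteq> \<zero>\<^bsub>Hom_vs D (on_Ob F (r x)) c\<^esub>"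
      using cogen[of "on_Ob F (r x)"] by auto
    then show "\<exists>G\<in>P ` r ` Ob X. \<exists>\<tau>\<in>Hom FC F G. \<tau> \<noteq> \<zero>\<^bsub>Hom_vs FC F G\<^esub>"
      using P_Hom[of "r x" F l] by (auto simp: functor_category_simps(2))
  qed
qed

end

theorem lemma4p1p1:
  fixes X :: "('o, 'm) category"
  assumes "groupoid X"
    and "essentially_finite X"
  shows "KV_2_vector_space
    (Rep X :: (('o, 'm, (complex, 'v) module, 'v \<Rightarrow> 'v) cat_functor, 'o \<Rightarrow> 'v \<Rightarrow> 'v) linear_category)"
proof -
  obtain r where r: "represented_groupoid X r"
    by (rule essentially_finite_represented[OF assms])
  obtain c :: "(complex, 'v) module" where c: "c \<in> Ob Vect"
    "\<And>d. d \<in> Ob Vect \<Longrightarrow> Idt Vect d \<noteq> \<zero>\<^bsub>Hom_vs Vect d d\<^esub> \<Longrightarrow> \<exists>f\<in>Hom Vect d c. f \<noteq> \<zero>\<^bsub>Hom_vs Vect d c\<^esub>"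
    using ex_Vect_cogenerator by blast
  interpret groupoid_functor_category X r "Vect :: ((complex, 'v) module, 'v \<Rightarrow> 'v) linear_category"
    by (intro groupoid_functor_category.intro r regular_linear_category_Vect)
  show ?thesis unfolding Rep_def by (rule KV_2_vector_space_FC[OF c])
qed

end
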